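(* Let $\Omega=\mathbb{R}^2\setminus B$, where $B$ is a bounded simply connected domain with piecewise smooth boundary, and let $\Phi$ be a Riemann (conformal) map of $\Omega$ onto $B_{r_0}$ whose inverse is represented by an absolutely convergent series $$\Phi^{-1}(z)=z+\sum_{n=1}^\infty\frac{b_n}{z^n}.$$ Let $\mathbf{v}_0$ be an initial datum on $\Omega$ with $(\operatorname{curl}\mathbf{v}_0)(\Phi^{-1}(\cdot))\in L_1(B_{r_0})$ satisfying the no-slip condition $\mathbf{v}_0=0$ on $\partial\Omega$, the infinity condition $\mathbf{v}_0(\mathbf{x})\to\mathbf{v}_\infty$ as $|\mathbf{x}|\to\infty$, and the zero-circularity condition $\lim_{R\to\infty}\oint_{|\mathbf{x}|=R}\mathbf{v}_0\cdot d\mathbf{l}=0$. Let $\mathbf{v}(t,\mathbf{x})$ be the solution in $\Omega$ of the Stokes problem $$\partial_t\mathbf{v}-\Delta\mathbf{v}=\nabla p,\quad \operatorname{div}\mathbf{v}=0,\quad \mathbf{v}(0,\mathbf{x})=\mathbf{v}_0(\mathbf{x}),\quad \mathbf{v}(t,\mathbf{x})=0\ \text{ on }\partial\Omega,\quad \mathbf{v}(t,\mathbf{x})\to\mathbf{v}_\infty\ \text{ as }|\mathbf{x}|\to\infty .$$ Then the function $w(t,\mathbf{x})=(\operatorname{curl}\mathbf{v})(t,\Phi^{-1}(\mathbf{x}))$, $\mathbf{x}\in B_{r_0}$, satisfies $$r_0\frac{\partial w_k(t,r)}{\partial r}\Big|_{r=r_0}+|k|\,w_k(t,r_0)=0,\qquad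 k\in\mathbb{Z}.$$
   Context: Points $\mathbf{x}=(x_1,x_2)\in\mathbb{R}^2$ are identified with $z=x_1+ix_2=re^{i\varphi}\in\mathbb{C}$; for $\mathbf{v}=(v_1,v_2)$, $\operatorname{curl}\mathbf{v}=\partial_{x_1}v_2-\partial_{x_2}v_1$; $p(t,\mathbf{x})$ is the scalar pressure. Here $r_0>0$, $B_{r_0}=\{\mathbf{x}\in\mathbb{R}^2:|\mathbf{x}|>r_0\}$, and $\mathbf{v}_\infty\in\mathbb{R}^2$ is a given constant vector. The Riemann map is normalized by $\Phi(z)=z+O(1/z)$, $\Phi'(z)=1+O(1/z^2)$ as $z\to\infty$. For a function $w$ on $B_{r_0}$, $w_k(t,r)=\frac1{2\pi}\int_0^{2\pi}w(t,r,\varphi)e^{-ik\varphi}\,d\varphi$ is its $k$-th angular Fourier coefficient. *)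

theory Defs
  imports "HOL-Analysis.Analysis" "HOL-Library.Landau_Symbols"
begin

text \<open>The plane is identified with the complex numbers: a point is \<open>z = x1 + i x2\<close>, and a planar
  vector field \<open>(v1, v2)\<close> is the complex-valued function \<open>v1 + i v2\<close>.\<close>

text \<open>Derivative in the direction \<open>e\<close>; thus \<open>pd 1\<close> and \<open>pd \<i>\<close> are the partial derivatives in
  \<open>x1\<close> and \<open>x2\<close>.\<close>

definition pd :: "complex \<Rightarrow> (complex \<Rightarrow> 'a::real_normed_vector) \<Rightarrow> complex \<Rightarrow> 'a" where
  "pd e f x = vector_derivative (\<lambda>s. f (x + s *\<^sub>R e)) (at 0)"

definition grad :: "(complex \<Rightarrow> real) \<Rightarrow> complex \<Rightarrow> complex" where
  "grad q x = Complex (pd 1 q x) (pd \<i> q x)"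

definition curl :: "(complex \<Rightarrow> complex) \<Rightarrow> complex \<Rightarrow> real" where
  "curl u x = pd 1 (\<lambda>y. Im (u y)) x - pd \<i> (\<lambda>y. Re (u y)) x"

definition divergence :: "(complex \<Rightarrow> complex) \<Rightarrow> complex \<Rightarrow> real" where
  "divergence u x = pd 1 (\<lambda>y. Re (u y)) x + pd \<i> (\<lambda>y. Im (u y)) x"

definition laplacian :: "(complex \<Rightarrow> 'a::real_normed_vector) \<Rightarrow> complex \<Rightarrow> 'a" where
  "laplacian f x = pd 1 (pd 1 f) x + pd \<i> (pd \<i> f) x"

definition time_deriv :: "(real \<Rightarrow> complex \<Rightarrow> complex) \<Rightarrow> real \<Rightarrow> complex \<Rightarrow> complex" where
  "time_deriv v t x = vector_derivative (\<lambda>s. v s x) (at t)"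

definition circulation :: "(complex \<Rightarrow> complex) \<Rightarrow> real \<Rightarrow> real" where
  "circulation u R =
     integral {0..2 * pi} (\<lambda>\<phi>. u (of_real R * cis \<phi>) \<bullet> (of_real R * (\<i> * cis \<phi>)))"

definition exterior_disc :: "real \<Rightarrow> complex set" where
  "exterior_disc r0 = {z. norm z > r0}"

definition angular_coeff :: "int \<Rightarrow> (complex \<Rightarrow> real) \<Rightarrow> real \<Rightarrow> complex" where
  "angular_coeff k w r =
     of_real (1 / (2 * pi)) *
       integral {0..2 * pi} (\<lambda>\<phi>. of_real (w (of_real r * cis \<phi>)) * cis (- (of_int k * \<phi>)))"

text \<open>A path made of finitely many regular \<open>C\<^sup>1\<close> arcs. Each arc is \<open>C\<^sup>1\<close> up to and including its end
  points, with nonzero one-sided derivatives there; corners and cusps are allowed at the break points.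
  (The library's \<open>valid_path\<close> puts no restriction on the derivative near the break points.)\<close>

definition regular_arc_on :: "real \<Rightarrow> real \<Rightarrow> (real \<Rightarrow> complex) \<Rightarrow> bool" where
  "regular_arc_on a b g \<longleftrightarrow>
     (\<exists>g'. (\<forall>s\<in>{a..b}. (g has_vector_derivative g' s) (at s within {a..b}) \<and> g' s \<noteq> 0) \<and>
           continuous_on {a..b} g')"

definition piecewise_smooth_path :: "(real \<Rightarrow> complex) \<Rightarrow> bool" where
  "piecewise_smooth_path g \<longleftrightarrow>
     (\<exists>(n::nat) \<tau>. \<tau> 0 = 0 \<and> \<tau> n = 1 \<and>
        (\<forall>i<n. \<tau> i < \<tau> (Suc i) \<and> regular_arc_on (\<tau> i) (\<tau> (Suc i)) g))"

definition piecewise_smooth_domain :: "complex set \<Rightarrow> bool" where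
  "piecewise_smooth_domain B \<longleftrightarrow>
     B \<noteq> {} \<and> open B \<and> connected B \<and> bounded B \<and> simply_connected B \<and>
     (\<exists>g. simple_path g \<and> pathfinish g = pathstart g \<and> piecewise_smooth_path g \<and>
          frontier B = path_image g)"

definition riemann_map_onto_exterior ::
  "complex set \<Rightarrow> real \<Rightarrow> (complex \<Rightarrow> complex) \<Rightarrow> bool" where
  "riemann_map_onto_exterior \<Omega> r0 \<Phi> \<longleftrightarrow>
     \<Phi> holomorphic_on \<Omega> \<and> bij_betw \<Phi> \<Omega> (exterior_disc r0) \<and>
     (\<lambda>z. \<Phi> z - z) \<in> O[at_infinity](\<lambda>z. 1 / z) \<and>
     (\<lambda>z. deriv \<Phi> z - 1) \<in> O[at_infinity](\<lambda>z. 1 / z\<^sup>2)"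

text \<open>Classical regularity for positive times. In the interior \<open>v\<close> is \<open>C\<^sup>1\<close> in time and \<open>C\<^sup>2\<close> in space.
  Up to the boundary only \<open>v\<close> and its time derivative are required to be continuous: near corners the
  spatial derivatives of \<open>v\<close>, in particular the vorticity, may be unbounded. The gradient of the
  pressure is then continuous by the Stokes equation.\<close>

definition stokes_regular ::
  "complex set \<Rightarrow> (real \<Rightarrow> complex \<Rightarrow> complex) \<Rightarrow> (real \<Rightarrow> complex \<Rightarrow> real) \<Rightarrow> bool" where
  "stokes_regular \<Omega> v p \<longleftrightarrow>
     continuous_on ({0<..} \<times> closure \<Omega>) (\<lambda>(t, x). v t x) \<and>
     (\<forall>t>0. \<forall>x\<in>closure \<Omega>. (\<lambda>s. v s x) differentiable (at t)) \<and>
     continuous_on ({0<..} \<times> closure \<Omega>) (\<lambda>(t, x). time_deriv v t x) \<and>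
     (\<forall>t>0. v t differentiable_on \<Omega> \<and> p t differentiable_on \<Omega>) \<and>
     (\<forall>a\<in>{1, \<i>}.
        (\<forall>t>0. pd a (v t) differentiable_on \<Omega>) \<and>
        continuous_on ({0<..} \<times> \<Omega>) (\<lambda>(t, x). pd a (v t) x) \<and>
        (\<forall>c\<in>{1, \<i>}. continuous_on ({0<..} \<times> \<Omega>) (\<lambda>(t, x). pd c (pd a (v t)) x)))"

definition stokes_solution ::
  "complex set \<Rightarrow> (complex \<Rightarrow> complex) \<Rightarrow> complex \<Rightarrow>
   (real \<Rightarrow> complex \<Rightarrow> complex) \<Rightarrow> (real \<Rightarrow> complex \<Rightarrow> real) \<Rightarrow> bool" where
  "stokes_solution \<Omega> v0 v_inf v p \<longleftrightarrow>
     stokes_regular \<Omega> v p \<and>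
     (\<forall>t>0. \<forall>x\<in>\<Omega>. time_deriv v t x - laplacian (v t) x = grad (p t) x) \<and>
     (\<forall>t>0. \<forall>x\<in>\<Omega>. divergence (v t) x = 0) \<and>
     continuous_on ({0..} \<times> \<Omega>) (\<lambda>(t, x). v t x) \<and> (\<forall>x\<in>\<Omega>. v 0 x = v0 x) \<and>
     (\<forall>t>0. \<forall>x\<in>frontier \<Omega>. v t x = 0) \<and>
     (\<forall>t>0. (v t \<longlongrightarrow> v_inf) at_infinity)"

text \<open>The condition \<open>r0 f'(r0) + m f(r0) = 0\<close> for a function \<open>f\<close> given on \<open>r > r0\<close>. The values
  \<open>f(r0)\<close> and \<open>f'(r0)\<close> are those of a \<open>C\<^sup>1\<close> extension \<open>F\<close> of \<open>f\<close> to \<open>r \<ge> r0\<close> (necessarily unique),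
  whose existence is part of the assertion.\<close>

definition robin_condition_at :: "real \<Rightarrow> real \<Rightarrow> (real \<Rightarrow> complex) \<Rightarrow> bool" where
  "robin_condition_at r0 m f \<longleftrightarrow>
     (\<exists>F F'. (\<forall>r>r0. F r = f r) \<and>
        (\<forall>r\<ge>r0. (F has_vector_derivative F' r) (at r within {r0..})) \<and>
        continuous_on {r0..} F' \<and>
        of_real r0 * F' r0 + of_real m * F r0 = 0)"

end

theory Submission
  imports Defs "HOL-Complex_Analysis.Complex_Analysis"
begin

text \<open>Write \<open>\<Psi>\<close> for the inverse of \<open>\<Phi>\<close>, and put \<open>\<omega> = curl v\<close>, \<open>\<kappa> = \<partial>1 \<omega> - i \<partial>2 \<omega>\<close>, \<open>h = \<partial>1 p - i \<partial>2 p\<close>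
  and \<open>g = cnj (\<partial>t v)\<close>. For a divergence-free field the Laplacian is the rotated gradient of the
  vorticity, so that the Stokes equation takes the form \<open>h = g + i \<kappa>\<close>. On \<open>z = r cis \<phi>\<close> the
  operator \<open>r \<partial>r - i \<partial>\<phi>\<close> is \<open>2 z \<partial>z\<close>. Applied to \<open>\<omega> \<circ> \<Psi>\<close> and combined with the Stokes equation it
  gives, for the Fourier coefficients \<open>w\<^sub>k\<close> of \<open>\<omega> \<circ> \<Psi>\<close>,

  \<open>r w\<^sub>k'(r) + k w\<^sub>k(r) = i (G\<^sub>k(r) - H\<^sub>k(r))\<close>,

  where \<open>G\<^sub>k\<close> and \<open>H\<^sub>k\<close> are the Fourier coefficients of \<open>z g(\<Psi> z) \<Psi>'(z)\<close> and \<open>z h(\<Psi> z) \<Psi>'(z)\<close>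
  (\<open>vorticity_coeff_derivative\<close>). The vorticity is real, so it is enough to treat \<open>k \<ge> 0\<close>. Two
  facts then yield the boundary condition.

  The pressure drops out. Both \<open>\<partial>t v\<close> and the Laplacian of \<open>v\<close> have zero flux through triangles,
  hence \<open>h\<close> is holomorphic (\<open>h_holomorphic\<close>) and \<open>H\<^sub>k(r)\<close> is a multiple of \<open>r ^ k\<close>. For \<open>k \<ge> 1\<close> it
  vanishes because \<open>h\<close> vanishes at infinity in the mean over suitable time intervals. The
  convergence \<open>v \<longlonglongrightarrow> v_inf\<close> holds for each time separately; Baire's theorem supplies, inside every
  time interval, a smaller one on which \<open>v\<close> is bounded near infinity
  (\<open>velocity_bounded_on_subinterval\<close>). Comparing mean values over large circles shows that there
  \<open>\<integral> h dt\<close> tends to \<open>0\<close> at infinity (\<open>time_integral_h_bound\<close>), and continuity in time extends \<open>H\<^sub>k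
  = 0\<close> to all times (\<open>pressure_coeff_zero\<close>). For \<open>k = 0\<close> the coefficient \<open>H\<^sub>0\<close> is real because \<open>p\<close>
  is single-valued, and only the real part of the identity matters.

  The velocity term tends to \<open>0\<close> as \<open>r \<longlonglongrightarrow> r0\<close>. By the no-slip condition \<open>g \<circ> \<Psi>\<close> tends to \<open>0\<close>
  uniformly at the circle, and the lengths \<open>\<integral> |\<Psi>'(r cis \<phi>)| r d\<phi>\<close> of the level curves stay bounded
  (\<open>integral_means_bounded\<close>). The second statement is the theorem of F. and M. Riesz for a
  rectifiable Jordan curve. Its proof has three steps. First, \<open>\<Phi>\<close> is uniformly continuous near the
  boundary (\<open>\<Phi>_uniformly_continuous_near_boundary\<close>): the exterior of a Jordan curve is locally
  connected at the curve by Janiszewski's theorem, and a bounded zero-free holomorphic function on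
  a disc cannot be small along paths that approach the circle and cross a fixed sector
  (\<open>no_small_crossing\<close>). Secondly, the curve is covered by many short pieces; by uniform
  continuity each of them meets the images of at most three of \<open>N\<close> equal arcs of a circle close to
  \<open>|z| = r0\<close>, which bounds the sum of the \<open>N\<close> chords independently of \<open>N\<close>. Thirdly, the maximum
  principle extends this bound to all radii.

  Finally \<open>r ^ k w\<^sub>k(r)\<close> has a derivative that tends to \<open>0\<close> at \<open>r0\<close>, so it extends continuously
  differentiably with derivative \<open>0\<close> at \<open>r0\<close>. This is the asserted condition
  (\<open>robin_condition_of_limit\<close>).\<close>

section \<open>Bounded holomorphic functions along paths crossing a sector\<close>

lemma winding_number_log_lift:
  assumes "path q" "\<And>t. t \<in> {0..1} \<Longrightarrow> p t = z + exp (q t)"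
  shows "winding_number p z = (q 1 - q 0) / (2 * of_real pi * \<i>)"
proof -
  have "winding_number p z = winding_number (\<lambda>t. p t - z) 0"
    by (rule winding_number_offset)
  also have "\<dots> = winding_number (exp \<circ> q) 0"
    by (rule winding_number_cong) (use assms in auto)
  also have "\<dots> = (q 1 - q 0) / (2 * of_real pi * \<i>)"
    using winding_number_compose_exp[OF assms(1)] by (simp add: pathfinish_def pathstart_def)
  finally show ?thesis .
qed

lemma Re_div_2pi_i: "Re (w / (2 * of_real pi * \<i>)) = Im w / (2 * pi)"
proof -
  have "w / (2 * of_real pi * \<i>) = - (\<i> * w) / of_real (2 * pi)"
    by (simp add: field_simps)
  then show ?thesis by (simp only: Re_divide_of_real) simp
qed

lemma Im_Ln_pos: "Im z > 0 \<Longrightarrow> Im (Ln z) > 0"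
  by (metis Im_Ln_pos_lt complex.sel(2) less_irrefl zero_complex.simps(2))

lemma Im_Ln_neg: "Im z < 0 \<Longrightarrow> Im (Ln z) < 0"
  using Im_Ln_pos_le[of z] Im_Ln_le_pi[of z] by (cases "z = 0") (auto simp: not_le[symmetric])

text \<open>Winding numbers of open paths are read off from logarithms of the difference to the base point.
  For a loop composed of such paths the signs of the real parts already decide whether it winds
  around a point.\<close>

lemma radial_segment_winding:
  fixes a :: complex and x :: real
  assumes "x > 0" "Im a \<noteq> 0"
  shows "of_real x \<notin> closed_segment 0 a"
    and "Re (winding_number (linepath 0 a) (of_real x)) = Im (Ln (1 - a / of_real x)) / (2 * pi)"
proof -
  show nin: "of_real x \<notin> closed_segment 0 a"
  proof
    assume "of_real x \<in> closed_segment 0 a"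
    then obtain t where t: "of_real x = t *\<^sub>R a" by (auto simp: in_segment)
    then have "Im (of_real x) = t * Im a" by simp
    with assms have "t = 0" by simp
    with t assms show False by simp
  qed
  define q where "q t = Ln (1 - of_real t * a / of_real x) + Ln (- of_real x)" for t :: real
  have nonpos: "1 - of_real t * a / of_real x \<notin> \<real>\<^sub>\<le>\<^sub>0" for t :: real
  proof (cases "t = 0")
    case False
    have "Im (1 - of_real t * a / of_real x) \<noteq> 0" using False assms
      by (simp add: Im_divide_of_real)
    then show ?thesis by (auto simp: complex_nonpos_Reals_iff)
  qed simp
  have pq: "path q"
    unfolding path_def q_def
    using nonpos by (intro continuous_intros) (use assms in auto)
  have ex: "linepath 0 a t = of_real x + exp (q t)" if "t \<in> {0..1}" for t
  proof -
    have "1 - of_real t * a / of_real x \<noteq> 0" using nonpos[of t] by auto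
    then have "exp (q t) = (1 - of_real t * a / of_real x) * (- of_real x)"
      using assms by (simp add: q_def exp_add)
    also have "\<dots> = of_real t * a - of_real x" using assms by (simp add: field_simps)
    finally show ?thesis by (simp add: linepath_def scaleR_conv_of_real)
  qed
  have "winding_number (linepath 0 a) (of_real x) = (q 1 - q 0) / (2 * of_real pi * \<i>)"
    by (rule winding_number_log_lift[OF pq ex])
  then show "Re (winding_number (linepath 0 a) (of_real x)) = Im (Ln (1 - a / of_real x)) / (2 * pi)"
    by (simp only: Re_div_2pi_i) (simp add: q_def)
qed

text \<open>The loop \<open>\<Lambda>\<close> leaves \<open>0\<close> along one ray, follows \<open>exp \<circ> P\<close> and returns along another ray. The
  point \<open>x\<close> lies between the rays and closer to \<open>0\<close> than the path. Each of the three pieces has a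
  winding number about \<open>x\<close> with positive real part, so the loop winds around \<open>x\<close>.\<close>

lemma radial_loop_encloses:
  fixes P :: "real \<Rightarrow> complex" and x \<psi> :: real
  defines "\<Lambda> \<equiv> linepath 0 (exp (P 0)) +++ (exp \<circ> P) +++ linepath (exp (P 1)) 0"
  assumes P: "path P" and "0 < x" and far: "\<And>t. t \<in> {0..1} \<Longrightarrow> x < norm (exp (P t))"
    and \<psi>: "0 < \<psi>" "\<psi> < pi" and ends: "Im (P 0) = - \<psi>" "Im (P 1) = \<psi>"
  shows "of_real x \<in> inside (path_image \<Lambda>)"
proof -
  let ?x = "complex_of_real x"
  let ?a = "exp (P 0)" and ?b = "exp (P 1)"
  let ?\<tau> = "exp \<circ> P"
  have Ima: "Im ?a < 0" and Imb: "Im ?b > 0"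
    using \<psi> ends by (auto simp: Im_exp sin_gt_zero)
  have pt: "path ?\<tau>" using P unfolding path_def by (intro continuous_on_compose continuous_intros)
  have x_tau: "?x \<notin> path_image ?\<tau>"
  proof
    assume "?x \<in> path_image ?\<tau>"
    then obtain t where t: "t \<in> {0..1}" "?x = exp (P t)" by (auto simp: path_image_def)
    show False using far[OF t(1)] \<open>0 < x\<close> unfolding t(2)[symmetric] by simp
  qed
  have Re_pos: "Re (1 - ?x * exp (- P t)) > 0" if "t \<in> {0..1}" for t
  proof -
    have "norm (?x * exp (- P t)) < 1"
      using far[OF that] \<open>0 < x\<close> by (simp add: norm_mult norm_divide exp_minus norm_inverse field_simps)
    then show ?thesis using complex_Re_le_cmod[of "?x * exp (- P t)"] by simp
  qed
  define q where "q t = P t + Ln (1 - ?x * exp (- P t))" for t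
  have "path q"
    unfolding path_def q_def
    using Re_pos P unfolding path_def
    by (intro continuous_intros) (auto simp: complex_nonpos_Reals_iff not_le)
  moreover have "?\<tau> t = ?x + exp (q t)" if "t \<in> {0..1}" for t
  proof -
    have "1 - ?x * exp (- P t) \<noteq> 0" using Re_pos[OF that]
      by (metis less_irrefl zero_complex.simps(1))
    then show ?thesis by (simp add: q_def exp_add field_simps exp_minus)
  qed
  ultimately have wt: "winding_number ?\<tau> ?x = (q 1 - q 0) / (2 * of_real pi * \<i>)"
    by (rule winding_number_log_lift)
  have "Im (exp (- P 1)) < 0" "Im (exp (- P 0)) > 0"
    using \<psi> ends by (auto simp: Im_exp sin_gt_zero)
  then have "Im (Ln (1 - ?x * exp (- P 1))) > 0" "Im (Ln (1 - ?x * exp (- P 0))) < 0"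
    using \<open>0 < x\<close> by (auto intro!: Im_Ln_pos Im_Ln_neg simp: mult_less_0_iff)
  then have "Im (q 1 - q 0) > 0" using ends \<psi> by (simp add: q_def)
  then have 2: "Re (winding_number ?\<tau> ?x) > 0"
    unfolding wt Re_div_2pi_i by simp
  have ne: "?x \<notin> closed_segment 0 ?a" "?x \<notin> closed_segment 0 ?b"
    using radial_segment_winding(1)[OF \<open>0 < x\<close>] Ima Imb by (metis less_irrefl)+
  have 1: "Re (winding_number (linepath 0 ?a) ?x) > 0"
    unfolding radial_segment_winding(2)[OF \<open>0 < x\<close> less_imp_neq[OF Ima]] using Ima \<open>0 < x\<close>
    by (intro divide_pos_pos Im_Ln_pos) (auto simp: Im_divide_of_real divide_neg_pos)
  have "Re (winding_number (linepath 0 ?b) ?x) < 0"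
    unfolding radial_segment_winding(2)[OF \<open>0 < x\<close> less_imp_neq[OF Imb, symmetric]] using Imb \<open>0 < x\<close>
    by (intro divide_neg_pos Im_Ln_neg) (auto simp: Im_divide_of_real)
  moreover have "winding_number (linepath ?b 0) ?x = - winding_number (linepath 0 ?b) ?x"
    using winding_number_reversepath[of "linepath 0 ?b" ?x] ne by simp
  ultimately have 3: "Re (winding_number (linepath ?b 0) ?x) > 0" by simp
  have sf: "pathfinish ?\<tau> = ?b" "pathstart ?\<tau> = ?a" by (auto simp: pathfinish_def pathstart_def)
  have ne': "?x \<notin> closed_segment ?b 0" using ne closed_segment_commute by metis
  have jn: "path \<Lambda>" "pathfinish \<Lambda> = pathstart \<Lambda>" using pt sf by (auto simp: \<Lambda>_def)
  have im: "path_image \<Lambda> = closed_segment 0 ?a \<union> path_image ?\<tau> \<union> closed_segment ?b 0"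
    using sf by (auto simp: \<Lambda>_def path_image_join)
  have "winding_number \<Lambda> ?x = winding_number (linepath 0 ?a) ?x + (winding_number ?\<tau> ?x
            + winding_number (linepath ?b 0) ?x)"
    unfolding \<Lambda>_def using pt sf ne ne' x_tau
    by (subst winding_number_join; auto simp: path_image_join)+
  then have "winding_number \<Lambda> ?x \<noteq> 0" using 1 2 3
    by (metis add_pos_pos less_irrefl plus_complex.simps(1) zero_complex.simps(1))
  then have "?x \<notin> outside (path_image \<Lambda>)"
    using winding_number_zero_in_outside[OF jn] by blast
  moreover have "?x \<notin> path_image \<Lambda>" unfolding im using ne ne' x_tau by auto
  ultimately show ?thesis using inside_Un_outside by blast
qed

text \<open>The maximum principle inside the loop of the previous lemma, for \<open>f u * exp (c u)\<close>. The weight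
  has modulus at most \<open>exp (c \<rho> cos \<psi>)\<close> on the two radii, where only \<open>|f| \<le> M\<close> is known, and at
  most \<open>exp (c \<rho>)\<close> on the path, where \<open>f\<close> is small; at \<open>x\<close> it is \<open>exp (c x)\<close>.\<close>

lemma crossing_estimate:
  fixes f :: "complex \<Rightarrow> complex" and P :: "real \<Rightarrow> complex" and \<rho> x \<psi> M \<epsilon> c :: real
  assumes holf: "f holomorphic_on ball 0 \<rho>" and bf: "\<And>u. u \<in> ball 0 \<rho> \<Longrightarrow> norm (f u) \<le> M"
    and P: "path P" and "0 < x"
    and far: "\<And>t. t \<in> {0..1} \<Longrightarrow> x < norm (exp (P t))"
    and near: "\<And>t. t \<in> {0..1} \<Longrightarrow> norm (exp (P t)) < \<rho>"
    and small: "\<And>t. t \<in> {0..1} \<Longrightarrow> norm (f (exp (P t))) \<le> \<epsilon>"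
    and \<psi>: "0 < \<psi>" "\<psi> < pi / 2" and ends: "Im (P 0) = - \<psi>" "Im (P 1) = \<psi>" and "c \<ge> 0"
  shows "norm (f (of_real x)) * exp (c * x) \<le> max (M * exp (c * (\<rho> * cos \<psi>))) (\<epsilon> * exp (c * \<rho>))"
proof -
  define \<Lambda> where "\<Lambda> = linepath 0 (exp (P 0)) +++ (exp \<circ> P) +++ linepath (exp (P 1)) 0"
  let ?S = "inside (path_image \<Lambda>)"
  let ?F = "\<lambda>u. f u * exp (of_real c * u)"
  let ?B = "max (M * exp (c * (\<rho> * cos \<psi>))) (\<epsilon> * exp (c * \<rho>))"
  have xin: "of_real x \<in> ?S"
    unfolding \<Lambda>_def by (rule radial_loop_encloses) (use assms in auto)
  have pt: "path (exp \<circ> P)"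
    using P unfolding path_def by (intro continuous_on_compose continuous_intros)
  have sf: "pathfinish (exp \<circ> P) = exp (P 1)" "pathstart (exp \<circ> P) = exp (P 0)"
    by (auto simp: pathfinish_def pathstart_def)
  have p\<Lambda>: "path \<Lambda>" using pt sf by (auto simp: \<Lambda>_def)
  have im: "path_image \<Lambda> = closed_segment 0 (exp (P 0)) \<union> path_image (exp \<circ> P) \<union> closed_segment 0 (exp (P 1))"
    using sf by (auto simp: \<Lambda>_def path_image_join closed_segment_commute)
  have "0 < \<rho>" using far[of 0] near[of 0] \<open>0 < x\<close> by auto
  have seg: "closed_segment 0 (exp (P t)) \<subseteq> ball 0 \<rho>" if "t \<in> {0..1}" for t
    using near[OF that] \<open>0 < \<rho>\<close> by (intro closed_segment_subset) auto
  have im_ball: "path_image \<Lambda> \<subseteq> ball 0 \<rho>"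
    unfolding im using seg[of 0] seg[of 1] near by (auto simp: path_image_def)
  have S_ball: "?S \<subseteq> ball 0 \<rho>"
    using outside_subset_convex[OF convex_ball im_ball] inside_Un_outside[of "path_image \<Lambda>"]
      inside_Int_outside[of "path_image \<Lambda>"] by blast
  have clS: "closure ?S \<subseteq> ball 0 \<rho>"
    using closure_inside_subset[of "path_image \<Lambda>"] closed_path_image[OF p\<Lambda>] S_ball im_ball by auto
  have holF: "?F holomorphic_on ball 0 \<rho>" by (intro holomorphic_intros holf)
  have bdS: "bounded ?S" using S_ball bounded_ball bounded_subset by blast
  have Re_seg: "Re u \<le> \<rho> * cos \<psi>" if "u \<in> closed_segment 0 (exp (P t))" "t \<in> {0, 1}" for u t
  proof -
    from that obtain s where s: "0 \<le> s" "s \<le> 1" "u = s *\<^sub>R exp (P t)" by (auto simp: in_segment)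
    have "Re u = s * (norm (exp (P t)) * cos \<psi>)"
      using s that ends by (auto simp: Re_exp)
    also have "\<dots> \<le> 1 * (\<rho> * cos \<psi>)"
      using s near[of t] that \<psi> cos_gt_zero[of \<psi>] \<open>0 < \<rho>\<close>
      by (intro mult_mono mult_nonneg_nonneg) (auto intro: less_imp_le simp del: norm_exp_eq_Re)
    finally show ?thesis by simp
  qed
  have "norm (?F (of_real x)) \<le> ?B"
  proof (rule maximum_modulus_frontier[where f = ?F and S = ?S])
    show "?F holomorphic_on interior ?S"
      using holF S_ball interior_subset by (meson holomorphic_on_subset order_trans)
    show "continuous_on (closure ?S) ?F"
      using holF clS holomorphic_on_imp_continuous_on continuous_on_subset by blast
    show "bounded ?S" by (fact bdS)
    show "of_real x \<in> ?S" by (fact xin)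
    fix u assume "u \<in> frontier ?S"
    then have "u \<in> path_image \<Lambda>"
      using frontier_inside_subset[OF closed_path_image[OF p\<Lambda>]] by auto
    then consider t where "t \<in> {0, 1}" "u \<in> closed_segment 0 (exp (P t))" | "u \<in> path_image (exp \<circ> P)"
      unfolding im by auto
    then show "norm (?F u) \<le> ?B"
    proof cases
      case 1
      then have "t \<in> {0..1}" by auto
      then have u: "u \<in> ball 0 \<rho>" using seg 1 by blast
      have "norm (?F u) \<le> M * exp (c * (\<rho> * cos \<psi>))"
        unfolding norm_mult using bf[OF u] Re_seg[OF 1(2,1)] \<open>c \<ge> 0\<close>
        by (intro mult_mono) (auto simp: intro: mult_left_mono order_trans[OF norm_ge_zero])
      then show ?thesis by simp
    next
      case 2
      then obtain t where t: "t \<in> {0..1}" "u = exp (P t)" by (auto simp: path_image_def)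
      have "Re u \<le> \<rho>" using near[OF t(1)] complex_Re_le_cmod[of u] unfolding t(2)[symmetric] by linarith
      then have "norm (?F u) \<le> \<epsilon> * exp (c * \<rho>)"
        unfolding norm_mult using small[OF t(1)] \<open>c \<ge> 0\<close> t
        by (intro mult_mono) (auto intro: mult_left_mono order_trans[OF norm_ge_zero])
      then show ?thesis by simp
    qed
  qed
  then show ?thesis by (simp add: norm_mult)
qed

text \<open>A quantitative form of Koebe's lemma. If \<open>x > \<rho> cos \<psi>\<close>, a large \<open>c\<close> makes the contribution of
  the radii in \<open>crossing_estimate\<close> smaller than \<open>|f x|\<close>, and then a small \<open>\<epsilon>\<close> does the same for
  the path. Both numbers depend on the sector only and not on the path.\<close>

lemma no_small_crossing:
  fixes f :: "complex \<Rightarrow> complex" and \<rho> \<psi> \<theta> M :: real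
  assumes holf: "f holomorphic_on ball 0 \<rho>" and bf: "\<And>u. u \<in> ball 0 \<rho> \<Longrightarrow> norm (f u) \<le> M"
    and nz: "\<And>u. u \<in> ball 0 \<rho> \<Longrightarrow> f u \<noteq> 0" and "0 < \<rho>" and \<psi>: "0 < \<psi>" "\<psi> < pi / 2"
  obtains \<epsilon> x where "0 < \<epsilon>" "0 < x" "x < \<rho>"
    "\<And>P. path P \<Longrightarrow> (\<And>t. t \<in> {0..1} \<Longrightarrow> x < norm (exp (P t)) \<and> norm (exp (P t)) < \<rho> \<and> norm (f (exp (P t))) \<le> \<epsilon>)
        \<Longrightarrow> Im (P 0) = \<theta> - \<psi> \<Longrightarrow> Im (P 1) = \<theta> + \<psi> \<Longrightarrow> False"
proof -
  have cos: "0 < cos \<psi>" "cos \<psi> < 1"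
    using \<psi> cos_gt_zero[of \<psi>] cos_monotone_0_pi[of 0 \<psi>] by auto
  obtain x where x: "\<rho> * cos \<psi> < x" "x < \<rho>"
    using dense[of "\<rho> * cos \<psi>" \<rho>] cos \<open>0 < \<rho>\<close> by auto
  have "0 < x" using x cos \<open>0 < \<rho>\<close> by (meson less_trans mult_pos_pos)
  define F where "F u = f (u * cis \<theta>)" for u
  have holF: "F holomorphic_on ball 0 \<rho>"
    unfolding F_def using holf
    by (intro holomorphic_on_compose_gen[OF _ holf, unfolded o_def] holomorphic_intros) (auto simp: norm_mult)
  have bF: "norm (F u) \<le> M" and nF: "F u \<noteq> 0" if "u \<in> ball 0 \<rho>" for u
    using that bf[of "u * cis \<theta>"] nz[of "u * cis \<theta>"] by (auto simp: F_def norm_mult)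
  let ?m = "norm (F (of_real x))"
  have "?m > 0" using nF[of "of_real x"] x \<open>0 < x\<close> by auto
  have "((\<lambda>c. M * exp (c * (\<rho> * cos \<psi> - x))) \<longlongrightarrow> M * 0) at_top"
  proof (intro tendsto_mult_left filterlim_compose[OF exp_at_bot])
    show "LIM c at_top. c * (\<rho> * cos \<psi> - x) :> at_bot"
      using x filterlim_tendsto_neg_mult_at_bot[OF tendsto_const[of "\<rho> * cos \<psi> - x"] _ filterlim_ident]
      by (simp add: mult.commute)
  qed
  then have "\<forall>\<^sub>F c in at_top. M * exp (c * (\<rho> * cos \<psi> - x)) < ?m \<and> c \<ge> 0"
    using \<open>?m > 0\<close> by (intro eventually_conj order_tendstoD eventually_ge_at_top) auto
  then obtain c where c: "M * exp (c * (\<rho> * cos \<psi> - x)) < ?m" "c \<ge> 0"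
    using eventually_happens'[OF trivial_limit_at_top_linorder] by blast
  \<comment> \<open>Half of the bound that the path may not exceed.\<close>
  define \<epsilon> where "\<epsilon> = ?m * exp (c * x) / (2 * exp (c * \<rho>))"
  show ?thesis
  proof
    show "0 < \<epsilon>" using \<open>?m > 0\<close> by (simp add: \<epsilon>_def)
    show "0 < x" "x < \<rho>" by fact+
    fix P assume P: "path P" and *: "\<And>t. t \<in> {0..1} \<Longrightarrow> x < norm (exp (P t)) \<and> norm (exp (P t)) < \<rho> \<and> norm (f (exp (P t))) \<le> \<epsilon>"
      and ends: "Im (P 0) = \<theta> - \<psi>" "Im (P 1) = \<theta> + \<psi>"
    define Q where "Q t = P t - \<i> * of_real \<theta>" for t
    have eQ: "exp (Q t) = exp (P t) * cis (- \<theta>)" for t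
      by (simp add: Q_def exp_diff cis_conv_exp exp_minus divide_inverse)
    have nQ: "norm (exp (Q t)) = norm (exp (P t))" for t by (simp add: eQ norm_mult del: norm_exp_eq_Re)
    have FQ: "F (exp (Q t)) = f (exp (P t))" for t by (simp add: F_def eQ mult.assoc cis_mult)
    have "path Q" using P unfolding path_def Q_def by (intro continuous_intros)
    have "norm (F (of_real x)) * exp (c * x) \<le> max (M * exp (c * (\<rho> * cos \<psi>))) (\<epsilon> * exp (c * \<rho>))"
      by (rule crossing_estimate[OF holF bF \<open>path Q\<close> \<open>0 < x\<close> _ _ _ \<psi> _ _ c(2)])
        (use * ends nQ FQ in \<open>auto simp: Q_def\<close>)
    moreover have "\<epsilon> * exp (c * \<rho>) < ?m * exp (c * x)" using \<open>?m > 0\<close> by (simp add: \<epsilon>_def)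
    moreover have "M * exp (c * (\<rho> * cos \<psi>)) < ?m * exp (c * x)"
    proof -
      have "M * exp (c * (\<rho> * cos \<psi>)) = M * exp (c * (\<rho> * cos \<psi> - x)) * exp (c * x)"
        by (simp add: mult.assoc right_diff_distrib exp_add[symmetric])
      also have "\<dots> < ?m * exp (c * x)" by (rule mult_strict_right_mono[OF c(1)]) simp
      finally show ?thesis .
    qed
    ultimately show False by linarith
  qed
qed

section \<open>Local connectivity of the exterior of a Jordan curve\<close>

text \<open>Remove from the curve a small open arc around \<open>q\<close> and let \<open>J'\<close> be the rest. Two points of the
  exterior near \<open>q\<close> are separated neither by the curve nor by \<open>J'\<close> together with the complement of
  the ball. These two closed sets meet exactly in \<open>J'\<close>, which is connected, so by Janiszewski's
  theorem their union does not separate the points either.\<close>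

lemma Jordan_exterior_locally_connected:
  fixes g :: "real \<Rightarrow> complex"
  assumes g: "simple_path g" "pathfinish g = pathstart g"
    and q: "q \<in> path_image g" and "\<epsilon> > 0"
  obtains \<delta> where "\<delta> > 0"
    "\<And>x y. x \<in> outside (path_image g) \<inter> ball q \<delta> \<Longrightarrow> y \<in> outside (path_image g) \<inter> ball q \<delta> \<Longrightarrow>
       \<exists>p. path p \<and> pathstart p = x \<and> pathfinish p = y \<and> path_image p \<subseteq> outside (path_image g) \<inter> ball q \<epsilon>"
proof -
  let ?J = "path_image g" and ?O = "outside (path_image g)"
  obtain s where s: "s \<in> {0..1}" "g s = q" using q by (auto simp: path_image_def)
  define h where "h = shiftpath s g"
  have h: "simple_path h" "pathfinish h = pathstart h" "path_image h = ?J" "h 0 = q" "h 1 = q"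
  proof -
    show "simple_path h" unfolding h_def using g s by (auto intro: simple_path_shiftpath)
    show "path_image h = ?J" unfolding h_def using g s by (intro path_image_shiftpath) auto
    show "pathfinish h = pathstart h" unfolding h_def using g s
      by (metis atLeastAtMost_iff pathfinish_shiftpath pathstart_shiftpath)
    show "h 0 = q" using s by (auto simp: h_def shiftpath_def)
    then show "h 1 = q" using \<open>pathfinish h = pathstart h\<close> by (simp add: pathstart_def pathfinish_def)
  qed
  have conth: "continuous_on {0..1} h" using h(1) simple_path_imp_path path_def by blast
  have "compact ?J" using g by (simp add: compact_simple_path_image)
  have c: "\<exists>d>0. \<forall>t\<in>{0..1}. dist t s < d \<longrightarrow> dist (h t) (h s) < \<epsilon>" if "s \<in> {0..1}" for s
    using conth that \<open>\<epsilon> > 0\<close> unfolding continuous_on_iff by blast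
  obtain \<eta>0 where \<eta>0: "\<eta>0 > 0" "\<And>t. t \<in> {0..1} \<Longrightarrow> dist t 0 < \<eta>0 \<Longrightarrow> dist (h t) q < \<epsilon>"
    using c[of 0] h(4) by auto
  obtain \<eta>1 where \<eta>1: "\<eta>1 > 0" "\<And>t. t \<in> {0..1} \<Longrightarrow> dist t 1 < \<eta>1 \<Longrightarrow> dist (h t) q < \<epsilon>"
    using c[of 1] h(5) by auto
  define \<eta> where "\<eta> = Min {\<eta>0, \<eta>1, 1/2} / 2"
  have \<eta>: "0 < \<eta>" "\<eta> < \<eta>0" "\<eta> < \<eta>1" "\<eta> < 1/2" using \<eta>0 \<eta>1 by (auto simp: \<eta>_def min_def)
  define J' where "J' = h ` {\<eta>..1-\<eta>}"
  have sub: "{\<eta>..1-\<eta>} \<subseteq> {0..1}" using \<eta> by auto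
  have J': "compact J'" "connected J'" "J' \<subseteq> ?J"
  proof -
    show "compact J'" "connected J'" unfolding J'_def using continuous_on_subset[OF conth sub]
      by (auto intro!: compact_continuous_image connected_continuous_image)
    have "J' \<subseteq> path_image h" unfolding J'_def path_image_def using sub by (rule image_mono)
    then show "J' \<subseteq> ?J" using h(3) by simp
  qed
  have "q \<notin> J'"
  proof
    assume "q \<in> J'"
    then obtain t where t: "\<eta> \<le> t" "t \<le> 1 - \<eta>" "h t = h 0" using h(4) by (auto simp: J'_def)
    have lf: "\<forall>x\<in>{0..1}. \<forall>y\<in>{0..1}. h x = h y \<longrightarrow> x = y \<or> x = 0 \<and> y = 1 \<or> x = 1 \<and> y = 0"
      using h(1) by (simp add: simple_path_def loop_free_def)
    have "t \<in> {0..1}" "t \<noteq> 0" "t \<noteq> 1" using t \<eta> by auto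
    then show False using bspec[OF bspec[OF lf, of t], of 0] t by auto
  qed
  have rest: "?J - ball q \<epsilon> \<subseteq> J'"
  proof
    fix y assume y: "y \<in> ?J - ball q \<epsilon>"
    then obtain t where t: "t \<in> {0..1}" "y = h t" using h(3) unfolding path_image_def by blast
    have "\<not> dist t 0 < \<eta>0" "\<not> dist t 1 < \<eta>1" using \<eta>0(2) \<eta>1(2) t y by (auto simp: dist_commute)
    then have "t \<in> {\<eta>..1-\<eta>}" using t \<eta> by (auto simp: dist_real_def)
    then show "y \<in> J'" using t by (auto simp: J'_def)
  qed
  have "open (- J')" using J'(1) by (simp add: compact_imp_closed open_Compl)
  then obtain d where d: "d > 0" "ball q d \<subseteq> - J'" using \<open>q \<notin> J'\<close> open_contains_ball by blast
  define \<delta> where "\<delta> = min d \<epsilon>"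
  show ?thesis
  proof
    show "\<delta> > 0" using d \<open>\<epsilon> > 0\<close> by (simp add: \<delta>_def)
    fix x y assume x: "x \<in> ?O \<inter> ball q \<delta>" and y: "y \<in> ?O \<inter> ball q \<delta>"
    let ?Q = "J' \<union> - ball q \<epsilon>"
    have con: "connected ?O" using Jordan_inside_outside[OF g] by blast
    have OJ: "?O \<subseteq> - ?J" using outside_no_overlap by blast
    have "connected_component (- (?J \<union> ?Q)) x y"
    proof (rule Janiszewski)
      show "compact ?J" by fact
      show "closed ?Q" using J'(1) by (intro closed_Un compact_imp_closed closed_Compl) auto
      have "?J \<inter> ?Q = J'" using rest J'(3) by blast
      then show "connected (?J \<inter> ?Q)" using J'(2) by simp
      show "connected_component (- ?J) x y"
        unfolding connected_component_def using con OJ x y by blast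
      have "ball q \<delta> \<subseteq> - ?Q" using d(2) by (auto simp: \<delta>_def)
      then show "connected_component (- ?Q) x y"
        unfolding connected_component_def using x y by (meson IntD2 connected_ball)
    qed
    moreover have "open (- (?J \<union> ?Q))" 
      using \<open>compact ?J\<close> J'(1) by (intro open_Compl closed_Un) (auto simp: compact_imp_closed)
    ultimately have "path_component (- (?J \<union> ?Q)) x y"
      by (simp add: path_component_eq_connected_component_set open_path_connected_component)
    then obtain p where p: "path p" "path_image p \<subseteq> - (?J \<union> ?Q)" "pathstart p = x" "pathfinish p = y"
      unfolding path_component_def by blast
    have "path_image p \<subseteq> ?O"
    proof -
      have "path_image p \<inter> inside ?J = {}"
      proof (rule ccontr)
        assume ne: "path_image p \<inter> inside ?J \<noteq> {}"
        have "open (inside ?J)" "open ?O" using Jordan_inside_outside[OF g] by auto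
        moreover have "path_image p \<subseteq> inside ?J \<union> ?O" using p(2) inside_Un_outside by blast
        moreover have "x \<in> path_image p" using p(3) by auto
        ultimately show False
          using connectedD[OF connected_path_image[OF p(1)], of "inside ?J" ?O] ne x inside_Int_outside[of ?J] by blast
      qed
      then show ?thesis using p(2) inside_Un_outside[of ?J] by blast
    qed
    then show "\<exists>p. path p \<and> pathstart p = x \<and> pathfinish p = y \<and> path_image p \<subseteq> ?O \<inter> ball q \<epsilon>"
      using p by (intro exI[of _ p]) auto
  qed
qed

section \<open>Boundary continuity of the conformal map\<close>

lemma at_infinity_lower_bound:
  fixes f :: "complex \<Rightarrow> complex"
  assumes "filterlim f at_infinity at_infinity"
  shows "\<exists>R. \<forall>z. norm z \<ge> R \<longrightarrow> norm (f z) \<ge> B"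
proof -
  have "\<forall>\<^sub>F z in at_infinity. norm (f z) \<ge> B"
    using assms unfolding filterlim_at_infinity_conv_norm_at_top by (simp add: filterlim_at_top)
  then show ?thesis unfolding eventually_at_infinity by blast
qed

text \<open>The properties of the conformal map that the boundary analysis needs: \<open>J\<close> is the boundary of
  \<open>\<Omega>\<close>, the maps are inverse to each other, and both behave like the identity at infinity.\<close>

locale exterior_conformal =
  fixes \<Omega> J :: "complex set" and r0 :: real and \<Phi> \<Psi> :: "complex \<Rightarrow> complex"
  assumes r0: "0 < r0"
    and open_\<Omega>: "open \<Omega>" and compact_J: "compact J" and J_disjoint: "J \<inter> \<Omega> = {}"
    and closure_\<Omega>: "closure \<Omega> = \<Omega> \<union> J"
    and cont_\<Phi>: "continuous_on \<Omega> \<Phi>"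
    and hol_\<Psi>: "\<Psi> holomorphic_on exterior_disc r0"
    and \<Psi>_in: "\<And>z. r0 < norm z \<Longrightarrow> \<Psi> z \<in> \<Omega>"
    and \<Phi>_gt: "\<And>x. x \<in> \<Omega> \<Longrightarrow> r0 < norm (\<Phi> x)"
    and \<Phi>_\<Psi>: "\<And>z. r0 < norm z \<Longrightarrow> \<Phi> (\<Psi> z) = z"
    and \<Psi>_\<Phi>: "\<And>x. x \<in> \<Omega> \<Longrightarrow> \<Psi> (\<Phi> x) = x"
    and \<Phi>_inf: "filterlim \<Phi> at_infinity at_infinity"
    and \<Psi>_inf: "((\<lambda>z. \<Psi> z / z) \<longlongrightarrow> 1) at_infinity"
begin

lemma cont_\<Psi>: "continuous_on (exterior_disc r0) \<Psi>"
  using hol_\<Psi> holomorphic_on_imp_continuous_on by blast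

lemma \<Psi>_to_infinity: "filterlim \<Psi> at_infinity at_infinity"
proof -
  have "filterlim (\<lambda>z. \<Psi> z / z * z) at_infinity at_infinity"
    by (rule tendsto_mult_filterlim_at_infinity[OF \<Psi>_inf _ filterlim_ident]) simp
  moreover have "\<forall>\<^sub>F z in at_infinity. \<Psi> z / z * z = \<Psi> z"
    using eventually_not_equal_at_infinity[of 0] by eventually_elim simp
  ultimately show ?thesis by (rule filterlim_mono_eventually[OF _ order_refl order_refl])
qed

text \<open>Points near \<open>J\<close> correspond to points near the circle: a compact part of the exterior of the disc
  has a compact image in \<open>\<Omega>\<close>, which keeps a positive distance from \<open>J\<close>, and points near infinity
  have images near infinity.\<close>

lemma \<Phi>_near_circle:
  assumes "r0 < r"
  obtains \<delta> where "\<delta> > 0" "\<And>x q. x \<in> \<Omega> \<Longrightarrow> q \<in> J \<Longrightarrow> dist x q < \<delta> \<Longrightarrow> norm (\<Phi> x) < r"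
proof -
  obtain m where m: "\<And>q. q \<in> J \<Longrightarrow> norm q \<le> m"
    using compact_imp_bounded[OF compact_J] unfolding bounded_iff by blast
  obtain R where R: "\<And>z. norm z \<ge> R \<Longrightarrow> norm (\<Psi> z) \<ge> m + 1"
    using at_infinity_lower_bound[OF \<Psi>_to_infinity] by blast
  let ?K = "cball 0 R - ball 0 r"
  have "compact (\<Psi> ` ?K)"
    using \<open>r0 < r\<close> by (intro compact_continuous_image continuous_on_subset[OF cont_\<Psi>] compact_diff)
      (auto simp: exterior_disc_def)
  then have "closed (\<Psi> ` ?K)" by (rule compact_imp_closed)
  moreover have "\<Psi> ` ?K \<subseteq> \<Omega>" using \<open>r0 < r\<close> by (auto intro!: \<Psi>_in)
  then have "J \<inter> \<Psi> ` ?K = {}" using J_disjoint by blast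
  ultimately have "\<exists>d>0. \<forall>q\<in>J. \<forall>y\<in>\<Psi> ` ?K. d \<le> dist q y"
    using separate_compact_closed[OF compact_J] by metis
  then obtain d where d: "d > 0" "\<And>q y. q \<in> J \<Longrightarrow> y \<in> \<Psi> ` ?K \<Longrightarrow> d \<le> dist q y" by blast
  show ?thesis
  proof
    show "min d 1 > 0" using d by simp
    fix x q assume x: "x \<in> \<Omega>" and q: "q \<in> J" and xq: "dist x q < min d 1"
    show "norm (\<Phi> x) < r"
    proof (rule ccontr)
      assume "\<not> norm (\<Phi> x) < r"
      moreover have "norm (\<Phi> x) < R"
      proof (rule ccontr)
        assume "\<not> ?thesis"
        then have "norm x \<ge> m + 1" using R[of "\<Phi> x"] \<Psi>_\<Phi>[OF x] by auto
        moreover have "norm x \<le> norm q + dist x q" using norm_triangle_sub[of x q] by (simp add: dist_norm)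
        ultimately show False using m[OF q] xq by auto
      qed
      ultimately have "x \<in> \<Psi> ` ?K" using \<Psi>_\<Phi>[OF x] by (intro image_eqI[of _ _ "\<Phi> x"]) auto
      then have "d \<le> dist q x" by (rule d(2)[OF q])
      then show False using xq by (auto simp: dist_commute)
    qed
  qed
qed

lemma \<Psi>_near_J:
  assumes "\<delta> > 0"
  obtains r where "r0 < r" "\<And>z. r0 < norm z \<Longrightarrow> norm z < r \<Longrightarrow> \<exists>q\<in>J. dist (\<Psi> z) q < \<delta>"
proof -
  obtain R where R: "\<And>x. norm x \<ge> R \<Longrightarrow> norm (\<Phi> x) \<ge> r0 + 1"
    using at_infinity_lower_bound[OF \<Phi>_inf] by blast
  define C where "C = closure \<Omega> \<inter> cball 0 R \<inter> - (\<Union>q\<in>J. ball q \<delta>)"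
  have "compact C" unfolding C_def
    by (intro compact_Int_closed closed_Int_compact compact_cball closed_closure closed_Compl open_UN) auto
  have "J \<subseteq> (\<Union>q\<in>J. ball q \<delta>)" using \<open>\<delta> > 0\<close> by force
  then have "C \<subseteq> \<Omega>" unfolding C_def closure_\<Omega> by blast
  have "compact ((\<lambda>x. norm (\<Phi> x)) ` C)"
    using continuous_on_subset[OF cont_\<Phi> \<open>C \<subseteq> \<Omega>\<close>] \<open>compact C\<close>
    by (intro compact_continuous_image continuous_intros)
  then have "\<exists>m>r0. \<forall>x\<in>C. m \<le> norm (\<Phi> x)"
  proof (cases "C = {}")
    case True then show ?thesis by (auto intro: exI[of _ "r0 + 1"])
  next
    case False
    then obtain x where "x \<in> C" "\<And>y. y \<in> C \<Longrightarrow> norm (\<Phi> x) \<le> norm (\<Phi> y)"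
      using compact_attains_inf[OF \<open>compact (_ ` C)\<close>] by fastforce
    then show ?thesis using \<Phi>_gt \<open>C \<subseteq> \<Omega>\<close> by blast
  qed
  then obtain m where m: "m > r0" "\<And>x. x \<in> C \<Longrightarrow> m \<le> norm (\<Phi> x)" by blast
  show ?thesis
  proof
    show "r0 < min m (r0 + 1)" using m by simp
    fix z :: complex assume z: "r0 < norm z" "norm z < min m (r0 + 1)"
    have "\<Psi> z \<notin> C" using m(2)[of "\<Psi> z"] \<Phi>_\<Psi>[OF z(1)] z by auto
    moreover have "norm (\<Psi> z) \<le> R" using R[of "\<Psi> z"] \<Phi>_\<Psi>[OF z(1)] z by force
    ultimately have "\<Psi> z \<in> (\<Union>q\<in>J. ball q \<delta>)"
      using \<Psi>_in[OF z(1)] by (auto simp: C_def closure_\<Omega>)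
    then show "\<exists>q\<in>J. dist (\<Psi> z) q < \<delta>" by (auto simp: dist_commute)
  qed
qed

lemma \<Psi>_bounded_near_circle:
  assumes "r0 < r"
  obtains M where "M > 0" "\<And>z. r0 < norm z \<Longrightarrow> norm z \<le> r \<Longrightarrow> norm (\<Psi> z) \<le> M"
proof -
  obtain r1 where r1: "r0 < r1" "\<And>z. r0 < norm z \<Longrightarrow> norm z < r1 \<Longrightarrow> \<exists>q\<in>J. dist (\<Psi> z) q < 1"
    using \<Psi>_near_J[of 1] by auto
  obtain m where m: "\<And>q. q \<in> J \<Longrightarrow> norm q \<le> m"
    using compact_imp_bounded[OF compact_J] unfolding bounded_iff by blast
  have "compact (\<Psi> ` (cball 0 r - ball 0 r1))"
    using r1(1) by (intro compact_continuous_image continuous_on_subset[OF cont_\<Psi>] compact_diff)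
      (auto simp: exterior_disc_def)
  then obtain m' where m': "\<And>z. z \<in> cball 0 r - ball 0 r1 \<Longrightarrow> norm (\<Psi> z) \<le> m'"
    unfolding compact_eq_bounded_closed bounded_iff by blast
  show ?thesis
  proof
    show "\<bar>m\<bar> + \<bar>m'\<bar> + 1 > 0" by simp
    fix z :: complex assume z: "r0 < norm z" "norm z \<le> r"
    show "norm (\<Psi> z) \<le> \<bar>m\<bar> + \<bar>m'\<bar> + 1"
    proof (cases "norm z < r1")
      case True
      then obtain q where "q \<in> J" "dist (\<Psi> z) q < 1" using r1 z by blast
      moreover have "norm (\<Psi> z) \<le> norm q + dist (\<Psi> z) q" using norm_triangle_sub[of "\<Psi> z" q] by (simp add: dist_norm)
      ultimately show ?thesis using m[of q] by linarith
    next
      case False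
      then have "norm (\<Psi> z) \<le> m'" using m'[of z] z by auto
      then show ?thesis by linarith
    qed
  qed
qed

text \<open>In the coordinate \<open>u = 1 / z\<close> the function \<open>\<Psi> - q\<close> has a simple pole at \<open>0\<close>. Multiplied by \<open>u\<close>
  it becomes holomorphic in a disc with value \<open>1\<close> at \<open>0\<close>, and for \<open>q\<close> outside \<open>\<Omega>\<close> it has no zero.
  This is the function to which \<open>no_small_crossing\<close> is applied.\<close>

lemma inverted_map_holomorphic:
  shows "(\<lambda>u. if u = 0 then 1 else u * (\<Psi> (1 / u) - q)) holomorphic_on ball 0 (1 / r0)"
proof -
  let ?f = "\<lambda>u. u * (\<Psi> (1 / u) - q)"
  have "((\<lambda>u. \<Psi> (inverse u) / inverse u - u * q) \<longlongrightarrow> 1 - 0 * q) (at 0)"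
    by (intro tendsto_intros filterlim_compose[OF \<Psi>_inf filterlim_inverse_at_infinity])
  moreover have "?f = (\<lambda>u. \<Psi> (inverse u) / inverse u - u * q)"
    by (rule ext) (simp add: divide_inverse right_diff_distrib mult.commute)
  ultimately have "(?f \<longlongrightarrow> 1) (at 0)" by simp
  moreover have "?f holomorphic_on ball 0 (1 / r0) - {0}"
  proof -
    have "(\<Psi> \<circ> (\<lambda>u. 1 / u)) holomorphic_on ball 0 (1 / r0) - {0}"
      using r0 by (intro holomorphic_on_compose_gen[OF _ hol_\<Psi>] holomorphic_intros)
        (auto simp: exterior_disc_def norm_divide field_simps)
    then show ?thesis by (intro holomorphic_intros) (auto simp: o_def)
  qed
  ultimately show ?thesis by (intro removable_singularity) auto
qed

end

lemma norm_exp_diff_le: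
  "norm (exp a - exp b) \<le> \<bar>norm (exp a) - norm (exp b)\<bar> + norm (exp b) * \<bar>Im a - Im b\<bar>"
proof -
  have e: "exp w = of_real (norm (exp w)) * cis (Im w)" for w :: complex
    unfolding norm_exp_eq_Re by (rule exp_eq_polar)
  have "exp a - exp b = of_real (norm (exp a) - norm (exp b)) * cis (Im a)
       + of_real (norm (exp b)) * (cis (Im b) * (cis (Im a - Im b) - 1))"
    by (subst e[of a], subst e[of b]) (simp add: algebra_simps cis_mult)
  then have "norm (exp a - exp b) \<le> norm (of_real (norm (exp a) - norm (exp b)) * cis (Im a))
       + norm (of_real (norm (exp b)) * (cis (Im b) * (cis (Im a - Im b) - 1)))"
    by (metis norm_triangle_ineq)
  also have "\<dots> = \<bar>norm (exp a) - norm (exp b)\<bar> + norm (exp b) * norm (cis (Im a - Im b) - 1)"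
    by (simp add: norm_mult del: of_real_diff)
  also have "norm (cis (Im a - Im b) - 1) \<le> \<bar>Im a - Im b\<bar>"
    using dist_exp_i_1[of "Im a - Im b"] abs_sin_x_le_abs_x[of "(Im a - Im b) / 2"]
    by (simp add: cis_conv_exp)
  finally show ?thesis by (simp add: mult_left_mono)
qed

context exterior_conformal begin

text \<open>Two points of \<open>\<Omega>\<close> near \<open>q\<close> are joined by a path near \<open>q\<close>. Its image under \<open>1 / \<Phi>\<close> runs close to
  the circle, and along it the function of the previous lemma is small. If the images of the end
  points were \<open>\<eta>\<close> apart, the image path would cross one of \<open>N\<close> fixed sectors, which
  \<open>no_small_crossing\<close> excludes.\<close>

lemma \<Phi>_oscillation_small:
  assumes q: "q \<in> J" and "\<eta> > 0"
    and lc: "\<And>\<epsilon>. \<epsilon> > 0 \<Longrightarrow> \<exists>\<delta>>0. \<forall>x\<in>\<Omega> \<inter> ball q \<delta>. \<forall>y\<in>\<Omega> \<inter> ball q \<delta>.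
        \<exists>p. path p \<and> pathstart p = x \<and> pathfinish p = y \<and> path_image p \<subseteq> \<Omega> \<inter> ball q \<epsilon>"
  shows "\<exists>\<delta>>0. \<forall>x\<in>\<Omega> \<inter> ball q \<delta>. \<forall>y\<in>\<Omega> \<inter> ball q \<delta>. dist (\<Phi> x) (\<Phi> y) < \<eta>"
proof -
  define \<rho> where "\<rho> = 1 / r0"
  have "\<rho> > 0" using r0 by (simp add: \<rho>_def)
  define f where "f u = (if u = 0 then 1 else u * (\<Psi> (1 / u) - q))" for u
  have holf: "f holomorphic_on ball 0 \<rho>"
    using inverted_map_holomorphic unfolding f_def \<rho>_def .
  have inv: "r0 < norm (1 / u)" if "u \<in> ball 0 \<rho>" "u \<noteq> 0" for u :: complex
    using that r0 by (auto simp: \<rho>_def norm_divide field_simps)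
  have nz: "f u \<noteq> 0" if "u \<in> ball 0 \<rho>" for u
    using \<Psi>_in[OF inv[OF that]] q J_disjoint by (auto simp: f_def)
  obtain M where M: "\<And>u. u \<in> ball 0 \<rho> \<Longrightarrow> norm (f u) \<le> M"
  proof -
    obtain M1 where M1: "\<And>z. r0 < norm z \<Longrightarrow> norm z \<le> 2 * r0 \<Longrightarrow> norm (\<Psi> z) \<le> M1"
      using \<Psi>_bounded_near_circle[of "2 * r0"] r0 by auto
    have "compact (f ` cball 0 (\<rho> / 2))"
      using \<open>\<rho> > 0\<close> by (intro compact_continuous_image continuous_on_subset[OF holomorphic_on_imp_continuous_on[OF holf]]) auto
    then obtain M2 where M2: "\<And>u. u \<in> cball 0 (\<rho> / 2) \<Longrightarrow> norm (f u) \<le> M2"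
      unfolding compact_eq_bounded_closed bounded_iff by blast
    have "norm (f u) \<le> max M2 (\<rho> * (M1 + norm q))" if u: "u \<in> ball 0 \<rho>" for u
    proof (cases "u \<in> cball 0 (\<rho> / 2)")
      case True then show ?thesis using M2 by (simp add: le_max_iff_disj)
    next
      case False
      then have "u \<noteq> 0" "norm u > \<rho> / 2" using \<open>\<rho> > 0\<close> by auto
      then have "norm (1 / u) \<le> 2 * r0" using r0 by (auto simp: \<rho>_def norm_divide field_simps)
      then have "norm (\<Psi> (1 / u)) \<le> M1" using M1 inv[OF u \<open>u \<noteq> 0\<close>] by blast
      then have "norm (\<Psi> (1 / u) - q) \<le> M1 + norm q" using norm_triangle_ineq4[of "\<Psi> (1/u)" q] by linarith
      then have "norm (f u) \<le> \<rho> * (M1 + norm q)"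
        using \<open>u \<noteq> 0\<close> \<open>\<rho> > 0\<close> u by (simp add: f_def norm_mult) (intro mult_mono, auto intro: order_trans[OF norm_ge_zero])
      then show ?thesis by simp
    qed
    then show ?thesis using that by blast
  qed
  \<comment> \<open>Points at distance \<open>\<eta>\<close> in a thin annulus around the circle differ in angle by at least \<open>\<alpha>\<close>, hence by two full sectors.\<close>
  define \<alpha> where "\<alpha> = \<eta> / (4 * r0)"
  have "\<alpha> > 0" using \<open>\<eta> > 0\<close> r0 by (simp add: \<alpha>_def)
  obtain N :: nat where N: "N \<ge> 3" "4 * pi / N \<le> \<alpha>"
  proof -
    obtain n :: nat where n: "4 * pi / \<alpha> < real n" using reals_Archimedean2 by blast
    show ?thesis
    proof
      show "n + 3 \<ge> 3" by simp
      show "4 * pi / real (n + 3) \<le> \<alpha>" using n \<open>\<alpha> > 0\<close> by (simp add: field_simps)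
    qed
  qed
  define \<psi> where "\<psi> = pi / N"
  have \<psi>: "0 < \<psi>" "\<psi> < pi / 2" using N by (auto simp: \<psi>_def field_simps)
  define \<theta> where "\<theta> j = 2 * \<psi> * real_of_int j + \<psi>" for j
  have "\<exists>e x. 0 < e \<and> 0 < x \<and> x < \<rho> \<and> (\<forall>P. path P \<longrightarrow>
      (\<forall>t\<in>{0..1}. x < norm (exp (P t)) \<and> norm (exp (P t)) < \<rho> \<and> norm (f (exp (P t))) \<le> e) \<longrightarrow>
      Im (P 0) = \<theta> k - \<psi> \<longrightarrow> Im (P 1) = \<theta> k + \<psi> \<longrightarrow> False)" for k
    by (rule no_small_crossing[OF holf M nz \<open>\<rho> > 0\<close> \<psi>, of "\<theta> k"], assumption, assumption) blast
  then obtain e x where ex: "\<And>k. 0 < e k" "\<And>k. 0 < x k" "\<And>k. x k < \<rho>" and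
    no: "\<And>k P. path P \<Longrightarrow>
      (\<And>t. t\<in>{0..1} \<Longrightarrow> x k < norm (exp (P t)) \<and> norm (exp (P t)) < \<rho> \<and> norm (f (exp (P t))) \<le> e k) \<Longrightarrow>
      Im (P 0) = \<theta> k - \<psi> \<Longrightarrow> Im (P 1) = \<theta> k + \<psi> \<Longrightarrow> False"
    by metis
  define E where "E = Min (e ` {0..<int N})"
  define X where "X = Max (x ` {0..<int N})"
  have ne: "{0..<int N} \<noteq> {}" using N by auto
  have E: "E > 0" "\<And>k. k \<in> {0..<int N} \<Longrightarrow> E \<le> e k" using ex ne by (auto simp: E_def)
  have X: "X > 0" "X < \<rho>" "\<And>k. k \<in> {0..<int N} \<Longrightarrow> x k \<le> X"
    using ex ne by (auto simp: X_def Max_gr_iff)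
  \<comment> \<open>Thin enough for the angle estimate, and inside the region where \<open>no_small_crossing\<close> applies to all sectors.\<close>
  define r where "r = min (r0 + \<eta> / 2) (min (2 * r0) (1 / X))"
  have r: "r0 < r" "r \<le> r0 + \<eta> / 2" "r \<le> 2 * r0" "r \<le> 1 / X"
  proof -
    show "r0 < r" using X r0 \<open>\<eta> > 0\<close> by (auto simp: r_def \<rho>_def field_simps)
    show "r \<le> r0 + \<eta> / 2" "r \<le> 2 * r0" "r \<le> 1 / X" by (simp_all only: r_def min.cobounded1 min.coboundedI2 min.cobounded2 order_refl)
  qed
  obtain \<delta>1 where \<delta>1: "\<delta>1 > 0" "\<And>x. x \<in> \<Omega> \<Longrightarrow> dist x q < \<delta>1 \<Longrightarrow> norm (\<Phi> x) < r"
    using \<Phi>_near_circle[OF r(1)] q by metis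
  define \<epsilon> where "\<epsilon> = min \<delta>1 (E / \<rho>)"
  have "\<epsilon> > 0" using \<delta>1 E \<open>\<rho> > 0\<close> by (simp add: \<epsilon>_def)
  obtain \<delta> where \<delta>: "\<delta> > 0" "\<And>x y. x \<in> \<Omega> \<inter> ball q \<delta> \<Longrightarrow> y \<in> \<Omega> \<inter> ball q \<delta> \<Longrightarrow>
        \<exists>p. path p \<and> pathstart p = x \<and> pathfinish p = y \<and> path_image p \<subseteq> \<Omega> \<inter> ball q \<epsilon>"
    using lc[OF \<open>\<epsilon> > 0\<close>] by blast
  show ?thesis
  proof (intro exI[of _ \<delta>] conjI ballI \<delta>(1))
    fix a b assume a: "a \<in> \<Omega> \<inter> ball q \<delta>" and b: "b \<in> \<Omega> \<inter> ball q \<delta>"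
    show "dist (\<Phi> a) (\<Phi> b) < \<eta>"
    proof (rule ccontr)
      assume far: "\<not> dist (\<Phi> a) (\<Phi> b) < \<eta>"
      obtain p where p: "path p" "pathstart p = a" "pathfinish p = b" "path_image p \<subseteq> \<Omega> \<inter> ball q \<epsilon>"
        using \<delta>(2)[OF a b] by blast
      have pin: "p t \<in> \<Omega>" "dist (p t) q < \<epsilon>" if "t \<in> {0..1}" for t
      proof -
        have "p t \<in> path_image p" using that by (auto simp: path_image_def)
        then show "p t \<in> \<Omega>" "dist (p t) q < \<epsilon>" using p(4) by (auto simp: dist_commute)
      qed
      have \<Phi>p: "r0 < norm (\<Phi> (p t))" "norm (\<Phi> (p t)) < r" if "t \<in> {0..1}" for t
        using \<Phi>_gt pin[OF that] \<delta>1(2) by (auto simp: \<epsilon>_def)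
      have \<Phi>p0: "\<Phi> (p t) \<noteq> 0" if "t \<in> {0..1}" for t
        using \<Phi>p(1)[OF that] r0 by auto
      define \<tau> where "\<tau> t = 1 / \<Phi> (p t)" for t
      have "path \<tau>"
        unfolding \<tau>_def path_def using p(1) pin(1) \<Phi>p0 unfolding path_def
        by (intro continuous_intros continuous_on_compose2[OF cont_\<Phi>]) auto
      have "0 \<notin> path_image \<tau>" using \<Phi>p0 by (auto simp: path_image_def \<tau>_def)
      obtain P where P: "path P" "\<And>t. t \<in> {0..1} \<Longrightarrow> \<tau> t = exp (P t)"
        using winding_number_as_continuous_log[OF \<open>path \<tau>\<close> \<open>0 \<notin> path_image \<tau>\<close>] by (metis add_0)
      have \<Phi>P: "\<Phi> (p t) = exp (- P t)" if "t \<in> {0..1}" for t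
        using P(2)[OF that] \<Phi>p0[OF that] by (simp add: \<tau>_def exp_minus field_simps)
      have XP: "X < norm (exp (P t)) \<and> norm (exp (P t)) < \<rho> \<and> norm (f (exp (P t))) \<le> E"
        if t: "t \<in> {0..1}" for t
      proof -
        have e: "exp (P t) = 1 / \<Phi> (p t)" using P(2)[OF t] by (simp add: \<tau>_def)
        have 1: "norm (exp (P t)) < \<rho>" unfolding e norm_divide \<rho>_def
          using \<Phi>p[OF t] r0 by (simp add: frac_less2)
        have "norm (\<Phi> (p t)) < 1 / X" using \<Phi>p[OF t] r(4) by linarith
        then have 2: "X < norm (exp (P t))" unfolding e norm_divide
          using X(1) \<Phi>p0[OF t] by (simp add: field_simps)
        have "f (exp (P t)) = exp (P t) * (p t - q)"
          using \<Psi>_\<Phi>[OF pin(1)[OF t]] \<Phi>p0[OF t] unfolding e f_def by simp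
        then have "norm (f (exp (P t))) \<le> \<rho> * (E / \<rho>)"
          using 1 pin(2)[OF t] \<open>\<rho> > 0\<close> unfolding norm_mult \<epsilon>_def dist_norm
          by (simp only: norm_mult) (intro mult_mono, auto)
        then show ?thesis using 1 2 \<open>\<rho> > 0\<close> by simp
      qed
      have "\<alpha> \<le> \<bar>Im (P 1) - Im (P 0)\<bar>"
      proof -
        have "\<eta> \<le> norm (\<Phi> (p 0) - \<Phi> (p 1))"
          using far p(2,3) by (simp add: pathstart_def pathfinish_def dist_norm)
        also have "\<dots> \<le> \<bar>norm (exp (- P 0)) - norm (exp (- P 1))\<bar> + norm (exp (- P 1)) * \<bar>Im (- P 0) - Im (- P 1)\<bar>"
          using norm_exp_diff_le[of "- P 0" "- P 1"] \<Phi>P by simp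
        also have "\<bar>norm (exp (- P 0)) - norm (exp (- P 1))\<bar> \<le> \<eta> / 2"
          by (intro abs_leI) (use \<Phi>p[of 0] \<Phi>p[of 1] \<Phi>P[of 0] \<Phi>P[of 1] r(2) in simp_all)
        also have "norm (exp (- P 1)) * \<bar>Im (- P 0) - Im (- P 1)\<bar> \<le> (2 * r0) * \<bar>Im (P 1) - Im (P 0)\<bar>"
          using \<Phi>p[of 1] \<Phi>P[of 1] r(3) by (intro mult_mono) auto
        finally show ?thesis using r0 by (simp add: \<alpha>_def field_simps)
      qed
      define lo where "lo = min (Im (P 0)) (Im (P 1))"
      define hi where "hi = max (Im (P 0)) (Im (P 1))"
      define j where "j = \<lceil>lo / (2 * \<psi>)\<rceil>"
      have "lo / (2 * \<psi>) \<le> j" "j \<le> lo / (2 * \<psi>) + 1"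
        unfolding j_def using ceiling_correct[of "lo / (2 * \<psi>)"] by auto
      then have "lo \<le> 2 * \<psi> * j" "2 * \<psi> * j \<le> lo + 2 * \<psi>"
        using \<psi>(1) by (auto simp: field_simps)
      moreover have "4 * \<psi> \<le> hi - lo"
        using \<open>\<alpha> \<le> _\<close> N(2) by (auto simp: \<psi>_def hi_def lo_def)
      ultimately have j: "\<theta> j - \<psi> \<in> {lo..hi}" "\<theta> j + \<psi> \<in> {lo..hi}"
        using \<psi>(1) by (auto simp: \<theta>_def algebra_simps)
      have ivt: "\<exists>t\<in>{0..1}. Im (P t) = y" if "y \<in> {lo..hi}" for y
      proof -
        have "is_interval ((\<lambda>t. Im (P t)) ` {0..1})"
          using P(1) unfolding path_def is_interval_connected_1
          by (intro connected_continuous_image continuous_intros) auto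
        moreover have "lo \<in> (\<lambda>t. Im (P t)) ` {0..1}" "hi \<in> (\<lambda>t. Im (P t)) ` {0..1}"
          unfolding lo_def hi_def min_def max_def by auto
        ultimately have "y \<in> (\<lambda>t. Im (P t)) ` {0..1}" using that
          by (meson atLeastAtMost_iff mem_is_interval_1_I)
        then show ?thesis by auto
      qed
      obtain s t where s: "s \<in> {0..1}" "Im (P s) = \<theta> j - \<psi>" and t: "t \<in> {0..1}" "Im (P t) = \<theta> j + \<psi>"
        using ivt[OF j(1)] ivt[OF j(2)] by blast
      \<comment> \<open>Only finitely many sectors were prepared, so the logarithm is shifted by a multiple of the period.\<close>
      define k where "k = j mod int N"
      have k: "k \<in> {0..<int N}" using N(1) by (simp add: k_def)
      define m where "m = j div int N"
      have "j = k + int N * m" by (simp add: k_def m_def)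
      then have \<theta>j: "\<theta> j = \<theta> k + 2 * pi * m" using N(1) by (simp add: \<theta>_def \<psi>_def field_simps)
      define Q where "Q u = subpath s t P u - \<i> * (of_int m * (of_real pi * 2))" for u
      have eQ: "exp (Q u) = exp (subpath s t P u)" for u
        unfolding Q_def by (simp add: exp_diff exp_integer_2pi)
      show False
      proof (rule no[of Q k])
        show "path Q" unfolding path_def Q_def
          using path_subpath[OF P(1) s(1) t(1)] unfolding path_def by (intro continuous_intros)
        show "Im (Q 0) = \<theta> k - \<psi>" "Im (Q 1) = \<theta> k + \<psi>"
          using s t \<theta>j by (auto simp: Q_def subpath_def)
        fix u :: real assume u: "u \<in> {0..1}"
        have "subpath s t P u \<in> P ` {0..1}"
          using path_image_subpath_subset[OF s(1) t(1), of P] u by (auto simp: path_image_def)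
        then obtain u' where u': "u' \<in> {0..1}" "subpath s t P u = P u'" by auto
        show "x k < norm (exp (Q u)) \<and> norm (exp (Q u)) < \<rho> \<and> norm (f (exp (Q u))) \<le> e k"
          unfolding eQ u'(2) using XP[OF u'(1)] X(3)[OF k] E(2)[OF k] by auto
      qed
    qed
  qed
qed

end

section \<open>Lengths of the level curves\<close>

text \<open>On a connected set there are \<open>card S + 1\<close> points whose distances from \<open>a\<close> increase in steps of
  \<open>dist a b / card S\<close>. Two of them lie in the same covering set.\<close>

lemma dist_le_card_cover:
  fixes a b :: "'a::metric_space" and D :: real
  assumes con: "connected A" and a: "a \<in> A" and b: "b \<in> A" and "finite S" and cov: "A \<subseteq> (\<Union>m\<in>S. T m)"
    and diam: "\<And>m x y. m \<in> S \<Longrightarrow> x \<in> T m \<Longrightarrow> y \<in> T m \<Longrightarrow> dist x y \<le> D"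
  shows "dist a b \<le> card S * D"
proof (rule ccontr)
  assume "\<not> ?thesis"
  then have less: "card S * D < dist a b" by simp
  define n where "n = card S"
  have "S \<noteq> {}" using a cov by auto
  then have "n > 0" using \<open>finite S\<close> by (auto simp: n_def card_gt_0_iff)
  define D' where "D' = dist a b / n"
  have D': "D < D'" using less \<open>n > 0\<close> by (simp add: D'_def n_def field_simps)
  have "D' \<ge> 0" by (simp add: D'_def)
  have "\<exists>c\<in>A. dist a c = real k * D'" if "k \<le> n" for k
  proof -
    have "connected ((\<lambda>x. dist a x) ` A)" by (intro connected_continuous_image con continuous_intros)
    moreover have "0 \<in> (\<lambda>x. dist a x) ` A" "dist a b \<in> (\<lambda>x. dist a x) ` A" using a b by force+
    moreover have "0 \<le> real k * D'" "real k * D' \<le> dist a b"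
      using \<open>D' \<ge> 0\<close> that \<open>n > 0\<close> by (auto simp: D'_def field_simps intro!: mult_right_mono)
    ultimately have "real k * D' \<in> (\<lambda>x. dist a x) ` A" by (meson connectedD_interval)
    then show ?thesis by force
  qed
  then obtain c where c: "\<And>k. k \<le> n \<Longrightarrow> c k \<in> A" "\<And>k. k \<le> n \<Longrightarrow> dist a (c k) = real k * D'" by metis
  have "\<exists>m\<in>S. c k \<in> T m" if "k \<le> n" for k using c(1)[OF that] cov by auto
  then obtain m where m: "\<And>k. k \<le> n \<Longrightarrow> m k \<in> S" "\<And>k. k \<le> n \<Longrightarrow> c k \<in> T (m k)" by metis
  have "\<not> inj_on m {..n}"
  proof
    assume "inj_on m {..n}"
    then have "card {..n} \<le> card S" using m(1) \<open>finite S\<close> by (intro card_inj_on_le) auto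
    then show False by (simp add: n_def)
  qed
  then obtain k l where kl: "k \<le> n" "l \<le> n" "k < l" "m k = m l"
    unfolding inj_on_def by (metis atMost_iff linorder_neqE_nat)
  have "1 * D' \<le> (real l - real k) * D'" using kl(3) \<open>D' \<ge> 0\<close>
    by (intro mult_right_mono) auto
  also have "\<dots> = dist a (c l) - dist a (c k)" using c(2) kl by (simp add: algebra_simps)
  also have "\<dots> \<le> dist (c k) (c l)" using dist_triangle[of a "c l" "c k"] by simp
  also have "\<dots> \<le> D" using diam[OF m(1)[OF kl(1)] m(2)[OF kl(1)], of "c l"] m(2)[OF kl(2)] kl(4) by simp
  finally show False using D' by simp
qed

lemma sin_ge_of_between:
  assumes "0 \<le> \<alpha>" "\<alpha> \<le> y" "y \<le> pi - \<alpha>"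
  shows "sin \<alpha> \<le> sin y"
proof (cases "y \<le> pi / 2")
  case True then show ?thesis using assms by (intro sin_monotone_2pi_le) auto
next
  case False
  then have "sin \<alpha> \<le> sin (pi - y)" using assms by (intro sin_monotone_2pi_le) auto
  then show ?thesis by simp
qed

lemma norm_cis_diff: "norm (cis a - cis b) = 2 * \<bar>sin ((a - b) / 2)\<bar>"
proof -
  have "cis a - cis b = cis b * (exp (\<i> * of_real (a - b)) - 1)"
    by (simp add: algebra_simps cis_conv_exp flip: exp_add)
  then show ?thesis using dist_exp_i_1[of "a - b"] by (simp add: norm_mult)
qed

text \<open>When the circle is divided into \<open>N\<close> equal arcs, a full arc lies on either side between two arcs
  that are neither equal nor cyclically adjacent.\<close>

lemma circle_arcs_far:
  fixes N j i :: nat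
  assumes N: "j < N" "i < N" "i \<noteq> j" "i \<noteq> (j + 1) mod N" "i \<noteq> (j + N - 1) mod N"
    and a: "2 * pi * i / N \<le> a" "a \<le> 2 * pi * (i + 1) / N"
    and b: "2 * pi * j / N \<le> b" "b \<le> 2 * pi * (j + 1) / N"
  shows "norm (cis a - cis b) \<ge> 2 * sin (pi / N)"
proof -
  have *: "2 * sin (pi / N) \<le> norm (cis a - cis b)"
    if ij: "j + 2 \<le> i" "i + 2 \<le> j + N" "2 * pi * i / N \<le> a" "a \<le> 2 * pi * (i + 1) / N"
      "2 * pi * j / N \<le> b" "b \<le> 2 * pi * (j + 1) / N" for i j :: nat and a b :: real
  proof -
    have "N > 0" using N by simp
    have "2 * pi / N = 2 * pi * (j + 2) / N - 2 * pi * (j + 1) / N" by (simp add: diff_divide_distrib[symmetric] algebra_simps)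
    also have "\<dots> \<le> 2 * pi * i / N - 2 * pi * (j + 1) / N"
      using ij(1) \<open>N > 0\<close> by (intro diff_right_mono divide_right_mono mult_left_mono) auto
    also have "\<dots> \<le> a - b" using ij by simp
    finally have 1: "pi / N \<le> (a - b) / 2" by (simp add: mult.commute)
    have "a - b \<le> 2 * pi * (i + 1) / N - 2 * pi * j / N" using ij by simp
    also have "\<dots> \<le> 2 * pi * (real (j + N) - 1) / N - 2 * pi * j / N"
      using ij(2) \<open>N > 0\<close> by (intro diff_right_mono divide_right_mono mult_left_mono) auto
    also have "\<dots> = 2 * pi - 2 * pi / N" using \<open>N > 0\<close> by (simp add: field_simps)
    finally have 2: "(a - b) / 2 \<le> pi - pi / N" by (simp add: mult.commute)
    have "sin (pi / N) \<le> sin ((a - b) / 2)" using 1 2 by (intro sin_ge_of_between) auto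
    then show ?thesis unfolding norm_cis_diff by simp
  qed
  show ?thesis
  proof (cases "j < i")
    case True
    have "i \<noteq> j + 1" using N by (cases "j + 1 < N") auto
    moreover have "i + 2 \<le> j + N"
    proof (cases "j = 0")
      case True then show ?thesis using N \<open>j < i\<close> by (auto simp: Suc_diff_Suc)
    next
      case False then show ?thesis using N by simp
    qed
    ultimately show ?thesis using True a b by (intro *) auto
  next
    case False
    then have "i < j" using N by simp
    have "(j + N - 1) mod N = j - 1" using \<open>i < j\<close> N(1)
      by (metis (no_types, opaque_lifting) Nat.diff_add_assoc2 One_nat_def Suc_leI less_imp_diff_less mod_add_self2 mod_less not_less_zero zero_less_iff_neq_zero)
    then have "i + 2 \<le> j" using N \<open>i < j\<close> by simp
    moreover have "j + 2 \<le> i + N"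
    proof (cases "i = 0")
      case True
      have "j + 1 \<noteq> N" using N(4) True N by auto
      then show ?thesis using True N by simp
    next
      case False then show ?thesis using N by simp
    qed
    ultimately have "2 * sin (pi / N) \<le> norm (cis b - cis a)" using a b by (intro *) auto
    then show ?thesis by (simp add: norm_minus_commute)
  qed
qed

text \<open>The boundary is parametrized by a Lipschitz map \<open>g\<close>, and \<open>\<Omega>\<close> is locally connected at each
  boundary point.\<close>

locale rectifiable_exterior = exterior_conformal +
  fixes g :: "real \<Rightarrow> complex" and K :: real
  assumes lc: "\<And>q \<epsilon>. q \<in> J \<Longrightarrow> \<epsilon> > 0 \<Longrightarrow> \<exists>\<delta>>0. \<forall>x\<in>\<Omega> \<inter> ball q \<delta>. \<forall>y\<in>\<Omega> \<inter> ball q \<delta>.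
        \<exists>p. path p \<and> pathstart p = x \<and> pathfinish p = y \<and> path_image p \<subseteq> \<Omega> \<inter> ball q \<epsilon>"
    and J_eq: "J = g ` {0..1}"
    and lip: "\<And>s t. s \<in> {0..1} \<Longrightarrow> t \<in> {0..1} \<Longrightarrow> dist (g s) (g t) \<le> K * dist s t"
begin

lemma K_nonneg: "K \<ge> 0"
  using order_trans[OF zero_le_dist lip[of 0 1]] by simp

text \<open>The oscillation estimate at single boundary points becomes uniform through a Lebesgue number of
  the cover of \<open>J\<close> by the corresponding balls.\<close>

lemma \<Phi>_uniformly_continuous_near_boundary:
  assumes "\<eta> > 0"
  obtains d r where "d > 0" "r0 < r"
    "\<And>z z'. r0 < norm z \<Longrightarrow> norm z < r \<Longrightarrow> r0 < norm z' \<Longrightarrow> norm z' < r \<Longrightarrow> dist (\<Psi> z) (\<Psi> z') < d \<Longrightarrow> dist z z' < \<eta>"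
proof -
  have "\<forall>q\<in>J. \<exists>\<delta>>0. \<forall>x\<in>\<Omega> \<inter> ball q \<delta>. \<forall>y\<in>\<Omega> \<inter> ball q \<delta>. dist (\<Phi> x) (\<Phi> y) < \<eta>"
    using \<Phi>_oscillation_small[OF _ \<open>\<eta> > 0\<close> lc] by simp
  then obtain \<delta> where \<delta>: "\<And>q. q \<in> J \<Longrightarrow> \<delta> q > 0"
    "\<And>q x y. q \<in> J \<Longrightarrow> x \<in> \<Omega> \<inter> ball q (\<delta> q) \<Longrightarrow> y \<in> \<Omega> \<inter> ball q (\<delta> q) \<Longrightarrow> dist (\<Phi> x) (\<Phi> y) < \<eta>"
    by metis
  have "J \<subseteq> \<Union> ((\<lambda>q. ball q (\<delta> q)) ` J)" using \<delta>(1) by force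
  then obtain e where e: "0 < e" "\<And>x. x \<in> J \<Longrightarrow> \<exists>G\<in>(\<lambda>q. ball q (\<delta> q)) ` J. ball x e \<subseteq> G"
    by (rule Heine_Borel_lemma[OF compact_J]) auto
  obtain r where r: "r0 < r" "\<And>z. r0 < norm z \<Longrightarrow> norm z < r \<Longrightarrow> \<exists>q\<in>J. dist (\<Psi> z) q < e / 2"
    using \<Psi>_near_J[of "e / 2"] e(1) by auto
  show ?thesis
  proof
    show "e / 2 > 0" "r0 < r" using e r by auto
    fix z z' :: complex
    assume z: "r0 < norm z" "norm z < r" "r0 < norm z'" "norm z' < r" "dist (\<Psi> z) (\<Psi> z') < e / 2"
    obtain x where x: "x \<in> J" "dist (\<Psi> z) x < e / 2" using r(2) z by blast
    have "dist (\<Psi> z') x < e"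
      using x(2) z(5) dist_triangle[of "\<Psi> z'" x "\<Psi> z"] by (simp add: dist_commute)
    then have "\<Psi> z \<in> ball x e" "\<Psi> z' \<in> ball x e" using x e by (auto simp: dist_commute)
    moreover obtain q where "q \<in> J" "ball x e \<subseteq> ball q (\<delta> q)" using e(2)[OF x(1)] by blast
    ultimately have "dist (\<Phi> (\<Psi> z)) (\<Phi> (\<Psi> z')) < \<eta>"
      using \<delta>(2)[of q] \<Psi>_in z by blast
    then show "dist z z' < \<eta>" using \<Phi>_\<Psi> z by simp
  qed
qed

text \<open>Divide the parameter interval of \<open>g\<close> into \<open>M\<close> equal parts and let \<open>T m\<close> be the \<open>\<delta>\<close>-neighbourhood
  of the \<open>m\<close>-th piece of the curve; its diameter is at most \<open>(K + 1) / M\<close>. Near the circle the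
  images \<open>A j\<close> of the \<open>N\<close> arcs are covered by the sets \<open>T m\<close>. Each chord is bounded by the number
  of sets that meet \<open>A j\<close> times their diameter. For large \<open>M\<close> uniform continuity of \<open>\<Phi>\<close> allows a
  set \<open>T m\<close> to meet \<open>A j\<close> only for three adjacent indices \<open>j\<close>, so that the total is at most \<open>3 M\<close>
  times the diameter.\<close>

lemma chord_sum_near_circle:
  assumes "N \<ge> 2"
  obtains r where "r0 < r"
    "\<And>z. r0 < norm z \<Longrightarrow> norm z < r \<Longrightarrow>
      (\<Sum>j<N. norm (\<Psi> (z * cis (2 * pi * (real j + 1) / N)) - \<Psi> (z * cis (2 * pi * j / N)))) \<le> 3 * (K + 1)"
proof -
  define \<eta> where "\<eta> = r0 * (2 * sin (pi / N))"
  have "sin (pi / N) > 0" using \<open>N \<ge> 2\<close> by (intro sin_gt_zero) (auto simp: field_simps)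
  then have "\<eta> > 0" using r0 by (simp add: \<eta>_def)
  obtain d r1 where d: "d > 0" "r0 < r1" and
    d': "\<And>z z'. r0 < norm z \<Longrightarrow> norm z < r1 \<Longrightarrow> r0 < norm z' \<Longrightarrow> norm z' < r1 \<Longrightarrow> dist (\<Psi> z) (\<Psi> z') < d \<Longrightarrow> dist z z' < \<eta>"
    using \<Phi>_uniformly_continuous_near_boundary[OF \<open>\<eta> > 0\<close>] by blast
  obtain M0 :: nat where "(K + 1) / d < M0" using reals_Archimedean2 by blast
  define M where "M = Suc M0"
  have "M > 0" and M: "(K + 1) / M < d"
  proof -
    show "M > 0" by (simp add: M_def)
    have "K + 1 < M0 * d" using \<open>(K + 1) / d < M0\<close> d by (simp add: field_simps)
    also have "\<dots> \<le> M * d" using d by (simp add: M_def)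
    finally show "(K + 1) / M < d" using \<open>M > 0\<close> by (simp add: field_simps)
  qed
  \<comment> \<open>Enlarging each piece by this \<open>\<delta>\<close> adds \<open>1 / M\<close> to its diameter.\<close>
  define \<delta> where "\<delta> = 1 / (2 * real M)"
  have "\<delta> > 0" using \<open>M > 0\<close> by (simp add: \<delta>_def)
  obtain r2 where r2: "r0 < r2" "\<And>z. r0 < norm z \<Longrightarrow> norm z < r2 \<Longrightarrow> \<exists>q\<in>J. dist (\<Psi> z) q < \<delta>"
    using \<Psi>_near_J[OF \<open>\<delta> > 0\<close>] by blast
  define T where "T m = {x. \<exists>s\<in>{0..1}. real m / M \<le> s \<and> s \<le> (real m + 1) / M \<and> dist x (g s) < \<delta>}" for m :: nat
  have T_diam: "dist x y \<le> (K + 1) / M" if x: "x \<in> T m" and y: "y \<in> T m" for x y m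
  proof -
    obtain s where s: "s \<in> {0..1}" "real m / M \<le> s" "s \<le> (real m + 1) / M" "dist x (g s) < \<delta>"
      using x by (auto simp: T_def)
    obtain t where t: "t \<in> {0..1}" "real m / M \<le> t" "t \<le> (real m + 1) / M" "dist y (g t) < \<delta>"
      using y by (auto simp: T_def)
    have "dist s t \<le> 1 / M" using s t by (simp add: dist_real_def abs_le_iff add_divide_distrib)
    then have "dist (g s) (g t) \<le> K * (1 / M)"
      using lip[OF s(1) t(1)] K_nonneg by (meson mult_left_mono order_trans)
    moreover have "dist x y \<le> dist x (g s) + (dist (g s) (g t) + dist y (g t))"
      by (metis dist_commute dist_triangle add_left_mono order_trans)
    ultimately have "dist x y \<le> K * (1 / M) + 2 * \<delta>" using s t by linarith
    then show ?thesis by (simp add: \<delta>_def add_divide_distrib)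
  qed
  have T_cover: "\<exists>m<M. \<Psi> z \<in> T m" if z: "r0 < norm z" "norm z < r2" for z
  proof -
    obtain s where s: "s \<in> {0..1}" "dist (\<Psi> z) (g s) < \<delta>" using r2(2)[OF z] J_eq by auto
    define m where "m = (if s = 1 then M - 1 else nat \<lfloor>s * M\<rfloor>)"
    have "m < M \<and> real m / M \<le> s \<and> s \<le> (real m + 1) / M"
    proof (cases "s = 1")
      case True
      then show ?thesis using \<open>M > 0\<close> by (simp add: m_def of_nat_diff field_simps)
    next
      case False
      have "0 \<le> s * M" "s * M < M" using s False \<open>M > 0\<close> by auto
      then have "real m \<le> s * M" "s * M < real m + 1" "m < M"
        using False by (auto simp: m_def nat_less_iff floor_less_iff)
      then show ?thesis using \<open>M > 0\<close> by (simp add: field_simps)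
    qed
    then show ?thesis unfolding T_def using s by blast
  qed
  show ?thesis
  proof
    show "r0 < min r1 r2" using d r2 by simp
    fix z :: complex assume z: "r0 < norm z" "norm z < min r1 r2"
    define I where "I j = {2 * pi * real j / N .. 2 * pi * (real j + 1) / N}" for j :: nat
    define A where "A j = (\<lambda>\<phi>. \<Psi> (z * cis \<phi>)) ` I j" for j
    have nz: "norm (z * cis \<phi>) = norm z" for \<phi> by (simp add: norm_mult)
    have conA: "connected (A j)" for j
      unfolding A_def I_def
      by (intro connected_continuous_image continuous_on_compose2[OF cont_\<Psi>] continuous_intros)
        (use z in \<open>auto simp: exterior_disc_def norm_mult\<close>)
    define S where "S j = {m. m < M \<and> T m \<inter> A j \<noteq> {}}" for j
    have chord: "norm (\<Psi> (z * cis (2 * pi * (real j + 1) / N)) - \<Psi> (z * cis (2 * pi * real j / N)))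
        \<le> card (S j) * ((K + 1) / M)" if "j < N" for j
    proof -
      have I: "2 * pi * (real j + 1) / N \<in> I j" "2 * pi * real j / N \<in> I j"
        using that by (auto simp: I_def field_simps)
      have "dist (\<Psi> (z * cis (2 * pi * (real j + 1) / N))) (\<Psi> (z * cis (2 * pi * real j / N))) \<le> card (S j) * ((K + 1) / M)"
      proof (rule dist_le_card_cover[where T = T and A = "A j"])
        show "connected (A j)" by (rule conA)
        show "\<Psi> (z * cis (2 * pi * (real j + 1) / N)) \<in> A j" "\<Psi> (z * cis (2 * pi * real j / N)) \<in> A j"
          unfolding A_def using I by blast+
        show "finite (S j)" by (simp add: S_def)
        show "A j \<subseteq> (\<Union>m\<in>S j. T m)"
        proof
          fix x assume x: "x \<in> A j"
          then obtain \<phi> where "x = \<Psi> (z * cis \<phi>)" by (auto simp: A_def)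
          then obtain m where "m < M" "x \<in> T m" using T_cover[of "z * cis \<phi>"] z nz by auto
          then show "x \<in> (\<Union>m\<in>S j. T m)" using x by (auto simp: S_def)
        qed
      qed (rule T_diam)
      then show ?thesis by (simp add: dist_norm)
    qed
    \<comment> \<open>Points with images in the same \<open>T m\<close> are less than the chord \<open>\<eta>\<close> of one arc apart.\<close>
    have three: "card {j. j < N \<and> m \<in> S j} \<le> 3" if "m < M" for m
    proof (cases "\<exists>j0<N. m \<in> S j0")
      case False
      then have e: "{j. j < N \<and> m \<in> S j} = {}" by auto
      show ?thesis unfolding e by simp
    next
      case True
      then obtain j0 where j0: "j0 < N" "m \<in> S j0" by blast
      then obtain b where b: "b \<in> I j0" "\<Psi> (z * cis b) \<in> T m" by (auto simp: S_def A_def)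
      have "{j. j < N \<and> m \<in> S j} \<subseteq> {j0, (j0 + 1) mod N, (j0 + N - 1) mod N}"
      proof (rule ccontr)
        assume "\<not> ?thesis"
        then obtain j where j: "j < N" "m \<in> S j" "j \<noteq> j0" "j \<noteq> (j0 + 1) mod N" "j \<noteq> (j0 + N - 1) mod N" by blast
        then obtain a where a: "a \<in> I j" "\<Psi> (z * cis a) \<in> T m" by (auto simp: S_def A_def)
        have "dist (z * cis a) (z * cis b) < \<eta>"
          using T_diam[OF a(2) b(2)] M z nz by (intro d') auto
        then have "norm z * norm (cis a - cis b) < \<eta>" by (simp add: dist_norm norm_mult flip: right_diff_distrib)
        moreover have "2 * sin (pi / N) \<le> norm (cis a - cis b)"
          using circle_arcs_far[OF j0(1) j(1,3,4,5), of a b] a(1) b(1) by (simp add: I_def add.commute)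
        then have "\<eta> \<le> norm z * norm (cis a - cis b)"
          unfolding \<eta>_def using z r0 \<open>sin (pi / N) > 0\<close> by (intro mult_mono) auto
        ultimately show False by simp
      qed
      then have "card {j. j < N \<and> m \<in> S j} \<le> card {j0, (j0 + 1) mod N, (j0 + N - 1) mod N}"
        by (intro card_mono) auto
      also have "\<dots> \<le> 3" by (simp add: card_insert_if)
      finally show ?thesis .
    qed
    have cS: "card (S j) = (\<Sum>m<M. if m \<in> S j then 1 else 0)" for j
    proof -
      have "S j = {m \<in> {..<M}. m \<in> S j}" by (auto simp: S_def)
      then show ?thesis by (simp add: sum.If_cases Int_def)
    qed
    have "(\<Sum>j<N. card (S j)) = (\<Sum>m<M. \<Sum>j<N. if m \<in> S j then 1 else 0)"
      unfolding cS by (rule sum.swap)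
    also have "\<dots> = (\<Sum>m<M. card {j. j < N \<and> m \<in> S j})"
      by (intro sum.cong refl) (simp add: sum.If_cases Int_def)
    also have "\<dots> \<le> (\<Sum>m<M. 3)" by (intro sum_mono three) auto
    finally have total: "(\<Sum>j<N. card (S j)) \<le> 3 * M" by simp
    have "(\<Sum>j<N. norm (\<Psi> (z * cis (2 * pi * (real j + 1) / N)) - \<Psi> (z * cis (2 * pi * real j / N))))
        \<le> (\<Sum>j<N. card (S j) * ((K + 1) / M))" by (intro sum_mono chord) auto
    also have "\<dots> = real (\<Sum>j<N. card (S j)) * ((K + 1) / M)" by (simp only: of_nat_sum sum_distrib_right)
    also have "\<dots> \<le> (3 * real M) * ((K + 1) / M)"
    proof (rule mult_right_mono)
      show "real (\<Sum>j<N. card (S j)) \<le> 3 * real M"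
        using of_nat_mono[OF total, where 'a = real] by simp
    qed (use K_nonneg in simp)
    also have "\<dots> = 3 * (K + 1)" using \<open>M > 0\<close> by simp
    finally show "(\<Sum>j<N. norm (\<Psi> (z * cis (2 * pi * (real j + 1) / N)) - \<Psi> (z * cis (2 * pi * j / N)))) \<le> 3 * (K + 1)"
      by (simp add: add.commute)
  qed
qed

lemma circle_map_derivative:
  assumes "r0 < norm z"
  shows "((\<lambda>\<phi>. \<Psi> (z * cis \<phi>)) has_vector_derivative z * (\<i> * cis \<phi>) * deriv \<Psi> (z * cis \<phi>)) (at \<phi>)"
proof -
  have ope: "open (exterior_disc r0)"
    unfolding exterior_disc_def by (intro open_Collect_less continuous_intros)
  have "z * cis \<phi> \<in> exterior_disc r0" using assms by (simp add: exterior_disc_def norm_mult)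
  then have "(\<Psi> has_field_derivative deriv \<Psi> (z * cis \<phi>)) (at (z * cis \<phi>))"
    using holomorphic_derivI[OF hol_\<Psi> ope] by blast
  moreover have "((\<lambda>\<phi>. z * cis \<phi>) has_vector_derivative z * (\<i> * cis \<phi>)) (at \<phi>)"
  proof -
    have "((\<lambda>w. z * exp (\<i> * w)) has_field_derivative z * (\<i> * exp (\<i> * of_real \<phi>))) (at (of_real \<phi>))"
      by (auto intro!: derivative_eq_intros)
    then show ?thesis unfolding cis_conv_exp by (rule has_vector_derivative_real_field)
  qed
  ultimately show ?thesis using field_vector_diff_chain_at[of "\<lambda>\<phi>. z * cis \<phi>" _ \<phi> \<Psi>] by (simp add: o_def)
qed

lemma chord_le_on_circle:
  assumes "r0 < norm z" "a \<le> b" "\<And>\<phi>. norm (deriv \<Psi> (z * cis \<phi>)) \<le> D"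
  shows "norm (\<Psi> (z * cis b) - \<Psi> (z * cis a)) \<le> norm z * D * (b - a)"
proof -
  have d: "((\<lambda>\<phi>. \<Psi> (z * cis \<phi>)) has_vector_derivative z * (\<i> * cis \<phi>) * deriv \<Psi> (z * cis \<phi>)) (at \<phi>)" for \<phi>
    by (rule circle_map_derivative[OF assms(1)])
  show ?thesis
  proof (cases "a < b")
    case True
    have "continuous_on {a..b} (\<lambda>\<phi>. \<Psi> (z * cis \<phi>))"
      by (rule continuous_at_imp_continuous_on) (use has_vector_derivative_continuous[OF d] in blast)
    then have "\<exists>x\<in>{a<..<b}. norm (\<Psi> (z * cis b) - \<Psi> (z * cis a))
        \<le> norm ((b - a) *\<^sub>R (z * (\<i> * cis x) * deriv \<Psi> (z * cis x)))"
      by (rule mvt_general[OF True]) (use d in \<open>simp add: has_vector_derivative_def\<close>)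
    then obtain x where "norm (\<Psi> (z * cis b) - \<Psi> (z * cis a))
        \<le> norm ((b - a) *\<^sub>R (z * (\<i> * cis x) * deriv \<Psi> (z * cis x)))" by blast
    also have "\<dots> \<le> norm z * D * (b - a)"
      using True mult_left_mono[OF assms(3)[of x], of "norm z"] by (simp add: norm_mult mult.commute)
    finally show ?thesis .
  qed (use assms in simp)
qed

text \<open>A sum of moduli of holomorphic functions obeys the maximum principle on an annulus. On the inner
  circle the chord sum is bounded by the length of the boundary curve, on the outer circle by the
  length of the smooth image curve, in both cases independently of \<open>N\<close>.\<close>

lemma chord_sum_bounded:
  assumes "r0 < R"
  obtains C where "\<And>N z. N \<ge> 2 \<Longrightarrow> r0 < norm z \<Longrightarrow> norm z < R \<Longrightarrow>
      (\<Sum>j<N. norm (\<Psi> (z * cis (2 * pi * (real j + 1) / N)) - \<Psi> (z * cis (2 * pi * real j / N)))) \<le> C"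
proof -
  have ope: "open (exterior_disc r0)"
    unfolding exterior_disc_def by (intro open_Collect_less continuous_intros)
  have "compact (deriv \<Psi> ` sphere 0 R)"
    using assms by (intro compact_continuous_image continuous_on_subset[OF holomorphic_on_imp_continuous_on[OF holomorphic_deriv[OF hol_\<Psi> ope]]])
      (auto simp: exterior_disc_def)
  then obtain D where D: "\<And>z. norm z = R \<Longrightarrow> norm (deriv \<Psi> z) \<le> D"
    unfolding compact_eq_bounded_closed bounded_iff by (metis imageI mem_sphere_0)
  define C where "C = max (3 * (K + 1)) (R * D * (2 * pi))"
  show ?thesis
  proof
    fix N :: nat and z0 :: complex assume "N \<ge> 2" and z0: "r0 < norm z0" "norm z0 < R"
    define f where "f j z = \<Psi> (z * cis (2 * pi * (real j + 1) / N)) - \<Psi> (z * cis (2 * pi * real j / N))" for j :: nat and z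
    obtain r where r: "r0 < r" "\<And>z. r0 < norm z \<Longrightarrow> norm z < r \<Longrightarrow> (\<Sum>j<N. norm (f j z)) \<le> 3 * (K + 1)"
      using chord_sum_near_circle[OF \<open>N \<ge> 2\<close>] unfolding f_def by blast
    have outer: "(\<Sum>j<N. norm (f j z)) \<le> R * D * (2 * pi)" if "norm z = R" for z
    proof -
      have "norm (f j z) \<le> R * D * (2 * pi / N)" for j
      proof -
        have "norm (f j z) \<le> norm z * D * (2 * pi * (real j + 1) / N - 2 * pi * real j / N)"
          unfolding f_def using that assms \<open>N \<ge> 2\<close>
          by (intro chord_le_on_circle D) (auto simp: norm_mult field_simps)
        also have "2 * pi * (real j + 1) / N - 2 * pi * real j / N = 2 * pi / N"
          by (simp add: diff_divide_distrib[symmetric] algebra_simps)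
        finally show ?thesis using that by simp
      qed
      then have "(\<Sum>j<N. norm (f j z)) \<le> (\<Sum>j<N. R * D * (2 * pi / N))" by (intro sum_mono)
      then show ?thesis using \<open>N \<ge> 2\<close> by simp
    qed
    have "(\<Sum>j<N. norm (f j z0)) \<le> C"
    proof (cases "norm z0 < r")
      case True
      then show ?thesis using r(2)[OF z0(1)] by (simp add: C_def)
    next
      case False
      obtain \<rho> where \<rho>: "r0 < \<rho>" "\<rho> < r" using dense[OF r(1)] by blast
      let ?S = "{z :: complex. \<rho> < norm z \<and> norm z < R}"
      \<comment> \<open>Unimodular weights turn the sum of moduli at \<open>z0\<close> into the value of a holomorphic function.\<close>
      define F where "F z = (\<Sum>j<N. cnj (sgn (f j z0)) * f j z)" for z
      have opS: "open ?S" by (intro open_Collect_conj open_Collect_less continuous_intros)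
      have clS: "closure ?S \<subseteq> {z. \<rho> \<le> norm z \<and> norm z \<le> R}"
        by (rule closure_minimal) (auto intro!: closed_Collect_conj closed_Collect_le continuous_intros)
      have ext: "{z. \<rho> \<le> norm z \<and> norm z \<le> R} \<subseteq> exterior_disc r0"
        using \<rho> by (auto simp: exterior_disc_def)
      have holf: "f j holomorphic_on exterior_disc r0" for j
      proof -
        have "(\<lambda>z. \<Psi> (z * cis a)) holomorphic_on exterior_disc r0" for a
          by (intro holomorphic_on_compose_gen[OF _ hol_\<Psi>, unfolded o_def] holomorphic_intros)
            (auto simp: exterior_disc_def norm_mult)
        then show ?thesis unfolding f_def by (intro holomorphic_intros)
      qed
      have holF: "F holomorphic_on exterior_disc r0"
        unfolding F_def by (intro holomorphic_intros holf)
      have F_le: "norm (F z) \<le> (\<Sum>j<N. norm (f j z))" for z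
        unfolding F_def by (intro order_trans[OF norm_sum] sum_mono) (simp add: norm_mult norm_sgn)
      have "norm (F z0) \<le> C"
      proof (rule maximum_modulus_frontier[where f = F and S = ?S])
        show "F holomorphic_on interior ?S"
          by (rule holomorphic_on_subset[OF holF]) (use ext in \<open>auto dest!: subsetD[OF interior_subset] intro!: subsetD[OF ext]\<close>)
        show "continuous_on (closure ?S) F"
          by (rule continuous_on_subset[OF holomorphic_on_imp_continuous_on[OF holF] order_trans[OF clS ext]])
        show "bounded ?S" by (rule bounded_subset[OF bounded_cball[of 0 R]]) auto
        show "z0 \<in> ?S" using False \<rho> z0 by auto
        fix z :: complex assume "z \<in> frontier ?S"
        then have "z \<in> closure ?S" "z \<notin> ?S" using opS by (auto simp: frontier_def interior_open)
        then have "\<rho> \<le> norm z" "norm z \<le> R" "\<not> (\<rho> < norm z \<and> norm z < R)"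
          using subsetD[OF clS, of z] by simp_all
        then consider "norm z = \<rho>" | "norm z = R" by (meson antisym_conv not_less)
        then show "norm (F z) \<le> C"
        proof cases
          case 1
          then have "(\<Sum>j<N. norm (f j z)) \<le> 3 * (K + 1)" using r(2) \<rho> by simp
          then show ?thesis using F_le[of z] by (simp add: C_def)
        next
          case 2
          then show ?thesis using F_le[of z] outer[OF 2] by (simp add: C_def)
        qed
      qed
      moreover have "F z0 = of_real (\<Sum>j<N. norm (f j z0))"
      proof -
        have "cnj (sgn w) * w = of_real (norm w)" for w :: complex
        proof (cases "w = 0")
          case False
          have "cnj (sgn w) * w = (w * cnj w) / of_real (norm w)" by (simp add: sgn_eq)
          also have "\<dots> = of_real ((norm w)\<^sup>2) / of_real (norm w)" by (simp only: complex_norm_square)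
          finally show ?thesis using False by (simp add: power2_eq_square)
        qed simp
        then show ?thesis by (simp add: F_def)
      qed
      moreover have "0 \<le> (\<Sum>j<N. norm (f j z0))" by (intro sum_nonneg) simp
      ultimately show ?thesis by (simp only: norm_of_real abs_of_nonneg)
    qed
    then show "(\<Sum>j<N. norm (\<Psi> (z0 * cis (2 * pi * (real j + 1) / N)) - \<Psi> (z0 * cis (2 * pi * real j / N)))) \<le> C"
      by (simp add: f_def)
  qed
qed

end

lemma length_le_of_chord_sums:
  fixes \<gamma> \<gamma>' :: "real \<Rightarrow> complex" and L C :: real
  assumes "L > 0" and d: "\<And>s. s \<in> {0..L} \<Longrightarrow> (\<gamma> has_vector_derivative \<gamma>' s) (at s within {0..L})"
    and cont: "continuous_on {0..L} \<gamma>'"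
    and chords: "\<And>N. N \<ge> 2 \<Longrightarrow> (\<Sum>j<N. norm (\<gamma> (L * (real j + 1) / N) - \<gamma> (L * real j / N))) \<le> C"
  shows "integral {0..L} (\<lambda>s. norm (\<gamma>' s)) \<le> C"
proof (rule field_le_epsilon)
  fix e :: real assume "e > 0"
  define \<epsilon> where "\<epsilon> = e / (2 * L)"
  have "\<epsilon> > 0" using \<open>e > 0\<close> \<open>L > 0\<close> by (simp add: \<epsilon>_def)
  have "uniformly_continuous_on {0..L} \<gamma>'" using cont by (intro compact_uniformly_continuous) auto
  then obtain \<delta> where \<delta>: "\<delta> > 0" "\<And>s t. s \<in> {0..L} \<Longrightarrow> t \<in> {0..L} \<Longrightarrow> dist s t < \<delta> \<Longrightarrow> dist (\<gamma>' s) (\<gamma>' t) < \<epsilon>"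
    using \<open>\<epsilon> > 0\<close> unfolding uniformly_continuous_on_def by metis
  obtain N0 :: nat where "L / \<delta> < N0" using reals_Archimedean2 by blast
  define N where "N = N0 + 2"
  have N: "N \<ge> 2" "L / N < \<delta>"
  proof -
    show "N \<ge> 2" by (simp add: N_def)
    have "L < N0 * \<delta>" using \<open>L / \<delta> < N0\<close> \<delta>(1) by (simp add: field_simps)
    also have "\<dots> \<le> N * \<delta>" using \<delta>(1) by (simp add: N_def)
    finally show "L / N < \<delta>" using \<open>N \<ge> 2\<close> by (simp add: field_simps)
  qed
  define a where "a j = L * real j / N" for j :: nat
  have a_step: "a (Suc j) - a j = L / N" for j
    unfolding a_def diff_divide_distrib[symmetric] by (simp add: algebra_simps)
  have a_mono: "a j \<le> a (Suc j)" for j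
  proof -
    have "0 \<le> L / N" using \<open>L > 0\<close> by simp
    then show ?thesis using a_step[of j] by linarith
  qed
  have a_ran: "a j \<in> {0..L}" if "j \<le> N" for j
    using that \<open>L > 0\<close> N by (auto simp: a_def field_simps)
  have ctn: "continuous_on {0..L} (\<lambda>s. norm (\<gamma>' s))" by (intro continuous_intros cont)
  have piece: "integral {a j..a (Suc j)} (\<lambda>s. norm (\<gamma>' s)) \<le> norm (\<gamma> (a (Suc j)) - \<gamma> (a j)) + 2 * \<epsilon> * (L / N)"
    if "j < N" for j
  proof -
    have sub: "{a j..a (Suc j)} \<subseteq> {0..L}" using a_ran[of j] a_ran[of "Suc j"] that by auto
    have near: "norm (\<gamma>' s - \<gamma>' (a j)) \<le> \<epsilon>" if s: "s \<in> {a j..a (Suc j)}" for s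
    proof -
      have "dist s (a j) < \<delta>" using s a_step[of j] N(2) by (auto simp: dist_real_def)
      then show ?thesis using \<delta>(2)[of s "a j"] sub s a_ran[of j] \<open>j < N\<close> by (auto simp: dist_norm intro: less_imp_le)
    qed
    have dj: "(\<gamma> has_vector_derivative \<gamma>' s) (at s within {a j..a (Suc j)})" if "s \<in> {a j..a (Suc j)}" for s
      using has_vector_derivative_within_subset[OF d[of s] sub] sub that by blast
    have "norm (\<gamma> (a (Suc j)) - \<gamma> (a j) - (a (Suc j) - a j) *\<^sub>R \<gamma>' (a j)) \<le> norm (a (Suc j) - a j) * \<epsilon>"
      using a_mono[of j]
      by (intro vector_differentiable_bound_linearization[where S = "{a j..a (Suc j)}" and f = \<gamma>] dj near)
        (auto simp: closed_segment_eq_real_ivl)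
    then have 1: "L / N * norm (\<gamma>' (a j)) \<le> norm (\<gamma> (a (Suc j)) - \<gamma> (a j)) + L / N * \<epsilon>"
      unfolding a_step using \<open>L > 0\<close>
        norm_triangle_ineq2[of "(L / N) *\<^sub>R \<gamma>' (a j)" "\<gamma> (a (Suc j)) - \<gamma> (a j)"]
      by (simp add: norm_minus_commute)
    have "integral {a j..a (Suc j)} (\<lambda>s. norm (\<gamma>' s)) \<le> integral {a j..a (Suc j)} (\<lambda>s. norm (\<gamma>' (a j)) + \<epsilon>)"
    proof (intro integral_le)
      show "(\<lambda>s. norm (\<gamma>' s)) integrable_on {a j..a (Suc j)}"
        by (intro integrable_continuous_real continuous_on_subset[OF ctn sub])
      show "norm (\<gamma>' s) \<le> norm (\<gamma>' (a j)) + \<epsilon>" if "s \<in> {a j..a (Suc j)}" for s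
        using near[OF that] norm_triangle_sub[of "\<gamma>' s" "\<gamma>' (a j)"] by linarith
    qed auto
    also have "\<dots> = L / N * norm (\<gamma>' (a j)) + L / N * \<epsilon>"
      using a_mono[of j] a_step[of j] by (simp add: algebra_simps)
    also have "\<dots> \<le> (norm (\<gamma> (a (Suc j)) - \<gamma> (a j)) + L / N * \<epsilon>) + L / N * \<epsilon>"
      using 1 by simp
    also have "\<dots> = norm (\<gamma> (a (Suc j)) - \<gamma> (a j)) + 2 * \<epsilon> * (L / N)" by simp
    finally show ?thesis .
  qed
  have sumup: "integral {0..a n} (\<lambda>s. norm (\<gamma>' s)) = (\<Sum>j<n. integral {a j..a (Suc j)} (\<lambda>s. norm (\<gamma>' s)))"
    if "n \<le> N" for n
    using that
  proof (induction n)
    case 0 then show ?case by (simp add: a_def)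
  next
    case (Suc n)
    have "integral {0..a n} (\<lambda>s. norm (\<gamma>' s)) + integral {a n..a (Suc n)} (\<lambda>s. norm (\<gamma>' s))
        = integral {0..a (Suc n)} (\<lambda>s. norm (\<gamma>' s))"
      using a_ran[of n] a_ran[of "Suc n"] Suc a_mono[of n]
      by (intro Henstock_Kurzweil_Integration.integral_combine integrable_continuous_real continuous_on_subset[OF ctn]) auto
    then show ?case using Suc by simp
  qed
  have "integral {0..L} (\<lambda>s. norm (\<gamma>' s)) = (\<Sum>j<N. integral {a j..a (Suc j)} (\<lambda>s. norm (\<gamma>' s)))"
    using sumup[of N] N by (simp add: a_def)
  also have "\<dots> \<le> (\<Sum>j<N. norm (\<gamma> (a (Suc j)) - \<gamma> (a j)) + 2 * \<epsilon> * (L / N))"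
    by (intro sum_mono piece) auto
  also have "\<dots> \<le> C + 2 * \<epsilon> * L"
    using chords[OF N(1)] N by (simp add: sum.distrib a_def add.commute)
  also have "2 * \<epsilon> * L = e" using \<open>L > 0\<close> by (simp add: \<epsilon>_def)
  finally show "integral {0..L} (\<lambda>s. norm (\<gamma>' s)) \<le> C + e" .
qed

context rectifiable_exterior begin

text \<open>The theorem of F. and M. Riesz: the chord sums are bounded independently of \<open>N\<close>, so the lengths
  of the level curves are bounded by the same constant.\<close>

lemma integral_means_bounded:
  assumes "r0 < R"
  obtains C where "\<And>r. r0 < r \<Longrightarrow> r < R \<Longrightarrow> integral {0..2 * pi} (\<lambda>\<phi>. r * norm (deriv \<Psi> (of_real r * cis \<phi>))) \<le> C"
proof -
  obtain C where C: "\<And>N z. N \<ge> 2 \<Longrightarrow> r0 < norm z \<Longrightarrow> norm z < R \<Longrightarrow>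
      (\<Sum>j<N. norm (\<Psi> (z * cis (2 * pi * (real j + 1) / N)) - \<Psi> (z * cis (2 * pi * real j / N)))) \<le> C"
    using chord_sum_bounded[OF assms] by blast
  have ope: "open (exterior_disc r0)"
    unfolding exterior_disc_def by (intro open_Collect_less continuous_intros)
  show ?thesis
  proof
    fix r assume r: "r0 < r" "r < R"
    let ?z = "complex_of_real r"
    have inx: "?z * cis \<phi> \<in> exterior_disc r0" for \<phi> using r r0 by (simp add: exterior_disc_def norm_mult)
    have cd: "continuous_on (exterior_disc r0) (deriv \<Psi>)"
      by (intro holomorphic_on_imp_continuous_on holomorphic_deriv hol_\<Psi> ope)
    have "integral {0..2 * pi} (\<lambda>\<phi>. norm (?z * (\<i> * cis \<phi>) * deriv \<Psi> (?z * cis \<phi>))) \<le> C"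
    proof (rule length_le_of_chord_sums[where \<gamma> = "\<lambda>\<phi>. \<Psi> (?z * cis \<phi>)"])
      show "((\<lambda>\<phi>. \<Psi> (?z * cis \<phi>)) has_vector_derivative ?z * (\<i> * cis s) * deriv \<Psi> (?z * cis s)) (at s within {0..2 * pi})" for s
        by (rule has_vector_derivative_at_within[OF circle_map_derivative]) (use r r0 in simp)
      show "continuous_on {0..2 * pi} (\<lambda>\<phi>. ?z * (\<i> * cis \<phi>) * deriv \<Psi> (?z * cis \<phi>))"
        by (intro continuous_intros continuous_on_compose2[OF cd]) (use inx in auto)
      show "(\<Sum>j<N. norm (\<Psi> (?z * cis (2 * pi * (real j + 1) / N)) - \<Psi> (?z * cis (2 * pi * real j / N)))) \<le> C"
        if "N \<ge> 2" for N using C[OF that, of ?z] r r0 by simp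
    qed simp
    then show "integral {0..2 * pi} (\<lambda>\<phi>. r * norm (deriv \<Psi> (of_real r * cis \<phi>))) \<le> C"
      using r r0 by (simp add: norm_mult)
  qed
qed

end

section \<open>Fourier coefficients on circles and Wirtinger derivatives\<close>

abbreviation circ :: "real \<Rightarrow> real \<Rightarrow> complex" where
  "circ r \<phi> \<equiv> of_real r * cis \<phi>"

abbreviation mode :: "int \<Rightarrow> real \<Rightarrow> complex" where
  "mode k \<phi> \<equiv> cis (- (of_int k * \<phi>))"

abbreviation has_partials :: "(complex \<Rightarrow> 'a::real_normed_vector) \<Rightarrow> 'a \<Rightarrow> 'a \<Rightarrow> complex \<Rightarrow> bool" where
  "has_partials F A B x \<equiv> (F has_derivative (\<lambda>e. Re e *\<^sub>R A + Im e *\<^sub>R B)) (at x)"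

abbreviation cont_field :: "complex set \<Rightarrow> (real \<Rightarrow> complex \<Rightarrow> 'a::topological_space) \<Rightarrow> bool" where
  "cont_field \<Omega> f \<equiv> continuous_on ({0<..} \<times> \<Omega>) (\<lambda>(t, x). f t x)"

lemma cis_has_vector_derivative [derivative_intros]:
  "((\<lambda>\<phi>. cis (a * \<phi>)) has_vector_derivative (\<i> * of_real a * cis (a * \<phi>))) (at \<phi> within S)"
proof -
  have "((\<lambda>w. exp (\<i> * (of_real a * w))) has_field_derivative (\<i> * of_real a * exp (\<i> * (of_real a * of_real \<phi>)))) (at (of_real \<phi>))"
    by (auto intro!: derivative_eq_intros)
  then show ?thesis
    unfolding cis_conv_exp of_real_mult by (rule has_vector_derivative_real_field)
qed

lemma circle_derivatives:
  fixes F :: "complex \<Rightarrow> complex"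
  assumes "(F has_derivative (\<lambda>e. Re e *\<^sub>R A + Im e *\<^sub>R B)) (at (z + circ \<rho> \<phi>))"
  shows "((\<lambda>\<rho>. F (z + circ \<rho> \<phi>)) has_vector_derivative of_real (cos \<phi>) * A + of_real (sin \<phi>) * B) (at \<rho>)"
    and "((\<lambda>\<phi>. F (z + circ \<rho> \<phi>)) has_vector_derivative of_real \<rho> * (of_real (cos \<phi>) * B - of_real (sin \<phi>) * A)) (at \<phi>)"
proof -
  have r: "((\<lambda>\<rho>. z + circ \<rho> \<phi>) has_vector_derivative cis \<phi>) (at \<rho>)"
    unfolding has_vector_derivative_def
    by (auto intro!: derivative_eq_intros simp: scaleR_conv_of_real)
  have p: "((\<lambda>\<phi>. z + circ \<rho> \<phi>) has_vector_derivative of_real \<rho> * (\<i> * cis \<phi>)) (at \<phi>)"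
    using has_vector_derivative_add[OF has_vector_derivative_const
        has_vector_derivative_mult_right[OF cis_has_vector_derivative[of 1 \<phi> UNIV], of "of_real \<rho>"], of z] by simp
  show "((\<lambda>\<rho>. F (z + circ \<rho> \<phi>)) has_vector_derivative of_real (cos \<phi>) * A + of_real (sin \<phi>) * B) (at \<rho>)"
    using vector_derivative_diff_chain_within[OF r has_derivative_at_withinI[OF assms]]
    by (simp add: o_def scaleR_conv_of_real)
  show "((\<lambda>\<phi>. F (z + circ \<rho> \<phi>)) has_vector_derivative of_real \<rho> * (of_real (cos \<phi>) * B - of_real (sin \<phi>) * A)) (at \<phi>)"
    using vector_derivative_diff_chain_within[OF p has_derivative_at_withinI[OF assms]]
    by (simp add: o_def scaleR_conv_of_real algebra_simps)
qed

lemma polar_Wirtinger: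
  fixes r a b e :: complex
  shows "r * ((of_real (cos \<phi>) * a + of_real (sin \<phi>) * b) * e) - \<i> * (r * (of_real (cos \<phi>) * b - of_real (sin \<phi>) * a) * e)
      = r * cis \<phi> * (a - \<i> * b) * e"
    and "r * ((of_real (cos \<phi>) * a + of_real (sin \<phi>) * b) * e) + \<i> * (r * (of_real (cos \<phi>) * b - of_real (sin \<phi>) * a) * e)
      = r * cis (- \<phi>) * (a + \<i> * b) * e"
proof -
  have cx: "cis \<phi> = of_real (cos \<phi>) + \<i> * of_real (sin \<phi>)" "cis (- \<phi>) = of_real (cos \<phi>) - \<i> * of_real (sin \<phi>)"
    by (simp_all add: complex_eq_iff)
  have ii: "\<i> * (\<i> * w) = - w" for w :: complex by (simp add: mult.assoc[symmetric])
  show "r * ((of_real (cos \<phi>) * a + of_real (sin \<phi>) * b) * e) - \<i> * (r * (of_real (cos \<phi>) * b - of_real (sin \<phi>) * a) * e)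
      = r * cis \<phi> * (a - \<i> * b) * e"
    and "r * ((of_real (cos \<phi>) * a + of_real (sin \<phi>) * b) * e) + \<i> * (r * (of_real (cos \<phi>) * b - of_real (sin \<phi>) * a) * e)
      = r * cis (- \<phi>) * (a + \<i> * b) * e"
    unfolding cx by (simp_all add: algebra_simps ii)
qed

text \<open>Here \<open>A\<close> and \<open>B\<close> are the partial derivatives of \<open>F\<close>, and \<open>(A - i B) / 2\<close>, \<open>(A + i B) / 2\<close> its
  two Wirtinger derivatives. In polar coordinates \<open>\<rho> \<partial>\<rho> - i \<partial>\<phi>\<close> and \<open>\<rho> \<partial>\<rho> + i \<partial>\<phi>\<close> are multiples of
  them, and integration by parts turns \<open>\<partial>\<phi>\<close> into multiplication of the \<open>k\<close>-th coefficient by \<open>i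
  k\<close>.\<close>

lemma circle_Fourier:
  fixes F A B :: "complex \<Rightarrow> complex" and k :: int
  assumes d: "\<And>x. x \<in> S \<Longrightarrow> has_partials F (A x) (B x) x"
    and cA: "continuous_on S A" and cB: "continuous_on S B"
    and I: "open I" "convex I" "\<And>\<rho> \<phi>. \<rho> \<in> I \<Longrightarrow> z + circ \<rho> \<phi> \<in> S" and \<rho>: "\<rho> \<in> I"
  defines "\<F> \<equiv> \<lambda>\<rho>. integral {0..2 * pi} (\<lambda>\<phi>. F (z + circ \<rho> \<phi>) * mode k \<phi>)"
    and "D \<equiv> integral {0..2 * pi} (\<lambda>\<phi>. (of_real (cos \<phi>) * A (z + circ \<rho> \<phi>) + of_real (sin \<phi>) * B (z + circ \<rho> \<phi>)) * mode k \<phi>)"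
  shows "(\<F> has_vector_derivative D) (at \<rho>)"
    and "of_real \<rho> * D + of_int k * \<F> \<rho> = integral {0..2 * pi} (\<lambda>\<phi>. circ \<rho> \<phi> * (A (z + circ \<rho> \<phi>) - \<i> * B (z + circ \<rho> \<phi>)) * mode k \<phi>)"
    and "of_real \<rho> * D - of_int k * \<F> \<rho> = integral {0..2 * pi} (\<lambda>\<phi>. circ \<rho> (- \<phi>) * (A (z + circ \<rho> \<phi>) + \<i> * B (z + circ \<rho> \<phi>)) * mode k \<phi>)"
proof -
  have cF: "continuous_on S F"
    using d by (meson continuous_at_imp_continuous_on has_derivative_continuous)
  have pos: "continuous_on X (\<lambda>p. z + of_real (fst p) * cis (snd p))" for X :: "(real \<times> real) set"
    by (intro continuous_intros)
  have comp: "continuous_on (I \<times> cbox 0 (2 * pi)) (\<lambda>p. G (z + of_real (fst p) * cis (snd p)))"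
    if "continuous_on S G" for G :: "complex \<Rightarrow> complex"
    using I(3) by (intro continuous_on_compose2[OF that pos]) auto
  have comp1: "continuous_on {0..2 * pi} (\<lambda>\<phi>. G (z + circ \<rho> \<phi>))" if "continuous_on S G" "\<rho> \<in> I" for G :: "complex \<Rightarrow> complex" and \<rho>
    using I(3)[OF that(2)] by (intro continuous_on_compose2[OF that(1)] continuous_intros) auto
  have der: "((\<lambda>\<rho>. F (z + circ \<rho> \<phi>) * mode k \<phi>) has_vector_derivative
       (of_real (cos \<phi>) * A (z + circ \<rho> \<phi>) + of_real (sin \<phi>) * B (z + circ \<rho> \<phi>)) * mode k \<phi>) (at \<rho> within I)"
    if "\<rho> \<in> I" for \<rho> \<phi>
    by (intro has_vector_derivative_mult_left has_vector_derivative_at_within[OF circle_derivatives(1)] d I(3) that)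
  have "(\<F> has_vector_derivative D) (at \<rho> within I)"
    unfolding \<F>_def D_def
    unfolding cbox_interval[symmetric]
  proof (rule leibniz_rule_vector_derivative[OF der])
    show "(\<lambda>\<phi>. F (z + circ \<rho> \<phi>) * mode k \<phi>) integrable_on cbox 0 (2 * pi)" if "\<rho> \<in> I" for \<rho>
      unfolding cbox_interval by (intro integrable_continuous_real continuous_intros comp1 cF that)
    show "continuous_on (I \<times> cbox 0 (2 * pi)) (\<lambda>(\<rho>, \<phi>). (of_real (cos \<phi>) * A (z + circ \<rho> \<phi>) + of_real (sin \<phi>) * B (z + circ \<rho> \<phi>)) * mode k \<phi>)"
      unfolding split_def by (intro continuous_intros comp cA cB)
  qed (use I \<rho> in auto)
  then show "(\<F> has_vector_derivative D) (at \<rho>)"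
    using at_within_open[OF \<rho> I(1)] by simp
  define E where "E = integral {0..2 * pi} (\<lambda>\<phi>. of_real \<rho> * (of_real (cos \<phi>) * B (z + circ \<rho> \<phi>) - of_real (sin \<phi>) * A (z + circ \<rho> \<phi>)) * mode k \<phi>)"
  have "((\<lambda>\<phi>. F (z + circ \<rho> \<phi>) * (- \<i> * of_int k * mode k \<phi>) +
      of_real \<rho> * (of_real (cos \<phi>) * B (z + circ \<rho> \<phi>) - of_real (sin \<phi>) * A (z + circ \<rho> \<phi>)) * mode k \<phi>) has_integral
      F (z + circ \<rho> (2 * pi)) * cis (- (of_int k * (2 * pi))) - F (z + circ \<rho> 0) * cis (- (of_int k * 0))) {0..2 * pi}"
  proof (rule fundamental_theorem_of_calculus)
    fix \<phi> :: real
    have "((\<lambda>\<phi>. mode k \<phi>) has_vector_derivative (- \<i> * of_int k * mode k \<phi>)) (at \<phi> within {0..2 * pi})"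
      using cis_has_vector_derivative[of "- of_int k" \<phi>] by simp
    then show "((\<lambda>\<phi>. F (z + circ \<rho> \<phi>) * mode k \<phi>) has_vector_derivative
      F (z + circ \<rho> \<phi>) * (- \<i> * of_int k * mode k \<phi>) +
      of_real \<rho> * (of_real (cos \<phi>) * B (z + circ \<rho> \<phi>) - of_real (sin \<phi>) * A (z + circ \<rho> \<phi>)) * mode k \<phi>) (at \<phi> within {0..2 * pi})"
      by (intro has_vector_derivative_mult has_vector_derivative_at_within[OF circle_derivatives(2)] d I(3) \<rho>)
  qed simp
  moreover have "cis (- (of_int k * (2 * pi))) = 1"
  proof -
    have "cis (- (of_int k * (2 * pi))) = cis (2 * pi * of_int (- k))" by (simp add: mult.commute)
    then show ?thesis by (simp only: cis_multiple_2pi Ints_of_int)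
  qed
  ultimately have "integral {0..2 * pi} (\<lambda>\<phi>. F (z + circ \<rho> \<phi>) * (- \<i> * of_int k * mode k \<phi>) +
      of_real \<rho> * (of_real (cos \<phi>) * B (z + circ \<rho> \<phi>) - of_real (sin \<phi>) * A (z + circ \<rho> \<phi>)) * mode k \<phi>) = 0"
    by (simp add: integral_unique)
  then have "integral {0..2 * pi} (\<lambda>\<phi>. F (z + circ \<rho> \<phi>) * (- \<i> * of_int k * mode k \<phi>)) + E = 0"
    unfolding E_def
    by (subst (asm) integral_add) (auto intro!: integrable_continuous_real continuous_intros comp1 cF cA cB \<rho>)
  moreover have "integral {0..2 * pi} (\<lambda>\<phi>. F (z + circ \<rho> \<phi>) * (- \<i> * of_int k * mode k \<phi>)) = - \<i> * of_int k * \<F> \<rho>"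
    unfolding \<F>_def by (subst integral_mult_right[symmetric]) (simp add: mult_ac)
  ultimately have E: "E = \<i> * of_int k * \<F> \<rho>" by (simp add: algebra_simps add_eq_0_iff)
  have ii: "\<i> * (\<i> * w) = - w" for w :: complex by (simp add: mult.assoc[symmetric])
  have rD: "of_real \<rho> * D = integral {0..2 * pi} (\<lambda>\<phi>. of_real \<rho> * ((of_real (cos \<phi>) * A (z + circ \<rho> \<phi>) + of_real (sin \<phi>) * B (z + circ \<rho> \<phi>)) * mode k \<phi>))"
    unfolding D_def by (simp add: integral_mult_right)
  have iE: "\<i> * E = integral {0..2 * pi} (\<lambda>\<phi>. \<i> * (of_real \<rho> * (of_real (cos \<phi>) * B (z + circ \<rho> \<phi>) - of_real (sin \<phi>) * A (z + circ \<rho> \<phi>)) * mode k \<phi>))"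
    unfolding E_def by (simp add: integral_mult_right)
  have "of_real \<rho> * D + of_int k * \<F> \<rho> = of_real \<rho> * D - \<i> * E" unfolding E by (simp add: ii mult.assoc)
  also have "\<dots> = integral {0..2 * pi} (\<lambda>\<phi>. of_real \<rho> * ((of_real (cos \<phi>) * A (z + circ \<rho> \<phi>) + of_real (sin \<phi>) * B (z + circ \<rho> \<phi>)) * mode k \<phi>)
     - \<i> * (of_real \<rho> * (of_real (cos \<phi>) * B (z + circ \<rho> \<phi>) - of_real (sin \<phi>) * A (z + circ \<rho> \<phi>)) * mode k \<phi>))"
    unfolding rD iE by (rule integral_diff[symmetric]) (auto intro!: integrable_continuous_real continuous_intros comp1 cF cA cB \<rho>)
  also have "\<dots> = integral {0..2 * pi} (\<lambda>\<phi>. circ \<rho> \<phi> * (A (z + circ \<rho> \<phi>) - \<i> * B (z + circ \<rho> \<phi>)) * mode k \<phi>)"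
  proof (rule integral_cong)
    fix \<phi> :: real
    show "of_real \<rho> * ((of_real (cos \<phi>) * A (z + circ \<rho> \<phi>) + of_real (sin \<phi>) * B (z + circ \<rho> \<phi>)) * mode k \<phi>)
     - \<i> * (of_real \<rho> * (of_real (cos \<phi>) * B (z + circ \<rho> \<phi>) - of_real (sin \<phi>) * A (z + circ \<rho> \<phi>)) * mode k \<phi>)
      = circ \<rho> \<phi> * (A (z + circ \<rho> \<phi>) - \<i> * B (z + circ \<rho> \<phi>)) * mode k \<phi>"
      by (rule polar_Wirtinger(1))
  qed
  finally show "of_real \<rho> * D + of_int k * \<F> \<rho> = integral {0..2 * pi} (\<lambda>\<phi>. circ \<rho> \<phi> * (A (z + circ \<rho> \<phi>) - \<i> * B (z + circ \<rho> \<phi>)) * mode k \<phi>)" .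
  have "of_real \<rho> * D - of_int k * \<F> \<rho> = of_real \<rho> * D + \<i> * E" unfolding E by (simp add: ii mult.assoc)
  also have "\<dots> = integral {0..2 * pi} (\<lambda>\<phi>. of_real \<rho> * ((of_real (cos \<phi>) * A (z + circ \<rho> \<phi>) + of_real (sin \<phi>) * B (z + circ \<rho> \<phi>)) * mode k \<phi>)
     + \<i> * (of_real \<rho> * (of_real (cos \<phi>) * B (z + circ \<rho> \<phi>) - of_real (sin \<phi>) * A (z + circ \<rho> \<phi>)) * mode k \<phi>))"
    unfolding rD iE by (rule integral_add[symmetric]) (auto intro!: integrable_continuous_real continuous_intros comp1 cF cA cB \<rho>)
  also have "\<dots> = integral {0..2 * pi} (\<lambda>\<phi>. circ \<rho> (- \<phi>) * (A (z + circ \<rho> \<phi>) + \<i> * B (z + circ \<rho> \<phi>)) * mode k \<phi>)"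
  proof (rule integral_cong)
    fix \<phi> :: real
    show "of_real \<rho> * ((of_real (cos \<phi>) * A (z + circ \<rho> \<phi>) + of_real (sin \<phi>) * B (z + circ \<rho> \<phi>)) * mode k \<phi>)
     + \<i> * (of_real \<rho> * (of_real (cos \<phi>) * B (z + circ \<rho> \<phi>) - of_real (sin \<phi>) * A (z + circ \<rho> \<phi>)) * mode k \<phi>)
      = circ \<rho> (- \<phi>) * (A (z + circ \<rho> \<phi>) + \<i> * B (z + circ \<rho> \<phi>)) * mode k \<phi>"
      by (rule polar_Wirtinger(2))
  qed
  finally show "of_real \<rho> * D - of_int k * \<F> \<rho> = integral {0..2 * pi} (\<lambda>\<phi>. circ \<rho> (- \<phi>) * (A (z + circ \<rho> \<phi>) + \<i> * B (z + circ \<rho> \<phi>)) * mode k \<phi>)" .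
qed

section \<open>Stream functions and integrals over segments\<close>

text \<open>The potential is the integral of the form \<open>Im (f dz)\<close> along segments from a base point. The
  hypothesis on \<open>A\<close> and \<open>B\<close> says that this form is closed; for \<open>f = cnj v\<close> it says that \<open>v\<close> is
  divergence-free, and \<open>\<psi>\<close> is then the stream function.\<close>

lemma Poincare_stream_function:
  fixes f A B :: "complex \<Rightarrow> complex"
  assumes S: "open S" "convex S" "c \<in> S"
    and d: "\<And>x. x \<in> S \<Longrightarrow> has_partials f (A x) (B x) x"
    and cA: "continuous_on S A" and cB: "continuous_on S B"
    and closed: "\<And>x. x \<in> S \<Longrightarrow> Re (A x) = Im (B x)"
  obtains \<psi> :: "complex \<Rightarrow> real" where "\<And>x. x \<in> S \<Longrightarrow> (\<psi> has_derivative (\<lambda>e. Im (f x * e))) (at x)"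
proof -
  define pt where "pt x s = c + of_real s * (x - c)" for x :: complex and s :: real
  have pt: "pt x s \<in> S" if "x \<in> S" "s \<in> {0..1}" for x s
  proof -
    have "pt x s = (1 - s) *\<^sub>R c + s *\<^sub>R x" by (simp add: pt_def scaleR_conv_of_real algebra_simps)
    then show ?thesis using S that by (simp add: convexD)
  qed
  have cf: "continuous_on S f"
    using d by (meson continuous_at_imp_continuous_on has_derivative_continuous)
  define \<psi> where "\<psi> x = integral (cbox 0 1) (\<lambda>s. Im (f (pt x s) * (x - c)))" for x
  define G where "G x s = Complex (s * Im (A (pt x s) * (x - c)) + Im (f (pt x s))) (s * Im (B (pt x s) * (x - c)) + Re (f (pt x s)))" for x s
  have Gapp: "G x s \<bullet> e = s * Im ((Re e *\<^sub>R A (pt x s) + Im e *\<^sub>R B (pt x s)) * (x - c)) + Im (f (pt x s) * e)" for x s e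
    unfolding G_def inner_complex_def by (simp add: algebra_simps)
  have cpt: "continuous_on (S \<times> cbox 0 1) (\<lambda>p. g (pt (fst p) (snd p)))" if "continuous_on S g" for g :: "complex \<Rightarrow> complex"
    by (rule continuous_on_compose2[OF that]) (auto simp: pt intro!: continuous_intros simp: pt_def[abs_def] pt[unfolded pt_def])
  have cpt1: "continuous_on (cbox 0 1) (\<lambda>s. g (pt x s))" if "continuous_on S g" "x \<in> S" for g :: "complex \<Rightarrow> complex" and x
    by (rule continuous_on_compose2[OF that(1)]) (use that(2) in \<open>auto intro!: continuous_intros simp: pt_def[abs_def] pt[unfolded pt_def]\<close>)
  have "(\<psi> has_derivative integral (cbox 0 1) (\<lambda>s. blinfun_inner_left (G x s))) (at x)" if x: "x \<in> S" for x
  proof -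
    have "(\<psi> has_derivative integral (cbox 0 1) (\<lambda>s. blinfun_inner_left (G x s))) (at x within S)"
      unfolding \<psi>_def
    proof (rule leibniz_rule)
      fix y s assume y: "y \<in> S" and s: "s \<in> cbox (0::real) 1"
      then have py: "pt y s \<in> S" using pt by (auto simp: cbox_interval)
      have "((\<lambda>y. f (pt y s)) has_derivative (\<lambda>e. Re (of_real s * e) *\<^sub>R A (pt y s) + Im (of_real s * e) *\<^sub>R B (pt y s))) (at y within S)"
        by (rule has_derivative_compose[where f = "\<lambda>y. pt y s" and g = f, OF _ d[OF py]]) (auto intro!: derivative_eq_intros simp: pt_def[abs_def])
      then have "((\<lambda>y. Im (f (pt y s) * (y - c))) has_derivative
          (\<lambda>e. Im (f (pt y s) * e + (Re (of_real s * e) *\<^sub>R A (pt y s) + Im (of_real s * e) *\<^sub>R B (pt y s)) * (y - c)))) (at y within S)"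
        by (auto intro!: derivative_eq_intros)
      moreover have "(\<lambda>e. Im (f (pt y s) * e + (Re (of_real s * e) *\<^sub>R A (pt y s) + Im (of_real s * e) *\<^sub>R B (pt y s)) * (y - c)))
          = blinfun_apply (blinfun_inner_left (G y s))"
        by (rule ext) (simp add: inner_commute[of _ "G y s"] Gapp algebra_simps)
      ultimately show "((\<lambda>y. Im (f (pt y s) * (y - c))) has_derivative blinfun_apply (blinfun_inner_left (G y s))) (at y within S)"
        by simp
    next
      fix y assume y: "y \<in> S"
      show "(\<lambda>s. Im (f (pt y s) * (y - c))) integrable_on cbox 0 1"
        by (intro integrable_continuous continuous_intros cpt1 cf y)
    next
      have "continuous_on (S \<times> cbox 0 1) (\<lambda>p. G (fst p) (snd p))"
        unfolding G_def by (intro continuous_intros cpt cf cA cB)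
      then show "continuous_on (S \<times> cbox 0 1) (\<lambda>(x, s). blinfun_inner_left (G x s))"
        unfolding split_def by (intro bounded_linear.continuous_on[OF bounded_linear_blinfun_inner_left])
    qed (use x S in auto)
    then show ?thesis using at_within_open[OF x S(1)] by simp
  qed
  moreover have "blinfun_apply (integral (cbox 0 1) (\<lambda>s. blinfun_inner_left (G x s))) = (\<lambda>e. Im (f x * e))" if x: "x \<in> S" for x
  proof
    fix e
    have cG: "continuous_on (cbox 0 1) (\<lambda>s. G x s)"
      unfolding G_def by (intro continuous_intros cpt1 cf cA cB x)
    have "blinfun_apply (integral (cbox 0 1) (\<lambda>s. blinfun_inner_left (G x s))) e = integral (cbox 0 1) (\<lambda>s. G x s \<bullet> e)"
    proof -
      have int: "(\<lambda>s. blinfun_inner_left (G x s)) integrable_on cbox 0 1"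
        by (intro integrable_continuous bounded_linear.continuous_on[OF bounded_linear_blinfun_inner_left] cG)
      show ?thesis
        using integral_linear[OF int blinfun.bounded_linear_left[of e], symmetric]
        by (simp add: o_def inner_commute)
    qed
    also have "\<dots> = Im (f x * e)"
    proof -
      have "((\<lambda>s. G x s \<bullet> e) has_integral 1 * Im (f (pt x 1) * e) - 0 * Im (f (pt x 0) * e)) {0..1}"
      proof (rule fundamental_theorem_of_calculus)
        fix s :: real assume s: "s \<in> {0..1}"
        have "((\<lambda>s. pt x s) has_vector_derivative (x - c)) (at s within {0..1})"
          unfolding has_vector_derivative_def pt_def by (auto intro!: derivative_eq_intros simp: scaleR_conv_of_real)
        from vector_derivative_diff_chain_within[OF this has_derivative_at_withinI[OF d[OF pt[OF x s]]]]
        have "((\<lambda>s. f (pt x s)) has_vector_derivative (Re (x - c) *\<^sub>R A (pt x s) + Im (x - c) *\<^sub>R B (pt x s))) (at s within {0..1})"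
          by (simp add: o_def)
        then have "((\<lambda>s. s * Im (f (pt x s) * e)) has_vector_derivative (s * Im ((Re (x - c) *\<^sub>R A (pt x s) + Im (x - c) *\<^sub>R B (pt x s)) * e) + 1 * Im (f (pt x s) * e))) (at s within {0..1})"
          by (intro has_vector_derivative_mult has_vector_derivative_id bounded_linear.has_vector_derivative[OF bounded_linear_Im] has_vector_derivative_mult_left)
        moreover have "G x s \<bullet> e = s * Im ((Re (x - c) *\<^sub>R A (pt x s) + Im (x - c) *\<^sub>R B (pt x s)) * e) + 1 * Im (f (pt x s) * e)"
          unfolding Gapp using closed[OF pt[OF x s]] by (simp add: algebra_simps)
        ultimately show "((\<lambda>s. s * Im (f (pt x s) * e)) has_vector_derivative G x s \<bullet> e) (at s within {0..1})"
          by simp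
      qed simp
      then show ?thesis by (simp add: pt_def cbox_interval integral_unique)
    qed
    finally show "blinfun_apply (integral (cbox 0 1) (\<lambda>s. blinfun_inner_left (G x s))) e = Im (f x * e)" .
  qed
  ultimately show ?thesis using that by metis
qed

text \<open>The contour integral over a segment, written over a fixed interval so that it can be
  differentiated in a parameter of \<open>f\<close>.\<close>

definition line_int :: "(complex \<Rightarrow> complex) \<Rightarrow> complex \<Rightarrow> complex \<Rightarrow> complex" where
  "line_int f a b = integral {0..1} (\<lambda>s. f (linepath a b s) * (b - a))"

lemma contour_integral_line_int: "contour_integral (linepath a b) f = line_int f a b"
  unfolding contour_integral_integral line_int_def
  by (rule integral_cong) (simp add: vector_derivative_linepath_at)

lemma linepath_in_convex: "convex S \<Longrightarrow> a \<in> S \<Longrightarrow> b \<in> S \<Longrightarrow> s \<in> {0..1} \<Longrightarrow> linepath a b s \<in> S"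
  by (metis closed_segment_subset image_subset_iff linepath_image_01)

lemma line_int_potential:
  fixes \<psi> :: "complex \<Rightarrow> real" and L :: "complex \<Rightarrow> real"
  assumes L: "bounded_linear L" and S: "convex S" "a \<in> S" "b \<in> S"
    and d: "\<And>x. x \<in> S \<Longrightarrow> (\<psi> has_derivative (\<lambda>e. L (f x * e))) (at x)"
    and cf: "continuous_on S f"
  shows "L (line_int f a b) = \<psi> b - \<psi> a"
proof -
  have ins: "linepath a b s \<in> S" if "s \<in> {0..1}" for s using linepath_in_convex S that by blast
  have "((\<lambda>s. L (f (linepath a b s) * (b - a))) has_integral \<psi> (linepath a b 1) - \<psi> (linepath a b 0)) {0..1}"
  proof (rule fundamental_theorem_of_calculus)
    fix s :: real assume s: "s \<in> {0..1}"
    show "((\<lambda>s. \<psi> (linepath a b s)) has_vector_derivative L (f (linepath a b s) * (b - a))) (at s within {0..1})"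
      using vector_derivative_diff_chain_within[OF has_vector_derivative_linepath_within has_derivative_at_withinI[OF d[OF ins[OF s]]]]
      by (simp add: o_def)
  qed simp
  then have "integral {0..1} (\<lambda>s. L (f (linepath a b s) * (b - a))) = \<psi> b - \<psi> a"
    by (simp add: integral_unique linepath_def)
  moreover have int: "(\<lambda>s. f (linepath a b s) * (b - a)) integrable_on {0..1}"
    using ins by (intro integrable_continuous_real continuous_intros continuous_on_compose2[OF cf]) auto
  have "integral {0..1} (\<lambda>s. L (f (linepath a b s) * (b - a))) = L (line_int f a b)"
    using integral_linear[OF int L] unfolding line_int_def o_def .
  ultimately show ?thesis by simp
qed

lemma line_int_lin:
  assumes "continuous_on S f" "continuous_on S g" "convex S" "a \<in> S" "b \<in> S"
  shows "line_int (\<lambda>x. f x + c * g x) a b = line_int f a b + c * line_int g a b"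
proof -
  have ins: "linepath a b s \<in> S" if "s \<in> {0..1}" for s using linepath_in_convex assms that by blast
  have *: "(\<lambda>s. f (linepath a b s) * (b - a)) integrable_on {0..1}" if "continuous_on S f" for f
    using ins by (intro integrable_continuous_real continuous_intros continuous_on_compose2[OF that]) auto
  have "line_int (\<lambda>x. f x + c * g x) a b = integral {0..1} (\<lambda>s. f (linepath a b s) * (b - a) + c * (g (linepath a b s) * (b - a)))"
    unfolding line_int_def by (simp add: algebra_simps)
  also have "\<dots> = line_int f a b + c * line_int g a b"
    unfolding line_int_def
    by (subst integral_add) (auto intro!: * assms integrable_on_mult_right)
  finally show ?thesis .
qed

section \<open>Holomorphy of the pressure gradient\<close>

text \<open>The Stokes equation in complex form at positive times. \<open>v1\<close> and \<open>v2\<close> are the partial derivatives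
  of the velocity and \<open>vt\<close> is its time derivative. Derivatives of the real functions \<open>\<omega>\<close> and \<open>p\<close>
  are written \<open>e \<mapsto> Re (\<kappa> e)\<close> and \<open>e \<mapsto> Re (h e)\<close>, so that \<open>\<kappa>\<close> and \<open>h\<close> are the conjugates of the
  gradients. In this notation the Laplacian of \<open>v\<close> is \<open>i cnj \<kappa>\<close>.\<close>

locale stokes_field =
  fixes \<Omega> :: "complex set" and v v1 v2 vt \<kappa> h :: "real \<Rightarrow> complex \<Rightarrow> complex" and \<omega> p :: "real \<Rightarrow> complex \<Rightarrow> real"
    and v_inf :: complex
  assumes field_open: "open \<Omega>"
    and v_deriv: "\<And>t x. 0 < t \<Longrightarrow> x \<in> \<Omega> \<Longrightarrow> has_partials (v t) (v1 t x) (v2 t x) x"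
    and cont_v: "cont_field \<Omega> v"
    and cont_v1: "cont_field \<Omega> v1"
    and cont_v2: "cont_field \<Omega> v2"
    and div_free: "\<And>t x. 0 < t \<Longrightarrow> x \<in> \<Omega> \<Longrightarrow> Re (v1 t x) + Im (v2 t x) = 0"
    and \<omega>_eq: "\<And>t x. 0 < t \<Longrightarrow> x \<in> \<Omega> \<Longrightarrow> \<omega> t x = Im (v1 t x) - Re (v2 t x)"
    and \<omega>_deriv: "\<And>t x. 0 < t \<Longrightarrow> x \<in> \<Omega> \<Longrightarrow> (\<omega> t has_derivative (\<lambda>e. Re (\<kappa> t x * e))) (at x)"
    and cont_\<kappa>: "continuous_on ({0<..} \<times> \<Omega>) (\<lambda>(t, x). \<kappa> t x)"
    and p_deriv: "\<And>t x. 0 < t \<Longrightarrow> x \<in> \<Omega> \<Longrightarrow> (p t has_derivative (\<lambda>e. Re (h t x * e))) (at x)"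
    and h_eq: "\<And>t x. 0 < t \<Longrightarrow> x \<in> \<Omega> \<Longrightarrow> h t x = cnj (vt t x) + \<i> * \<kappa> t x"
    and v_time: "\<And>t x. 0 < t \<Longrightarrow> x \<in> \<Omega> \<Longrightarrow> ((\<lambda>s. v s x) has_vector_derivative vt t x) (at t)"
    and cont_vt: "cont_field \<Omega> vt"
    and v_infinity: "\<And>t. 0 < t \<Longrightarrow> (v t \<longlongrightarrow> v_inf) at_infinity"
begin

lemma cont_h: "cont_field \<Omega> h"
proof -
  have "continuous_on ({0<..} \<times> \<Omega>) (\<lambda>(t, x). cnj (vt t x) + \<i> * \<kappa> t x)"
    using cont_vt cont_\<kappa> unfolding split_def by (intro continuous_intros)
  then show ?thesis by (rule continuous_on_eq) (auto simp: h_eq)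
qed

lemma cont_slice:
  fixes f :: "real \<Rightarrow> complex \<Rightarrow> complex"
  assumes "cont_field \<Omega> f" "0 < t"
  shows "continuous_on \<Omega> (f t)"
proof -
  have "continuous_on \<Omega> (\<lambda>x. case (t, x) of (t, x) \<Rightarrow> f t x)"
    by (rule continuous_on_compose2[OF assms(1)]) (use assms(2) in \<open>auto intro!: continuous_intros\<close>)
  then show ?thesis by simp
qed

text \<open>The imaginary part of the integral of \<open>cnj (v t)\<close> over a triangle is a flux, which vanishes at
  all positive times since \<open>v t\<close> has a stream function. Differentiation in \<open>t\<close> gives the claim
  without any spatial derivative of \<open>vt\<close>.\<close>

lemma triangle_flux_zero:
  assumes S: "open S" "convex S" "S \<subseteq> \<Omega>" "a \<in> S" "b \<in> S" "c \<in> S" and "0 < t"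
  shows "Im (line_int (\<lambda>x. cnj (vt t x)) a b + line_int (\<lambda>x. cnj (vt t x)) b c + line_int (\<lambda>x. cnj (vt t x)) c a) = 0"
proof -
  let ?I = "\<lambda>s. line_int (\<lambda>x. cnj (v s x)) a b + line_int (\<lambda>x. cnj (v s x)) b c + line_int (\<lambda>x. cnj (v s x)) c a"
  let ?J = "line_int (\<lambda>x. cnj (vt t x)) a b + line_int (\<lambda>x. cnj (vt t x)) b c + line_int (\<lambda>x. cnj (vt t x)) c a"
  have zero: "Im (?I s) = 0" if "0 < s" for s
  proof -
    have d: "((\<lambda>x. cnj (v s x)) has_derivative (\<lambda>e. Re e *\<^sub>R cnj (v1 s x) + Im e *\<^sub>R cnj (v2 s x))) (at x)" if "x \<in> S" for x
      using bounded_linear.has_derivative[OF bounded_linear_cnj v_deriv[OF \<open>0 < s\<close>, of x]] that S by auto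
    have cc: "continuous_on S (\<lambda>x. cnj (f s x))" if "cont_field \<Omega> f" for f
      by (intro continuous_intros continuous_on_subset[OF cont_slice[OF that \<open>0 < s\<close>] S(3)])
    have cl: "Re (cnj (v1 s x)) = Im (cnj (v2 s x))" if "x \<in> S" for x
      using div_free[OF \<open>0 < s\<close>, of x] S that by auto
    obtain \<psi> where \<psi>: "\<And>x. x \<in> S \<Longrightarrow> (\<psi> has_derivative (\<lambda>e. Im (cnj (v s x) * e))) (at x)"
      using Poincare_stream_function[OF S(1,2,4) d cc[OF cont_v1] cc[OF cont_v2] cl] by blast
    show ?thesis
      using line_int_potential[OF bounded_linear_Im S(2) _ _ \<psi> cc[OF cont_v]] S(4-6) by simp
  qed
  have der: "((\<lambda>s. line_int (\<lambda>x. cnj (v s x)) a b) has_vector_derivative line_int (\<lambda>x. cnj (vt t x)) a b) (at t)"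
    if "a \<in> S" "b \<in> S" for a b
  proof -
    have ins: "linepath a b s \<in> \<Omega>" if "s \<in> {0..1}" for s
      using linepath_in_convex[OF S(2) \<open>a \<in> S\<close> \<open>b \<in> S\<close> that] S(3) by blast
    have cc: "continuous_on ({0<..} \<times> cbox 0 1) (\<lambda>q. f (fst q) (linepath a b (snd q)))"
      if "cont_field \<Omega> f" for f :: "real \<Rightarrow> complex \<Rightarrow> complex"
    proof -
      have "continuous_on ({0<..} \<times> cbox 0 1) (\<lambda>q. case (fst q, linepath a b (snd q)) of (t, x) \<Rightarrow> f t x)"
        by (rule continuous_on_compose2[OF that]) (use ins in \<open>auto intro!: continuous_intros simp: linepath_def[abs_def]\<close>)
      then show ?thesis by simp
    qed
    have cc1: "continuous_on (cbox 0 1) (\<lambda>r. f s (linepath a b r))"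
      if "cont_field \<Omega> f" "0 < s" for f :: "real \<Rightarrow> complex \<Rightarrow> complex" and s
      by (rule continuous_on_compose2[OF cont_slice[OF that]]) (use ins in \<open>auto intro!: continuous_intros\<close>)
    have "((\<lambda>s. integral (cbox 0 1) (\<lambda>r. cnj (v s (linepath a b r)) * (b - a))) has_vector_derivative
        integral (cbox 0 1) (\<lambda>r. cnj (vt t (linepath a b r)) * (b - a))) (at t within {0<..})"
    proof (rule leibniz_rule_vector_derivative)
      show "((\<lambda>s. cnj (v s (linepath a b r)) * (b - a)) has_vector_derivative cnj (vt s (linepath a b r)) * (b - a)) (at s within {0<..})"
        if "s \<in> {0<..}" "r \<in> cbox 0 1" for s r
        using that ins
        by (intro has_vector_derivative_mult_left bounded_linear.has_vector_derivative[OF bounded_linear_cnj] has_vector_derivative_at_within[OF v_time]) auto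
      show "(\<lambda>r. cnj (v s (linepath a b r)) * (b - a)) integrable_on cbox 0 1" if "s \<in> {0<..}" for s
        using that by (intro integrable_continuous continuous_intros cc1[OF cont_v]) auto
      show "continuous_on ({0<..} \<times> cbox 0 1) (\<lambda>(s, r). cnj (vt s (linepath a b r)) * (b - a))"
        unfolding split_def by (intro continuous_intros cc cont_vt)
    qed (use \<open>0 < t\<close> in auto)
    then show ?thesis
      using at_within_open[of t "{0<..}"] \<open>0 < t\<close> by (simp add: line_int_def cbox_interval)
  qed
  have "((\<lambda>s. Im (?I s)) has_vector_derivative Im ?J) (at t)"
    by (intro bounded_linear.has_vector_derivative[OF bounded_linear_Im] has_vector_derivative_add der S)
  moreover have "((\<lambda>s. Im (?I s)) has_vector_derivative 0) (at t)"
    by (rule has_vector_derivative_transform_within_open[of "\<lambda>_. 0" _ _ "{0<..}"])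
      (use \<open>0 < t\<close> zero in auto)
  ultimately show ?thesis by (rule vector_derivative_unique_at)
qed

text \<open>By Morera's theorem. The real part of the integral of \<open>h\<close> over a triangle vanishes because \<open>p\<close>
  is a potential; the imaginary part splits into the flux of \<open>vt\<close> and the integral of \<open>Re (\<kappa> dz)\<close>,
  for which \<open>\<omega>\<close> is a potential.\<close>

lemma h_holomorphic:
  assumes "0 < t"
  shows "h t holomorphic_on \<Omega>"
proof -
  have "h t analytic_on \<Omega>"
  proof (rule Morera_local_triangle)
    fix z assume "z \<in> \<Omega>"
    then obtain e where e: "e > 0" "ball z e \<subseteq> \<Omega>" using field_open open_contains_ball by blast
    let ?S = "ball z e"
    have ch: "continuous_on ?S (h t)" and ck: "continuous_on ?S (\<kappa> t)" and cv: "continuous_on ?S (\<lambda>x. cnj (vt t x))"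
      using cont_slice[OF cont_h assms] cont_slice[OF cont_\<kappa> assms] cont_slice[OF cont_vt assms] e(2)
      by (auto intro!: continuous_intros intro: continuous_on_subset)
    have "contour_integral (linepath a b) (h t) + contour_integral (linepath b c) (h t) + contour_integral (linepath c a) (h t) = 0"
      if "convex hull {a, b, c} \<subseteq> ?S" for a b c
    proof -
      have abc: "a \<in> ?S" "b \<in> ?S" "c \<in> ?S" using that hull_subset[of "{a, b, c}" convex] by auto
      let ?T = "\<lambda>f. line_int f a b + line_int f b c + line_int f c a"
      have re: "Re (line_int (h t) a b) = p t b - p t a" if "a \<in> ?S" "b \<in> ?S" for a b
        by (rule line_int_potential[OF bounded_linear_Re _ that _ ch]) (use p_deriv assms e in auto)
      have rk: "Re (line_int (\<kappa> t) a b) = \<omega> t b - \<omega> t a" if "a \<in> ?S" "b \<in> ?S" for a b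
        by (rule line_int_potential[OF bounded_linear_Re _ that _ ck]) (use \<omega>_deriv assms e in auto)
      have h: "line_int (h t) a b = line_int (\<lambda>x. cnj (vt t x)) a b + \<i> * line_int (\<kappa> t) a b" if "a \<in> ?S" "b \<in> ?S" for a b
      proof -
        have "line_int (h t) a b = line_int (\<lambda>x. cnj (vt t x) + \<i> * \<kappa> t x) a b"
          unfolding line_int_def
        proof (rule integral_cong)
          fix s :: real assume "s \<in> {0..1}"
          then have "linepath a b s \<in> \<Omega>" using linepath_in_convex[of ?S a b s] that e by auto
          then show "h t (linepath a b s) * (b - a) = (cnj (vt t (linepath a b s)) + \<i> * \<kappa> t (linepath a b s)) * (b - a)"
            using h_eq assms by simp
        qed
        then show ?thesis using line_int_lin[OF cv ck _ that] by simp
      qed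
      have "Re (?T (h t)) = 0" using re abc by simp
      moreover have "Im (?T (h t)) = 0"
        using h abc rk triangle_flux_zero[OF _ _ e(2) abc assms] by simp
      ultimately have "?T (h t) = 0" by (simp add: complex_eq_iff)
      then show ?thesis by (simp add: contour_integral_line_int)
    qed
    then show "\<exists>T. open T \<and> z \<in> T \<and> continuous_on T (h t) \<and> (\<forall>a b c. convex hull {a, b, c} \<subseteq> T \<longrightarrow>
        contour_integral (linepath a b) (h t) + contour_integral (linepath b c) (h t) + contour_integral (linepath c a) (h t) = 0)"
      using e ch by (intro exI[of _ ?S]) auto
  qed
  then show ?thesis by (rule analytic_imp_holomorphic)
qed

lemma cont_on_param:
  fixes f :: "real \<Rightarrow> complex \<Rightarrow> complex"
  assumes "cont_field \<Omega> f" "continuous_on X T" "continuous_on X P"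
    and "\<And>q. q \<in> X \<Longrightarrow> 0 < T q" "\<And>q. q \<in> X \<Longrightarrow> P q \<in> \<Omega>"
  shows "continuous_on X (\<lambda>q. f (T q) (P q))"
proof -
  have "continuous_on X (\<lambda>q. case (T q, P q) of (t, x) \<Rightarrow> f t x)"
    by (rule continuous_on_compose2[OF assms(1)]) (use assms in \<open>auto intro!: continuous_intros\<close>)
  then show ?thesis by simp
qed

lemma complex_v_deriv_curl:
  assumes "0 < t" "x \<in> \<Omega>"
  shows "v1 t x - \<i> * v2 t x = \<i> * of_real (\<omega> t x)"
  using div_free[OF assms] \<omega>_eq[OF assms] by (simp add: complex_eq_iff)

lemma complex_\<omega>_deriv:
  assumes "0 < t" "x \<in> \<Omega>"
  shows "((\<lambda>x. of_real (\<omega> t x) :: complex) has_derivative (\<lambda>e. Re e *\<^sub>R of_real (Re (\<kappa> t x)) + Im e *\<^sub>R of_real (- Im (\<kappa> t x)))) (at x)"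
proof -
  have "((\<lambda>x. of_real (\<omega> t x) :: complex) has_derivative (\<lambda>e. of_real (Re (\<kappa> t x * e)))) (at x)"
    by (rule bounded_linear.has_derivative[OF bounded_linear_of_real \<omega>_deriv[OF assms]])
  moreover have "(\<lambda>e. of_real (Re (\<kappa> t x * e)) :: complex) = (\<lambda>e. Re e *\<^sub>R of_real (Re (\<kappa> t x)) + Im e *\<^sub>R of_real (- Im (\<kappa> t x)))"
    by (rule ext) (simp add: complex_eq_iff algebra_simps)
  ultimately show ?thesis by simp
qed

section \<open>Decay of the time-integrated pressure gradient\<close>

lemma holomorphic_circle_mean:
  fixes f :: "complex \<Rightarrow> complex"
  assumes "f holomorphic_on ball z R" "0 \<le> \<rho>" "\<rho> < R"
  shows "integral {0..2 * pi} (\<lambda>\<phi>. f (z + circ \<rho> \<phi>)) = 2 * pi * f z"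
proof (cases "\<rho> = 0")
  case True then show ?thesis by (simp add: scaleR_conv_of_real)
next
  case False
  have ball: "\<And>S. S \<subseteq> ball z R \<Longrightarrow> f holomorphic_on S" using assms(1) holomorphic_on_subset by blast
  have "((\<lambda>u. f u / (u - z)) has_contour_integral 2 * of_real pi * \<i> * f z) (circlepath z \<rho>)"
    using assms False
    by (intro Cauchy_integral_circlepath holomorphic_on_imp_continuous_on ball) auto
  then have i1: "((\<lambda>x. f (circlepath z \<rho> x) / (circlepath z \<rho> x - z) * vector_derivative (circlepath z \<rho>) (at x within {0..1}))
      has_integral 2 * of_real pi * \<i> * f z) {0..1}"
    unfolding has_contour_integral_def .
  define c where "c = 2 * of_real pi * \<i>"
  have "c \<noteq> 0" by (simp add: c_def)
  have e: "f (circlepath z \<rho> x) / (circlepath z \<rho> x - z) * vector_derivative (circlepath z \<rho>) (at x within {0..1})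
      = c * f (z + of_real \<rho> * cis (2 * pi * x))" if "x \<in> {0..1}" for x
  proof -
    have c1: "circlepath z \<rho> x = z + of_real \<rho> * cis (2 * pi * x)"
      by (simp add: circlepath cis_conv_exp mult_ac)
    have v: "vector_derivative (circlepath z \<rho>) (at x within {0..1}) = c * (of_real \<rho> * cis (2 * pi * x))"
      using vector_derivative_circlepath01[of x z \<rho>] that by (simp add: c_def cis_conv_exp mult_ac)
    show ?thesis unfolding c1 v using False by simp
  qed
  have "((\<lambda>x. c * f (z + of_real \<rho> * cis (2 * pi * x))) has_integral c * f z) {0..1}"
    by (rule has_integral_eq[OF _ i1[folded c_def]]) (rule e)
  then have "((\<lambda>x. c * f (z + of_real \<rho> * cis (2 * pi * x)) / c) has_integral c * f z / c) {0..1}"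
    by (rule has_integral_divide)
  then have "((\<lambda>x. f (z + of_real \<rho> * cis (2 * pi * x))) has_integral f z) (cbox 0 1)"
    using \<open>c \<noteq> 0\<close> by (simp add: cbox_interval)
  from has_integral_affinity[OF this, of "1 / (2 * pi)" 0]
  have "((\<lambda>\<phi>. f (z + circ \<rho> \<phi>)) has_integral (2 * pi) *\<^sub>R f z) {0..2 * pi}"
    by (simp add: image_affinity_atLeastAtMost_div)
  then show ?thesis by (simp add: integral_unique scaleR_conv_of_real)
qed

text \<open>Let \<open>YY\<close> and \<open>WW\<close> be the integrals over time and over the circle of radius \<open>\<rho>\<close> about \<open>z\<close> of \<open>v\<close>
  and of \<open>\<omega> cis (-\<phi>)\<close>, and let \<open>hh\<close> be the time integral of \<open>h t z\<close>. The first-order relations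
  between \<open>v\<close>, \<open>\<omega>\<close> and \<open>\<kappa>\<close> become \<open>YY' = i cnj WW\<close> and \<open>(\<rho> WW)' = \<rho> KK\<close>, and by the Stokes
  equation and the mean value property of \<open>h\<close> the term \<open>KK\<close> equals \<open>-2 \<pi> i hh\<close> up to the
  contribution of \<open>v s2 - v s1\<close>, which is at most \<open>\<epsilon>\<close> pointwise. Two integrations show that \<open>YY\<close>
  differs from \<open>- \<pi> cnj hh \<rho>\<^sup>2 / 2\<close> by a constant and an error of order \<open>\<epsilon> \<rho>\<^sup>2\<close>. As \<open>YY\<close> is
  bounded in terms of \<open>m\<close>, the number \<open>hh\<close> must be small.\<close>

lemma time_integral_h_bound:
  assumes s: "0 < s1" "s1 \<le> s2" and ball: "ball z (2 * R) \<subseteq> \<Omega>" and "0 < R"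
    and bd: "\<And>t x. t \<in> {s1..s2} \<Longrightarrow> x \<in> ball z (2 * R) \<Longrightarrow> norm (v t x) \<le> m"
    and diff: "\<And>x. x \<in> ball z (2 * R) \<Longrightarrow> norm (v s2 x - v s1 x) \<le> \<epsilon>"
  shows "norm (integral {s1..s2} (\<lambda>t. h t z)) \<le> 4 * \<epsilon> + 8 * m * (s2 - s1) / R\<^sup>2"
proof -
  define X where "X \<rho> \<phi> = z + circ \<rho> \<phi>" for \<rho> \<phi> :: real
  have inS: "X \<rho> \<phi> \<in> ball z (2 * R)" if "\<rho> \<in> {0..<2*R}" for \<rho> \<phi>
    using that by (auto simp: X_def dist_norm norm_mult)
  have in\<Omega>: "X \<rho> \<phi> \<in> \<Omega>" if "\<rho> \<in> {0..<2*R}" for \<rho> \<phi> using inS[OF that] ball by blast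
  have tpos: "0 < t" if "t \<in> {s1..s2}" for t using that s by auto
  have zS: "z \<in> ball z (2 * R)" using \<open>0 < R\<close> by simp
  then have "z \<in> \<Omega>" using ball by blast
  have "0 \<le> \<epsilon>" using diff[OF zS] norm_ge_zero order_trans by blast
  define hh where "hh = integral {s1..s2} (\<lambda>t. h t z)"
  define y where "y t \<rho> = integral {0..2 * pi} (\<lambda>\<phi>. v t (X \<rho> \<phi>))" for t \<rho>
  define W where "W t \<rho> = integral {0..2 * pi} (\<lambda>\<phi>. of_real (\<omega> t (X \<rho> \<phi>)) * cis (- \<phi>))" for t \<rho>
  define k where "k t \<rho> = integral {0..2 * pi} (\<lambda>\<phi>. \<kappa> t (X \<rho> \<phi>))" for t \<rho>
  have cont_\<omega>: "continuous_on ({0<..} \<times> \<Omega>) (\<lambda>(t, x). of_real (\<omega> t x) :: complex)"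
  proof -
    have "continuous_on ({0<..} \<times> \<Omega>) (\<lambda>(t, x). of_real (Im (v1 t x) - Re (v2 t x)) :: complex)"
      using cont_v1 cont_v2 unfolding split_def by (intro continuous_intros)
    then show ?thesis by (rule continuous_on_eq) (auto simp: \<omega>_eq)
  qed
  have contX: "continuous_on D (\<lambda>q. X (f q) (g q))" if "continuous_on D f" "continuous_on D g" for D :: "'b::topological_space set" and f g
    unfolding X_def using that by (intro continuous_intros)
  have cP: "continuous_on ({s1..s2} \<times> {0..<2*R}) (\<lambda>q. integral {0..2 * pi} (\<lambda>\<phi>. G (fst q) (X (snd q) \<phi>) * e \<phi>))"
    if G: "cont_field \<Omega> G" and e: "continuous_on UNIV e" for G :: "real \<Rightarrow> complex \<Rightarrow> complex" and e
  proof -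
    have e': "continuous_on D (\<lambda>q. e (f q))" if "continuous_on D f" for D :: "((real \<times> real) \<times> real) set" and f
      by (rule continuous_on_compose2[OF e that]) auto
    have "continuous_on (({s1..s2} \<times> {0..<2*R}) \<times> cbox 0 (2 * pi)) (\<lambda>(q, \<phi>). G (fst q) (X (snd q) \<phi>) * e \<phi>)"
      unfolding split_def
      by (intro continuous_intros cont_on_param[OF G] contX e') (use tpos in\<Omega> in auto)
    from integral_continuous_on_param[OF this] show ?thesis by (simp add: cbox_interval)
  qed
  have cy: "continuous_on ({s1..s2} \<times> {0..<2*R}) (\<lambda>q. y (fst q) (snd q))"
    using cP[OF cont_v, of "\<lambda>_. 1"] by (simp add: y_def)
  have cW: "continuous_on ({s1..s2} \<times> {0..<2*R}) (\<lambda>q. W (fst q) (snd q))"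
    using cP[OF cont_\<omega>, of "\<lambda>\<phi>. cis (- \<phi>)"] by (simp add: W_def continuous_intros)
  have ck: "continuous_on ({s1..s2} \<times> {0..<2*R}) (\<lambda>q. k (fst q) (snd q))"
    using cP[OF cont_\<kappa>, of "\<lambda>_. 1"] by (simp add: k_def)
  have swap: "continuous_on (D \<times> cbox s1 s2) (\<lambda>q. f (snd q) (fst q))"
    if "continuous_on ({s1..s2} \<times> {0..<2*R}) (\<lambda>q. f (fst q) (snd q))" "D \<subseteq> {0..<2*R}" for f :: "real \<Rightarrow> real \<Rightarrow> complex" and D
  proof -
    have "continuous_on (D \<times> cbox s1 s2) (\<lambda>q. (\<lambda>q. f (fst q) (snd q)) (snd q, fst q))"
      by (rule continuous_on_compose2[OF that(1)]) (use that(2) in \<open>auto intro!: continuous_intros\<close>)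
    then show ?thesis by simp
  qed
  have slice: "continuous_on {s1..s2} (\<lambda>t. f t \<rho>)"
    if "continuous_on ({s1..s2} \<times> {0..<2*R}) (\<lambda>q. f (fst q) (snd q))" "\<rho> \<in> {0..<2*R}" for f :: "real \<Rightarrow> real \<Rightarrow> complex" and \<rho>
  proof -
    have "continuous_on {s1..s2} (\<lambda>t. (\<lambda>q. f (fst q) (snd q)) (t, \<rho>))"
      by (rule continuous_on_compose2[OF that(1)]) (use that(2) in \<open>auto intro!: continuous_intros\<close>)
    then show ?thesis by simp
  qed
  define YY where "YY \<rho> = integral (cbox s1 s2) (\<lambda>t. y t \<rho>)" for \<rho>
  define WW where "WW \<rho> = integral (cbox s1 s2) (\<lambda>t. W t \<rho>)" for \<rho>
  define KK where "KK \<rho> = integral (cbox s1 s2) (\<lambda>t. k t \<rho>)" for \<rho>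
  have cYY: "continuous_on {0..<2*R} YY" and cWW: "continuous_on {0..<2*R} WW"
    unfolding YY_def WW_def
    by (rule integral_continuous_on_param, use swap[OF cy] swap[OF cW] in \<open>simp add: split_def\<close>)+
  have ballX: "open {0<..<2*R}" "convex {0<..<2*R}" "\<And>\<rho> \<phi>. \<rho> \<in> {0<..<2*R} \<Longrightarrow> z + circ \<rho> \<phi> \<in> ball z (2*R)"
    using inS unfolding X_def by auto
  have cs: "continuous_on (ball z (2*R)) (f t)" if "cont_field \<Omega> f" "0 < t" for f :: "real \<Rightarrow> complex \<Rightarrow> complex" and t
    by (rule continuous_on_subset[OF cont_slice[OF that] ball])
  \<comment> \<open>The case \<open>k = 0\<close> of \<open>circle_Fourier\<close>, with \<open>v1 - i v2 = i \<omega>\<close>.\<close>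
  have dy: "((\<lambda>\<rho>. y t \<rho>) has_vector_derivative \<i> * cnj (W t \<rho>)) (at \<rho>)"
    if t: "t \<in> {s1..s2}" and \<rho>: "\<rho> \<in> {0<..<2*R}" for t \<rho>
  proof -
    note cF = circle_Fourier[where F = "v t" and A = "v1 t" and B = "v2 t" and k = 0 and S = "ball z (2*R)" and I = "{0<..<2*R}" and z = z and \<rho> = \<rho>,
        OF _ cs[OF cont_v1 tpos[OF t]] cs[OF cont_v2 tpos[OF t]] ballX \<rho>]
    have d: "has_partials (v t) (v1 t x) (v2 t x) x" if "x \<in> ball z (2*R)" for x
      using v_deriv tpos[OF t] ball that by blast
    define D where "D = integral {0..2 * pi} (\<lambda>\<phi>. (of_real (cos \<phi>) * v1 t (X \<rho> \<phi>) + of_real (sin \<phi>) * v2 t (X \<rho> \<phi>)))"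
    have 1: "((\<lambda>\<rho>. y t \<rho>) has_vector_derivative D) (at \<rho>)"
      using cF(1)[OF d] by (simp add: y_def D_def X_def)
    have "of_real \<rho> * D = integral {0..2 * pi} (\<lambda>\<phi>. circ \<rho> \<phi> * (v1 t (X \<rho> \<phi>) - \<i> * v2 t (X \<rho> \<phi>)))"
      using cF(2)[OF d] by (simp add: D_def X_def)
    also have "\<dots> = integral {0..2 * pi} (\<lambda>\<phi>. of_real \<rho> * \<i> * cnj (of_real (\<omega> t (X \<rho> \<phi>)) * cis (- \<phi>)))"
      using complex_v_deriv_curl tpos[OF t] in\<Omega>[of \<rho>] \<rho> by (intro integral_cong) (simp add: cis_cnj)
    also have "\<dots> = of_real \<rho> * (\<i> * integral {0..2 * pi} (\<lambda>\<phi>. cnj (of_real (\<omega> t (X \<rho> \<phi>)) * cis (- \<phi>))))"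
      by (simp add: mult.assoc)
    also have "integral {0..2 * pi} (\<lambda>\<phi>. cnj (of_real (\<omega> t (X \<rho> \<phi>)) * cis (- \<phi>))) = cnj (W t \<rho>)"
      unfolding W_def by (rule integral_cnj[symmetric])
    finally have "D = \<i> * cnj (W t \<rho>)" using \<rho> by simp
    then show ?thesis using 1 by simp
  qed
  \<comment> \<open>The case \<open>k = 1\<close> of \<open>circle_Fourier\<close> for \<open>\<omega>\<close>.\<close>
  have dW: "((\<lambda>\<rho>. of_real \<rho> * W t \<rho>) has_vector_derivative of_real \<rho> * k t \<rho>) (at \<rho>)"
    if t: "t \<in> {s1..s2}" and \<rho>: "\<rho> \<in> {0<..<2*R}" for t \<rho>
  proof -
    let ?A = "\<lambda>x. of_real (Re (\<kappa> t x)) :: complex" and ?B = "\<lambda>x. of_real (- Im (\<kappa> t x)) :: complex"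
    have cA: "continuous_on (ball z (2*R)) ?A" "continuous_on (ball z (2*R)) ?B"
      by (intro continuous_intros cs[OF cont_\<kappa> tpos[OF t]])+
    have d: "((\<lambda>x. of_real (\<omega> t x) :: complex) has_derivative (\<lambda>e. Re e *\<^sub>R ?A x + Im e *\<^sub>R ?B x)) (at x)" if "x \<in> ball z (2*R)" for x
      using complex_\<omega>_deriv tpos[OF t] ball that by blast
    note cF = circle_Fourier[where F = "\<lambda>x. of_real (\<omega> t x)" and A = ?A and B = ?B and k = 1 and S = "ball z (2*R)" and I = "{0<..<2*R}" and z = z and \<rho> = \<rho>,
        OF d cA ballX \<rho>]
    define D where "D = integral {0..2 * pi} (\<lambda>\<phi>. (of_real (cos \<phi>) * ?A (X \<rho> \<phi>) + of_real (sin \<phi>) * ?B (X \<rho> \<phi>)) * cis (- \<phi>))"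
    have 1: "((\<lambda>\<rho>. W t \<rho>) has_vector_derivative D) (at \<rho>)"
      using cF(1) by (simp add: W_def D_def X_def)
    have "of_real \<rho> * D + W t \<rho> = integral {0..2 * pi} (\<lambda>\<phi>. circ \<rho> \<phi> * (?A (X \<rho> \<phi>) - \<i> * ?B (X \<rho> \<phi>)) * cis (- \<phi>))"
      using cF(2) by (simp add: D_def X_def W_def)
    also have "\<dots> = integral {0..2 * pi} (\<lambda>\<phi>. of_real \<rho> * \<kappa> t (X \<rho> \<phi>))"
    proof (rule integral_cong)
      fix \<phi> :: real
      have "?A (X \<rho> \<phi>) - \<i> * ?B (X \<rho> \<phi>) = \<kappa> t (X \<rho> \<phi>)" by (simp add: complex_eq_iff)
      moreover have "cis \<phi> * cis (- \<phi>) = 1" by (simp add: cis_mult)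
      ultimately show "circ \<rho> \<phi> * (?A (X \<rho> \<phi>) - \<i> * ?B (X \<rho> \<phi>)) * cis (- \<phi>) = of_real \<rho> * \<kappa> t (X \<rho> \<phi>)"
        by (metis mult.assoc mult.commute mult.left_neutral)
    qed
    finally have "of_real \<rho> * D + W t \<rho> = of_real \<rho> * k t \<rho>" by (simp add: k_def)
    moreover have "((\<lambda>\<rho>. of_real \<rho> * W t \<rho>) has_vector_derivative of_real \<rho> * D + 1 * W t \<rho>) (at \<rho>)"
      by (intro has_vector_derivative_mult 1) (auto intro!: derivative_eq_intros simp: has_vector_derivative_def scaleR_conv_of_real)
    ultimately show ?thesis by simp
  qed
  have dYY: "(YY has_vector_derivative \<i> * cnj (WW \<rho>)) (at \<rho>)" if \<rho>: "\<rho> \<in> {0<..<2*R}" for \<rho>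
  proof -
    have "((\<lambda>\<rho>. integral (cbox s1 s2) (\<lambda>t. y t \<rho>)) has_vector_derivative integral (cbox s1 s2) (\<lambda>t. \<i> * cnj (W t \<rho>))) (at \<rho> within {0<..<2*R})"
    proof (rule leibniz_rule_vector_derivative)
      show "((\<lambda>\<rho>. y t \<rho>) has_vector_derivative \<i> * cnj (W t \<rho>)) (at \<rho> within {0<..<2*R})" if "\<rho> \<in> {0<..<2*R}" "t \<in> cbox s1 s2" for t \<rho>
        using dy[of t \<rho>] that by (auto intro: has_vector_derivative_at_within)
      show "(\<lambda>t. y t \<rho>) integrable_on cbox s1 s2" if "\<rho> \<in> {0<..<2*R}" for \<rho>
        using slice[OF cy, of \<rho>] that by (intro integrable_continuous) (simp add: cbox_interval)
      show "continuous_on ({0<..<2*R} \<times> cbox s1 s2) (\<lambda>(\<rho>, t). \<i> * cnj (W t \<rho>))"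
        unfolding split_def by (intro continuous_intros swap[OF cW]) auto
    qed (use \<rho> in auto)
    moreover have "integral (cbox s1 s2) (\<lambda>t. \<i> * cnj (W t \<rho>)) = \<i> * cnj (WW \<rho>)"
      unfolding WW_def by (simp add: integral_cnj)
    ultimately show ?thesis using at_within_open[OF \<rho>] by (simp add: YY_def[abs_def])
  qed
  have dWW: "((\<lambda>\<rho>. of_real \<rho> * WW \<rho>) has_vector_derivative of_real \<rho> * KK \<rho>) (at \<rho>)" if \<rho>: "\<rho> \<in> {0<..<2*R}" for \<rho>
  proof -
    have "((\<lambda>\<rho>. integral (cbox s1 s2) (\<lambda>t. of_real \<rho> * W t \<rho>)) has_vector_derivative integral (cbox s1 s2) (\<lambda>t. of_real \<rho> * k t \<rho>)) (at \<rho> within {0<..<2*R})"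
    proof (rule leibniz_rule_vector_derivative)
      show "((\<lambda>\<rho>. of_real \<rho> * W t \<rho>) has_vector_derivative of_real \<rho> * k t \<rho>) (at \<rho> within {0<..<2*R})" if "\<rho> \<in> {0<..<2*R}" "t \<in> cbox s1 s2" for t \<rho>
        using dW[of t \<rho>] that by (auto intro: has_vector_derivative_at_within)
      show "(\<lambda>t. of_real \<rho> * W t \<rho>) integrable_on cbox s1 s2" if "\<rho> \<in> {0<..<2*R}" for \<rho>
        using slice[OF cW, of \<rho>] that by (intro integrable_continuous continuous_intros) (simp add: cbox_interval)
      show "continuous_on ({0<..<2*R} \<times> cbox s1 s2) (\<lambda>(\<rho>, t). of_real \<rho> * k t \<rho>)"
        unfolding split_def by (intro continuous_intros swap[OF ck]) auto
    qed (use \<rho> in auto)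
    then show ?thesis using at_within_open[OF \<rho>] by (simp add: WW_def[abs_def] KK_def)
  qed
  \<comment> \<open>By the Stokes equation \<open>i \<kappa> = h - cnj vt\<close>; the integral of \<open>h\<close> is its mean value, that of \<open>vt\<close> the increment of \<open>v\<close>.\<close>
  have KK: "norm (of_real \<rho> * KK \<rho> + 2 * pi * \<i> * hh * \<rho>) \<le> 2 * pi * \<epsilon> * \<rho>" if \<rho>: "\<rho> \<in> {0<..<2*R}" for \<rho>
  proof -
    have \<rho>': "\<rho> \<in> {0..<2*R}" using \<rho> by auto
    define \<delta> where "\<delta> = integral {0..2 * pi} (\<lambda>\<phi>. cnj (v s2 (X \<rho> \<phi>) - v s1 (X \<rho> \<phi>)))"
    have cX: "continuous_on {0..2 * pi} (\<lambda>\<phi>. f t (X \<rho> \<phi>))" if "cont_field \<Omega> f" "0 < t" for f :: "real \<Rightarrow> complex \<Rightarrow> complex" and t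
      by (intro cont_on_param[OF that(1)] contX continuous_intros) (use that in\<Omega>[OF \<rho>'] in auto)
    define P :: complex where "P = 2 * of_real pi"
    have "\<i> * k t \<rho> = P * h t z - integral {0..2 * pi} (\<lambda>\<phi>. cnj (vt t (X \<rho> \<phi>)))" if t: "t \<in> {s1..s2}" for t
    proof -
      have "\<i> * k t \<rho> = integral {0..2 * pi} (\<lambda>\<phi>. \<i> * \<kappa> t (X \<rho> \<phi>))" by (simp add: k_def)
      also have "\<dots> = integral {0..2 * pi} (\<lambda>\<phi>. h t (X \<rho> \<phi>) - cnj (vt t (X \<rho> \<phi>)))"
        using h_eq[OF tpos[OF t] in\<Omega>[OF \<rho>']] by simp
      also have "\<dots> = integral {0..2 * pi} (\<lambda>\<phi>. h t (X \<rho> \<phi>)) - integral {0..2 * pi} (\<lambda>\<phi>. cnj (vt t (X \<rho> \<phi>)))"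
        using tpos[OF t] by (intro integral_diff integrable_continuous_real continuous_intros cX cont_h cont_vt)
      also have "integral {0..2 * pi} (\<lambda>\<phi>. h t (X \<rho> \<phi>)) = P * h t z"
        unfolding X_def P_def using holomorphic_circle_mean[of "h t" z "2 * R" \<rho>] \<rho> holomorphic_on_subset[OF h_holomorphic[OF tpos[OF t]] ball] by auto
      finally show ?thesis .
    qed
    then have "\<i> * KK \<rho> = integral (cbox s1 s2) (\<lambda>t. P * h t z - integral {0..2 * pi} (\<lambda>\<phi>. cnj (vt t (X \<rho> \<phi>))))"
      unfolding KK_def integral_mult_right[symmetric] by (intro integral_cong) (simp add: cbox_interval)
    also have "\<dots> = integral (cbox s1 s2) (\<lambda>t. P * h t z) - integral (cbox s1 s2) (\<lambda>t. integral {0..2 * pi} (\<lambda>\<phi>. cnj (vt t (X \<rho> \<phi>))))"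
    proof (rule integral_diff)
      show "(\<lambda>t. P * h t z) integrable_on cbox s1 s2"
        by (intro integrable_continuous continuous_intros cont_on_param[OF cont_h]) (use tpos \<open>z \<in> \<Omega>\<close> in \<open>auto simp: cbox_interval\<close>)
      have "continuous_on (cbox s1 s2) (\<lambda>t. integral (cbox 0 (2 * pi)) (\<lambda>\<phi>. cnj (vt t (X \<rho> \<phi>))))"
        by (intro integral_continuous_on_param) (use tpos in\<Omega>[OF \<rho>'] in \<open>auto simp: split_def cbox_interval intro!: continuous_intros cont_on_param[OF cont_vt] contX\<close>)
      then show "(\<lambda>t. integral {0..2 * pi} (\<lambda>\<phi>. cnj (vt t (X \<rho> \<phi>)))) integrable_on cbox s1 s2"
        by (intro integrable_continuous) (simp add: cbox_interval)
    qed
    also have "integral (cbox s1 s2) (\<lambda>t. P * h t z) = P * hh" by (simp add: hh_def cbox_interval)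
    also have "integral (cbox s1 s2) (\<lambda>t. integral {0..2 * pi} (\<lambda>\<phi>. cnj (vt t (X \<rho> \<phi>)))) = \<delta>"
    proof -
      have "integral (cbox s1 s2) (\<lambda>t. integral (cbox 0 (2 * pi)) (\<lambda>\<phi>. cnj (vt t (X \<rho> \<phi>))))
          = integral (cbox 0 (2 * pi)) (\<lambda>\<phi>. integral (cbox s1 s2) (\<lambda>t. cnj (vt t (X \<rho> \<phi>))))"
        by (rule integral_swap_continuous)
          (use tpos in\<Omega>[OF \<rho>'] in \<open>auto simp: split_def cbox_Pair_eq cbox_interval intro!: continuous_intros cont_on_param[OF cont_vt] contX\<close>)
      also have "\<dots> = \<delta>"
        unfolding \<delta>_def cbox_interval
      proof (rule integral_cong)
        fix \<phi> :: real
        have "((\<lambda>t. cnj (vt t (X \<rho> \<phi>))) has_integral cnj (v s2 (X \<rho> \<phi>)) - cnj (v s1 (X \<rho> \<phi>))) {s1..s2}"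
          by (rule fundamental_theorem_of_calculus)
            (use s tpos in\<Omega>[OF \<rho>'] in \<open>auto intro!: bounded_linear.has_vector_derivative[OF bounded_linear_cnj] has_vector_derivative_at_within[OF v_time]\<close>)
        then show "integral {s1..s2} (\<lambda>t. cnj (vt t (X \<rho> \<phi>))) = cnj (v s2 (X \<rho> \<phi>) - v s1 (X \<rho> \<phi>))"
          by (simp add: integral_unique)
      qed
      finally show ?thesis by (simp add: cbox_interval)
    qed
    finally have "\<delta> = P * hh - \<i> * KK \<rho>" by simp
    then have "\<i> * \<delta> = KK \<rho> + \<i> * (P * hh)" by (simp add: complex_eq_iff)
    then have "of_real \<rho> * KK \<rho> + 2 * pi * \<i> * hh * \<rho> = of_real \<rho> * (\<i> * \<delta>)" by (simp add: P_def algebra_simps)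
    moreover have "norm \<delta> \<le> \<epsilon> * (2 * pi - 0)"
      unfolding \<delta>_def
    proof (rule integral_bound)
      show "continuous_on {0..2 * pi} (\<lambda>\<phi>. cnj (v s2 (X \<rho> \<phi>) - v s1 (X \<rho> \<phi>)))"
        using s by (intro continuous_intros cX cont_v) auto
      show "norm (cnj (v s2 (X \<rho> \<phi>) - v s1 (X \<rho> \<phi>))) \<le> \<epsilon>" for \<phi>
        using diff[OF inS[OF \<rho>']] by (simp only: complex_mod_cnj)
    qed simp
    ultimately show ?thesis using \<rho> mult_left_mono[of "norm \<delta>" "\<epsilon> * (2 * pi)" \<rho>] by (simp add: norm_mult mult_ac)
  qed
  have WWb: "norm (WW \<rho> + pi * \<i> * hh * \<rho>) \<le> 2 * pi * \<epsilon> * \<rho>" if \<rho>: "\<rho> \<in> {0<..<2*R}" for \<rho>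
  proof -
    let ?Z = "\<lambda>\<rho>. of_real \<rho> * WW \<rho> + pi * \<i> * hh * (of_real \<rho>)\<^sup>2"
    have dZ: "(?Z has_vector_derivative of_real x * KK x + 2 * pi * \<i> * hh * x) (at x)" if "x \<in> {0<..<2*R}" for x
    proof -
      have "((\<lambda>w. pi * \<i> * hh * w\<^sup>2) has_field_derivative 2 * pi * \<i> * hh * of_real x) (at (of_real x))"
        by (auto intro!: derivative_eq_intros)
      from has_vector_derivative_add[OF dWW[OF that] has_vector_derivative_real_field[OF this]]
      show ?thesis by simp
    qed
    have "\<exists>x\<in>{0<..<\<rho>}. norm (?Z \<rho> - ?Z 0) \<le> norm ((\<rho> - 0) *\<^sub>R (of_real x * KK x + 2 * pi * \<i> * hh * x))"
    proof (rule mvt_general)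
      show "continuous_on {0..\<rho>} ?Z" using \<rho> by (intro continuous_intros continuous_on_subset[OF cWW]) auto
      show "(?Z has_derivative (\<lambda>h. h *\<^sub>R (of_real x * KK x + 2 * pi * \<i> * hh * x))) (at x)" if "0 < x" "x < \<rho>" for x
        using dZ[of x] that \<rho> by (simp add: has_vector_derivative_def)
    qed (use \<rho> in auto)
    then obtain x where x: "x \<in> {0<..<\<rho>}" "norm (?Z \<rho>) \<le> \<rho> * norm (of_real x * KK x + 2 * pi * \<i> * hh * x)"
      using \<rho> by auto
    have "norm (?Z \<rho>) \<le> \<rho> * (2 * pi * \<epsilon> * \<rho>)"
    proof -
      have "norm (of_real x * KK x + 2 * pi * \<i> * hh * x) \<le> 2 * pi * \<epsilon> * x" using KK[of x] x(1) \<rho> by auto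
      also have "\<dots> \<le> 2 * pi * \<epsilon> * \<rho>" using x(1) \<open>0 \<le> \<epsilon>\<close> by (intro mult_left_mono) auto
      finally show ?thesis using x(2) \<rho> by (meson greaterThanLessThan_iff less_imp_le mult_left_mono order_trans)
    qed
    moreover have "?Z \<rho> = of_real \<rho> * (WW \<rho> + pi * \<i> * hh * \<rho>)" by (simp add: algebra_simps power2_eq_square)
    ultimately show ?thesis using \<rho> by (simp add: norm_mult)
  qed
  let ?V = "\<lambda>\<rho>. YY \<rho> + pi * cnj hh * (of_real \<rho>)\<^sup>2 / 2"
  have dV: "(?V has_vector_derivative \<i> * cnj (WW x) + pi * cnj hh * x) (at x)" if "x \<in> {0<..<2*R}" for x
  proof -
    have "((\<lambda>w. pi * cnj hh * w\<^sup>2 / 2) has_field_derivative pi * cnj hh * of_real x) (at (of_real x))"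
      by (auto intro!: derivative_eq_intros)
    from has_vector_derivative_add[OF dYY[OF that] has_vector_derivative_real_field[OF this]]
    show ?thesis by simp
  qed
  have "\<exists>x\<in>{0<..<R}. norm (?V R - ?V 0) \<le> norm ((R - 0) *\<^sub>R (\<i> * cnj (WW x) + pi * cnj hh * x))"
  proof (rule mvt_general)
    show "continuous_on {0..R} ?V" using \<open>0 < R\<close> by (intro continuous_intros continuous_on_subset[OF cYY]) auto
    show "(?V has_derivative (\<lambda>h. h *\<^sub>R (\<i> * cnj (WW x) + pi * cnj hh * x))) (at x)" if "0 < x" "x < R" for x
      using dV[of x] that by (simp add: has_vector_derivative_def)
  qed fact
  then obtain x where x: "x \<in> {0<..<R}" "norm (?V R - ?V 0) \<le> R * norm (\<i> * cnj (WW x) + pi * cnj hh * x)"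
    using \<open>0 < R\<close> by auto
  have "\<i> * cnj (WW x) + pi * cnj hh * x = \<i> * cnj (WW x + pi * \<i> * hh * x)"
    by (simp add: complex_eq_iff algebra_simps)
  then have "norm (\<i> * cnj (WW x) + pi * cnj hh * x) \<le> 2 * pi * \<epsilon> * x"
    using WWb[of x] x(1) by (simp add: norm_mult del: complex_cnj_add)
  also have "\<dots> \<le> 2 * pi * \<epsilon> * R" using x(1) \<open>0 \<le> \<epsilon>\<close> by (intro mult_left_mono) auto
  finally have "norm (?V R - ?V 0) \<le> R * (2 * pi * \<epsilon> * R)"
    using x(2) \<open>0 < R\<close> by (meson less_imp_le mult_left_mono order_trans)
  moreover have YYb: "norm (YY \<rho>) \<le> m * (2 * pi) * (s2 - s1)" if \<rho>: "\<rho> \<in> {0..<2*R}" for \<rho>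
    unfolding YY_def cbox_interval
  proof (rule integral_bound[OF s(2) slice[OF cy \<rho>]])
    fix t assume t: "t \<in> {s1..s2}"
    have "norm (y t \<rho>) \<le> m * (2 * pi - 0)"
      unfolding y_def
    proof (rule integral_bound)
      show "continuous_on {0..2 * pi} (\<lambda>\<phi>. v t (X \<rho> \<phi>))"
        by (intro cont_on_param[OF cont_v] contX continuous_intros) (use tpos[OF t] in\<Omega>[OF \<rho>] in auto)
    qed (use bd[OF t inS[OF \<rho>]] in auto)
    then show "norm (y t \<rho>) \<le> m * (2 * pi)" by simp
  qed
  moreover have "?V R - ?V 0 = (YY R - YY 0) + pi * cnj hh * (of_real R)\<^sup>2 / 2" by simp
  ultimately have "norm (pi * cnj hh * (of_real R)\<^sup>2 / 2) \<le> R * (2 * pi * \<epsilon> * R) + 2 * (m * (2 * pi) * (s2 - s1))"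
  proof -
    assume *: "norm (?V R - ?V 0) \<le> R * (2 * pi * \<epsilon> * R)" "?V R - ?V 0 = (YY R - YY 0) + pi * cnj hh * (of_real R)\<^sup>2 / 2"
    have "norm (YY R) \<le> m * (2 * pi) * (s2 - s1)" "norm (YY 0) \<le> m * (2 * pi) * (s2 - s1)"
      using YYb[of R] YYb[of 0] \<open>0 < R\<close> by auto
    then have "norm (YY R - YY 0) \<le> 2 * (m * (2 * pi) * (s2 - s1))" using norm_triangle_ineq4[of "YY R" "YY 0"] by linarith
    moreover have "norm (pi * cnj hh * (of_real R)\<^sup>2 / 2) \<le> norm ((YY R - YY 0) + pi * cnj hh * (of_real R)\<^sup>2 / 2) + norm (YY R - YY 0)"
      using norm_triangle_ineq4[of "(YY R - YY 0) + pi * cnj hh * (of_real R)\<^sup>2 / 2" "YY R - YY 0"] by simp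
    ultimately show ?thesis using *(1) unfolding *(2) by linarith
  qed
  then have le: "pi * norm hh * R\<^sup>2 / 2 \<le> R * (2 * pi * \<epsilon> * R) + 2 * (m * (2 * pi) * (s2 - s1))"
    by (simp add: norm_mult norm_divide norm_power)
  define q where "q = R\<^sup>2"
  define S where "S = m * (s2 - s1)"
  have "q > 0" using \<open>0 < R\<close> by (simp add: q_def)
  have "pi * norm hh * q / 2 \<le> 2 * pi * \<epsilon> * q + 4 * pi * S"
    using le unfolding q_def S_def power2_eq_square by (simp only: mult_ac)
  then have le': "(2 / pi) * (pi * norm hh * q / 2) \<le> (2 / pi) * (2 * pi * \<epsilon> * q + 4 * pi * S)"
    by (rule mult_left_mono) simp
  have "(2 / pi) * (pi * norm hh * q / 2) = norm hh * q" by simp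
  moreover have "(2 / pi) * (2 * pi * \<epsilon> * q + 4 * pi * S) = 4 * \<epsilon> * q + 8 * S"
    unfolding distrib_left by simp
  ultimately have "norm hh * q \<le> 4 * \<epsilon> * q + 8 * S" using le' by (simp only:)
  then have "norm hh \<le> (4 * \<epsilon> * q + 8 * S) / q" using \<open>q > 0\<close> by (simp add: pos_le_divide_eq)
  also have "\<dots> = 4 * \<epsilon> + 8 * S / q" using \<open>q > 0\<close> by (simp add: add_divide_distrib)
  finally have "norm hh \<le> 4 * \<epsilon> + 8 * m * (s2 - s1) / R\<^sup>2" unfolding q_def S_def mult.assoc .
  then show ?thesis by (simp add: hh_def)
qed

end

section \<open>Robin conditions obtained from a limit at the end point\<close>

lemma robin_condition_cnj:
  assumes "robin_condition_at r0 m f"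
  shows "robin_condition_at r0 m (\<lambda>r. cnj (f r))"
proof -
  obtain F F' where F: "\<forall>r>r0. F r = f r" "\<forall>r\<ge>r0. (F has_vector_derivative F' r) (at r within {r0..})"
    "continuous_on {r0..} F'" "of_real r0 * F' r0 + of_real m * F r0 = 0"
    using assms unfolding robin_condition_at_def by blast
  have "of_real r0 * cnj (F' r0) + of_real m * cnj (F r0) = cnj (of_real r0 * F' r0 + of_real m * F r0)" by simp
  then have "of_real r0 * cnj (F' r0) + of_real m * cnj (F r0) = 0" using F(4) by simp
  then show ?thesis
    unfolding robin_condition_at_def
    using F by (intro exI[of _ "\<lambda>r. cnj (F r)"] exI[of _ "\<lambda>r. cnj (F' r)"])
      (auto intro!: bounded_linear.has_vector_derivative[OF bounded_linear_cnj] continuous_intros)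
qed

text \<open>The function \<open>U r = r ^ m f r\<close> has the derivative \<open>r ^ m E r / r\<close>, which extends continuously by
  \<open>0\<close> to \<open>r0\<close>. Its antiderivative \<open>V\<close> is the \<open>C\<^sup>1\<close> extension of \<open>U\<close>, and \<open>V r / r ^ m\<close> that of
  \<open>f\<close>. The vanishing of \<open>V'\<close> at \<open>r0\<close> is the Robin condition.\<close>

lemma robin_condition_of_limit:
  fixes f D E :: "real \<Rightarrow> complex" and m :: nat
  assumes "0 < r0"
    and D: "\<And>r. r0 < r \<Longrightarrow> (f has_vector_derivative D r) (at r)"
    and E: "\<And>r. r0 < r \<Longrightarrow> of_real r * D r + of_nat m * f r = E r"
    and cE: "continuous_on {r0<..} E" and lim: "(E \<longlongrightarrow> 0) (at_right r0)"
  shows "robin_condition_at r0 m f"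
proof -
  define G where "G r = (if r \<le> r0 then 0 else of_real (r ^ m / r) * E r)" for r
  have G_at: "G r = of_real (r ^ m / r) * E r" if "r0 < r" for r using that by (simp add: G_def)
  have cG: "continuous_on {r0..} G"
  proof (rule continuous_on_eq_continuous_within[THEN iffD2, rule_format])
    fix r assume r: "r \<in> {r0..}"
    show "continuous (at r within {r0..}) G"
    proof (cases "r = r0")
      case True
      have "((\<lambda>r. of_real (r ^ m / r) * E r) \<longlongrightarrow> of_real (r0 ^ m / r0) * 0) (at_right r0)"
        using \<open>0 < r0\<close> by (intro tendsto_intros lim) auto
      moreover have "\<forall>\<^sub>F r in at_right r0. of_real (r ^ m / r) * E r = G r"
        using eventually_at_right_less[of r0] by eventually_elim (simp add: G_at)
      ultimately have "(G \<longlongrightarrow> of_real (r0 ^ m / r0) * 0) (at_right r0)" by (rule Lim_transform_eventually)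
      then have "(G \<longlongrightarrow> 0) (at_right r0)" by simp
      moreover have "at r0 within {r0..} = at_right r0"
        by (simp add: at_within_Ici_at_right)
      ultimately show ?thesis using True by (simp add: continuous_within G_def)
    next
      case False
      then have "r0 < r" using r by simp
      have "continuous_on {r0<..} (\<lambda>r. of_real (r ^ m / r) * E r)"
        using \<open>0 < r0\<close> by (intro continuous_intros cE) auto
      then have "continuous_on {r0<..} G" by (rule continuous_on_eq) (simp add: G_at)
      then show ?thesis using \<open>r0 < r\<close>
        by (simp add: continuous_on_eq_continuous_at continuous_at_imp_continuous_at_within)
    qed
  qed
  define U where "U r = of_real (r ^ m) * f r" for r
  have dU: "(U has_vector_derivative G r) (at r)" if "r0 < r" for r
  proof -
    have "0 < r" using that \<open>0 < r0\<close> by simp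
    have "((\<lambda>r. r ^ m) has_real_derivative m * r ^ (m - 1)) (at r)" by (auto intro!: derivative_eq_intros)
    then have "((\<lambda>r. r ^ m *\<^sub>R f r) has_vector_derivative (r ^ m *\<^sub>R D r + (m * r ^ (m - 1)) *\<^sub>R f r)) (at r)"
      by (intro has_vector_derivative_scaleR D that)
    moreover have "r ^ m *\<^sub>R D r + (m * r ^ (m - 1)) *\<^sub>R f r = G r"
    proof -
      have "of_real (r ^ m / r) * (of_real r * D r + of_nat m * f r) = of_real (r ^ m) * D r + of_real (m * (r ^ m / r)) * f r"
        using \<open>0 < r\<close> by (simp add: field_simps)
      moreover have "m * (r ^ m / r) = m * r ^ (m - 1)" using \<open>0 < r\<close> by (cases m) auto
      ultimately show ?thesis using E[OF that] by (simp only: G_at[OF that] scaleR_conv_of_real)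
    qed
    ultimately show ?thesis by (simp add: U_def[abs_def] scaleR_conv_of_real)
  qed
  define r1 where "r1 = r0 + 1"
  define V where "V r = U r1 - integral {r0..r1} G + integral {r0..r} G" for r
  have dV: "(V has_vector_derivative G r) (at r within {r0..})" if "r0 \<le> r" for r
  proof -
    have "((\<lambda>u. integral {r0..u} G) has_vector_derivative G r) (at r within {r0..r + 1})"
      using that by (intro integral_has_vector_derivative continuous_on_subset[OF cG]) auto
    moreover have "at r within {r0..} = at r within {r0..r + 1}"
      by (rule at_within_nhd[of r "{..<r + 1}"]) auto
    ultimately show ?thesis unfolding V_def
      by (auto intro!: derivative_eq_intros simp: has_vector_derivative_def)
  qed
  have VU: "V r = U r" if "r0 < r" for r
  proof -
    have "((\<lambda>r. V r - U r) has_vector_derivative 0) (at x within {r0<..})" if "x \<in> {r0<..}" for x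
    proof -
      have "(V has_vector_derivative G x) (at x within {r0<..})"
        by (rule has_vector_derivative_within_subset[OF dV]) (use that in auto)
      from has_vector_derivative_diff[OF this has_vector_derivative_at_within[OF dU]] that
      show ?thesis by auto
    qed
    then obtain c where c: "\<And>x. x \<in> {r0<..} \<Longrightarrow> V x - U x = c"
      using has_vector_derivative_zero_constant[of "{r0<..}" "\<lambda>r. V r - U r"] by auto
    have "c = 0" using c[of r1] by (simp add: V_def r1_def)
    then show ?thesis using c[of r] that by simp
  qed
  define F where "F r = inverse (r ^ m) *\<^sub>R V r" for r
  define F' where "F' r = inverse (r ^ m) *\<^sub>R G r + (- (m / r * inverse (r ^ m))) *\<^sub>R V r" for r
  have cV: "continuous_on {r0..} V"
    using dV by (auto simp: continuous_on_eq_continuous_within intro: has_vector_derivative_continuous)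
  show ?thesis
    unfolding robin_condition_at_def
  proof (intro exI conjI allI impI)
    fix r assume "r0 < r"
    then show "F r = f r" using \<open>0 < r0\<close> VU[of r] by (simp add: F_def U_def scaleR_conv_of_real)
  next
    fix r assume "r0 \<le> r"
    then have "0 < r" using \<open>0 < r0\<close> by simp
    have "((\<lambda>r. inverse (r ^ m)) has_real_derivative - (inverse (r ^ m) * (m * r ^ (m - 1)) * inverse (r ^ m))) (at r within {r0..})"
      using \<open>0 < r\<close> by (auto intro!: derivative_eq_intros)
    moreover have "inverse (r ^ m) * (m * r ^ (m - 1)) * inverse (r ^ m) = m / r * inverse (r ^ m)"
      using \<open>0 < r\<close> by (cases m) (auto simp: field_simps)
    ultimately have "((\<lambda>r. inverse (r ^ m)) has_real_derivative - (m / r * inverse (r ^ m))) (at r within {r0..})" by simp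
    from has_vector_derivative_scaleR[OF this dV[OF \<open>r0 \<le> r\<close>]]
    show "(F has_vector_derivative F' r) (at r within {r0..})" by (simp add: F_def[abs_def] F'_def)
  next
    show "continuous_on {r0..} F'"
      unfolding F'_def using \<open>0 < r0\<close> by (intro continuous_intros cG cV) auto
  next
    have "r0 * (m / r0 * inverse (r0 ^ m)) = m * inverse (r0 ^ m)" using \<open>0 < r0\<close> by simp
    then show "of_real r0 * F' r0 + of_real (real m) * F r0 = 0"
      using \<open>0 < r0\<close> by (simp add: F'_def F_def G_def scaleR_conv_of_real)
  qed
qed

section \<open>Behaviour at infinity on short time intervals\<close>

context stokes_field begin

text \<open>For each time the velocity is bounded on \<open>R0 \<le> |x|\<close>, because it is continuous there and
  converges at infinity. The times at which it is bounded by a given \<open>n\<close> form a closed set, and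
  these sets exhaust the interval, so by Baire's theorem one of them contains an interval.\<close>

lemma velocity_bounded_on_subinterval:
  assumes far: "\<And>x. R0 \<le> norm x \<Longrightarrow> x \<in> \<Omega>" and ab: "0 < a" "a < b"
  obtains s1 s2 m where "a \<le> s1" "s1 < s2" "s2 \<le> b"
    "\<And>t x. t \<in> {s1..s2} \<Longrightarrow> R0 \<le> norm x \<Longrightarrow> norm (v t x) \<le> m"
proof (rule ccontr)
  assume neg: "\<not> thesis"
  note obt = that
  have no: "\<not> (\<forall>t\<in>{s1..s2}. \<forall>x. R0 \<le> norm x \<longrightarrow> norm (v t x) \<le> m)" if "a \<le> s1" "s1 < s2" "s2 \<le> b" for s1 s2 m
    using neg obt[of s1 s2 m] that by blast
  define F where "F n = {t \<in> {a..b}. \<forall>x. R0 \<le> norm x \<longrightarrow> norm (v t x) \<le> real n}" for n :: nat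
  have clF: "closed (F n)" for n
  proof -
    have "F n = {a..b} \<inter> (\<Inter>x\<in>{x. R0 \<le> norm x}. {t \<in> {a..b}. norm (v t x) \<le> real n})"
      by (auto simp: F_def)
    moreover have "closed {t \<in> {a..b}. norm (v t x) \<le> real n}" if "R0 \<le> norm x" for x
      by (intro continuous_on_closed_Collect_le continuous_intros cont_on_param[OF cont_v])
        (use far that ab in auto)
    ultimately show ?thesis by (auto intro!: closed_Int closed_INT)
  qed
  have bdd: "\<exists>n. t \<in> F n" if t: "t \<in> {a..b}" for t
  proof -
    have "0 < t" using t ab by auto
    have "\<forall>\<^sub>F x in at_infinity. norm (v t x - v_inf) < 1"
      using tendstoD[OF v_infinity[OF \<open>0 < t\<close>], of 1] by (simp add: dist_norm)
    then obtain R1 where R1: "\<And>x. R1 \<le> norm x \<Longrightarrow> norm (v t x - v_inf) < 1"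
      unfolding eventually_at_infinity by blast
    have sub: "{x. R0 \<le> norm x} \<inter> cball 0 R1 \<subseteq> \<Omega>" using far by auto
    have "closed {x :: complex. R0 \<le> norm x}" by (intro closed_Collect_le continuous_intros)
    then have "compact (v t ` ({x. R0 \<le> norm x} \<inter> cball 0 R1))"
      by (intro compact_continuous_image continuous_on_subset[OF cont_slice[OF cont_v \<open>0 < t\<close>] sub] closed_Int_compact) auto
    then obtain m where m: "\<And>x. R0 \<le> norm x \<Longrightarrow> norm x \<le> R1 \<Longrightarrow> norm (v t x) \<le> m"
      unfolding compact_eq_bounded_closed bounded_iff by force
    obtain n :: nat where n: "max m (norm v_inf + 1) \<le> real n" using real_arch_simple by blast
    have "norm (v t x) \<le> real n" if "R0 \<le> norm x" for x
    proof (cases "norm x \<le> R1")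
      case True then show ?thesis using m[OF that True] n by linarith
    next
      case False
      then have "norm (v t x) \<le> norm v_inf + 1"
        using R1[of x] norm_triangle_sub[of "v t x" v_inf] by linarith
      then show ?thesis using n by linarith
    qed
    then show ?thesis using t by (auto simp: F_def)
  qed
  have "{a..b} \<subseteq> closure (\<Inter> (range (\<lambda>n. {a..b} - F n)))"
  proof (rule Baire)
    fix T assume "T \<in> range (\<lambda>n. {a..b} - F n)"
    then obtain n where T: "T = {a..b} - F n" by blast
    have "openin (top_of_set {a..b}) T"
      unfolding T by (intro openin_diff openin_subtopology_self closed_subset clF) (auto simp: F_def)
    moreover have "t \<in> closure T" if t: "t \<in> {a..b}" for t
      unfolding closure_approachable
    proof (intro allI impI)
      fix e :: real assume "e > 0"
      have "a \<le> max a (t - e/2)" "max a (t - e/2) < min b (t + e/2)" "min b (t + e/2) \<le> b"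
        using t ab \<open>e > 0\<close> by auto
      from no[OF this, of "real n"] obtain y x where "y \<in> {max a (t - e/2)..min b (t + e/2)}" "R0 \<le> norm x" "\<not> norm (v y x) \<le> real n"
        by blast
      then have "y \<in> {max a (t - e/2)..min b (t + e/2)}" "y \<notin> F n" by (auto simp: F_def)
      then have "y \<in> T" "dist y t < e" using \<open>e > 0\<close> unfolding T by (auto simp: dist_real_def)
      then show "\<exists>y\<in>T. dist y t < e" by blast
    qed
    ultimately show "openin (top_of_set {a..b}) T \<and> {a..b} \<subseteq> closure T" by blast
  qed auto
  moreover have "\<Inter> (range (\<lambda>n. {a..b} - F n)) = {}" using bdd by auto
  ultimately have "{a..b} \<subseteq> closure {}" by (simp only:)
  then show False using ab by simp
qed

text \<open>The estimate of \<open>time_integral_h_bound\<close> on balls whose radius is a fixed fraction of \<open>|z|\<close>.\<close>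

lemma time_integral_h_decay:
  assumes far: "\<And>x. R0 \<le> norm x \<Longrightarrow> x \<in> \<Omega>" and s: "0 < s1" "s1 \<le> s2"
    and bd: "\<And>t x. t \<in> {s1..s2} \<Longrightarrow> R0 \<le> norm x \<Longrightarrow> norm (v t x) \<le> m"
  shows "((\<lambda>z. integral {s1..s2} (\<lambda>t. h t z)) \<longlongrightarrow> 0) at_infinity"
proof (rule tendstoI)
  fix e :: real assume "e > 0"
  have "((\<lambda>x. v s2 x - v s1 x) \<longlongrightarrow> v_inf - v_inf) at_infinity"
    using s by (intro tendsto_diff v_infinity) auto
  from tendstoD[OF this, of "e / 8"] have "\<forall>\<^sub>F x in at_infinity. norm (v s2 x - v s1 x) < e / 8"
    using \<open>e > 0\<close> by (simp add: dist_norm)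
  then obtain R1 where R1: "\<And>x. R1 \<le> norm x \<Longrightarrow> norm (v s2 x - v s1 x) < e / 8"
    unfolding eventually_at_infinity by blast
  define M where "M = \<bar>m\<bar> * (s2 - s1)"
  have "M \<ge> 0" using s by (simp add: M_def)
  \<comment> \<open>With \<open>R = |z| / 4\<close> the ball of radius \<open>2 R\<close> about \<open>z\<close> stays at distance \<open>|z| / 2\<close> from the origin.\<close>
  define N where "N = Max {1, 2 * R0, 2 * R1, 256 * M / e + 1}"
  have N: "1 \<le> N" "2 * R0 \<le> N" "2 * R1 \<le> N" "256 * M / e + 1 \<le> N" by (auto simp: N_def)
  show "\<forall>\<^sub>F z in at_infinity. dist (integral {s1..s2} (\<lambda>t. h t z)) 0 < e"
    unfolding eventually_at_infinity
  proof (intro exI allI impI)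
    fix z :: complex assume z: "N \<le> norm z"
    define R where "R = norm z / 4"
    have z1: "1 \<le> norm z" "0 < norm z" using z N by linarith+
    have "R > 0" using z1 by (simp add: R_def)
    have big: "norm z / 2 \<le> norm x" if "x \<in> ball z (2 * R)" for x
      using that norm_triangle_sub[of z x] by (simp add: R_def dist_norm)
    have "norm (integral {s1..s2} (\<lambda>t. h t z)) \<le> 4 * (e / 8) + 8 * \<bar>m\<bar> * (s2 - s1) / R\<^sup>2"
    proof (rule time_integral_h_bound[OF s _ \<open>R > 0\<close>])
      show "ball z (2 * R) \<subseteq> \<Omega>" using far big z N by force
      show "norm (v t x) \<le> \<bar>m\<bar>" if "t \<in> {s1..s2}" "x \<in> ball z (2 * R)" for t x
        using bd[OF that(1), of x] big[OF that(2)] z N by linarith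
      show "norm (v s2 x - v s1 x) \<le> e / 8" if "x \<in> ball z (2 * R)" for x
        using R1[of x] big[OF that] z N by linarith
    qed
    also have "8 * \<bar>m\<bar> * (s2 - s1) / R\<^sup>2 = 128 * M / (norm z)\<^sup>2"
      by (simp add: R_def M_def power_divide)
    also have "128 * M / (norm z)\<^sup>2 \<le> 128 * M / norm z"
      using z1 \<open>M \<ge> 0\<close> mult_left_mono[of 1 "norm z" "norm z"]
      by (intro divide_left_mono) (auto simp: power2_eq_square intro!: mult_pos_pos)
    also have "128 * M / norm z < e / 2"
    proof -
      have "256 * M / e < norm z" using z N by linarith
      then have "256 * M < norm z * e" using \<open>e > 0\<close> by (simp add: pos_divide_less_eq)
      then show ?thesis using z1 by (simp add: field_simps)
    qed
    finally show "dist (integral {s1..s2} (\<lambda>t. h t z)) 0 < e" by simp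
  qed
qed

end

context exterior_conformal begin

lemma deriv_\<Psi>_bounded_at_infinity:
  obtains R D where "R > r0" "\<And>z :: complex. R \<le> norm z \<Longrightarrow> norm (deriv \<Psi> z) \<le> D"
proof -
  have "\<forall>\<^sub>F z in at_infinity. norm (\<Psi> z / z - 1) < 1"
    using tendstoD[OF \<Psi>_inf, of 1] by (simp add: dist_norm)
  then obtain R0 where R0: "\<And>z. R0 \<le> norm z \<Longrightarrow> norm (\<Psi> z / z - 1) < 1"
    unfolding eventually_at_infinity by blast
  define R where "R = 2 * \<bar>R0\<bar> + 3 * r0"
  have R: "R > r0" "2 * R0 \<le> R" "2 * r0 < R" using r0 by (auto simp: R_def)
  have le2: "norm (\<Psi> w) \<le> 2 * norm w" if "R0 \<le> norm w" "w \<noteq> 0" for w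
  proof -
    have "norm (\<Psi> w / w) \<le> 2" using R0[OF that(1)] norm_triangle_sub[of "\<Psi> w / w" 1] by simp
    then show ?thesis using that(2) by (simp add: norm_divide pos_divide_le_eq)
  qed
  show ?thesis
  proof
    show "R > r0" by fact
    fix z :: complex assume z: "R \<le> norm z"
    have "norm z > 0" using z R r0 by linarith
    have near: "norm z / 2 \<le> norm w" "norm w \<le> 3 / 2 * norm z" if "dist z w \<le> norm z / 2" for w :: complex
      using that norm_triangle_sub[of z w] norm_triangle_sub[of w z] by (simp_all add: dist_norm norm_minus_commute)
    have sub: "cball z (norm z / 2) \<subseteq> exterior_disc r0"
    proof
      fix w assume "w \<in> cball z (norm z / 2)"
      then have "norm z / 2 \<le> norm w" using near by simp
      then show "w \<in> exterior_disc r0" using z R by (simp add: exterior_disc_def)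
    qed
    have "norm ((deriv ^^ 1) \<Psi> z) \<le> fact 1 * (3 * norm z) / (norm z / 2) ^ 1"
    proof (rule Cauchy_inequality)
      show "\<Psi> holomorphic_on ball z (norm z / 2)" using hol_\<Psi> sub ball_subset_cball by (meson holomorphic_on_subset order_trans)
      show "continuous_on (cball z (norm z / 2)) \<Psi>" using continuous_on_subset[OF cont_\<Psi> sub] .
      show "0 < norm z / 2" using \<open>norm z > 0\<close> by simp
      fix w assume "norm (z - w) = norm z / 2"
      then have "dist z w \<le> norm z / 2" by (simp add: dist_norm)
      note w = near[OF this]
      then have "w \<noteq> 0" "R0 \<le> norm w" using \<open>norm z > 0\<close> z R by auto
      then show "norm (\<Psi> w) \<le> 3 * norm z" using le2[of w] w by linarith
    qed
    then show "norm (deriv \<Psi> z) \<le> 6" using \<open>norm z > 0\<close> by simp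
  qed
qed

end

lemma continuous_zero_of_integrals:
  fixes g :: "real \<Rightarrow> complex"
  assumes "s1 < s2" and cg: "continuous_on {s1..s2} g"
    and zero: "\<And>u. u \<in> {s1..s2} \<Longrightarrow> integral {s1..u} g = 0" and t: "t \<in> {s1..s2}"
  shows "g t = 0"
proof -
  have "((\<lambda>u. integral {s1..u} g) has_vector_derivative g t) (at t within {s1..s2})"
    by (rule integral_has_vector_derivative[OF cg t])
  moreover have "((\<lambda>u. integral {s1..u} g) has_vector_derivative 0) (at t within {s1..s2})"
    by (rule has_vector_derivative_transform[OF t _ has_vector_derivative_const[of 0]]) (simp add: zero)
  ultimately show ?thesis
    by (rule vector_derivative_unique_within[rotated]) (use \<open>s1 < s2\<close> t in \<open>simp add: trivial_limit_within islimpt_Icc\<close>)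
qed

section \<open>Fourier coefficients of the pressure gradient\<close>

text \<open>A Stokes field in the exterior domain whose time derivative is continuous up to the boundary and
  vanishes there.\<close>

locale stokes_exterior = stokes_field \<Omega> v v1 v2 vt \<kappa> h \<omega> p v_inf + rectifiable_exterior \<Omega> J r0 \<Phi> \<Psi> g K
  for \<Omega> J :: "complex set" and r0 :: real and \<Phi> \<Psi> :: "complex \<Rightarrow> complex" and g :: "real \<Rightarrow> complex" and K :: real
    and v v1 v2 vt \<kappa> h :: "real \<Rightarrow> complex \<Rightarrow> complex" and \<omega> p :: "real \<Rightarrow> complex \<Rightarrow> real" and v_inf :: complex +
  fixes R0 :: real
  assumes far: "\<And>x. R0 \<le> norm x \<Longrightarrow> x \<in> \<Omega>"
    and cont_vt_closure: "\<And>t. 0 < t \<Longrightarrow> continuous_on (closure \<Omega>) (vt t)"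
    and vt_boundary: "\<And>t q. 0 < t \<Longrightarrow> q \<in> J \<Longrightarrow> vt t q = 0"
begin

lemma open_ext: "open (exterior_disc r0)"
  unfolding exterior_disc_def by (intro open_Collect_less continuous_intros)

lemma in_ext: "r0 < r \<Longrightarrow> circ r \<phi> \<in> exterior_disc r0"
  using r0 by (simp add: exterior_disc_def norm_mult)

lemma \<Psi>_circle_in: "r0 < r \<Longrightarrow> \<Psi> (circ r \<phi>) \<in> \<Omega>"
  using \<Psi>_in r0 by (simp add: norm_mult)

lemma cont_deriv_\<Psi>: "continuous_on (exterior_disc r0) (deriv \<Psi>)"
  by (intro holomorphic_on_imp_continuous_on holomorphic_deriv hol_\<Psi> open_ext)

text \<open>The \<open>k\<close>-th Fourier coefficient, up to the factor \<open>2 \<pi>\<close>, of \<open>2 z \<partial>z (p \<circ> \<Psi>)\<close> on the circle of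
  radius \<open>r\<close>.\<close>

definition pressure_coeff :: "int \<Rightarrow> real \<Rightarrow> real \<Rightarrow> complex" where
  "pressure_coeff k t r = integral {0..2 * pi} (\<lambda>\<phi>. h t (\<Psi> (circ r \<phi>)) * deriv \<Psi> (circ r \<phi>)
      * (circ r \<phi>) * mode k \<phi>)"

text \<open>The function \<open>F z = h t (\<Psi> z) * deriv \<Psi> z * z\<close> is holomorphic, so its \<open>k\<close>-th coefficient \<open>c\<close>
  satisfies \<open>r c' = k c\<close> by the third part of \<open>circle_Fourier\<close>.\<close>

lemma pressure_coeff_power:
  assumes t: "0 < t" and r: "r0 < r" "r0 < r'"
  shows "pressure_coeff (int k) t r / of_real r ^ k = pressure_coeff (int k) t r' / of_real r' ^ k"
proof -
  define F where "F z = h t (\<Psi> z) * deriv \<Psi> z * z" for z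
  have holF: "F holomorphic_on exterior_disc r0"
    unfolding F_def
    by (intro holomorphic_intros holomorphic_on_compose_gen[OF hol_\<Psi> h_holomorphic[OF t], unfolded o_def] hol_\<Psi> open_ext)
      (auto simp: exterior_disc_def \<Psi>_in)
  have d: "has_partials F (deriv F x) (\<i> * deriv F x) x" if "x \<in> exterior_disc r0" for x
  proof -
    have "(F has_field_derivative deriv F x) (at x)" by (rule holomorphic_derivI[OF holF open_ext that])
    moreover have "(*) (deriv F x) = (\<lambda>e. Re e *\<^sub>R deriv F x + Im e *\<^sub>R (\<i> * deriv F x))"
      by (rule ext) (simp add: complex_eq_iff algebra_simps)
    ultimately show ?thesis by (simp add: has_field_derivative_def)
  qed
  have cd: "continuous_on (exterior_disc r0) (deriv F)"
    by (intro holomorphic_on_imp_continuous_on holomorphic_deriv holF open_ext)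
  have I: "0 + circ \<rho> \<phi> \<in> exterior_disc r0" if "\<rho> \<in> {r0<..}" for \<rho> \<phi>
    using in_ext that by simp
  have pc: "pressure_coeff (int k) t = (\<lambda>\<rho>. integral {0..2 * pi} (\<lambda>\<phi>. F (0 + circ \<rho> \<phi>) * mode (int k) \<phi>))"
    by (rule ext) (simp add: pressure_coeff_def F_def)
  have cvx: "convex {r0<..}" by simp
  have der: "((\<lambda>\<rho>. pressure_coeff (int k) t \<rho> / of_real \<rho> ^ k) has_vector_derivative 0) (at \<rho> within {r0<..})" if \<rho>: "\<rho> \<in> {r0<..}" for \<rho>
  proof -
    note cF = circle_Fourier[where F = F and A = "deriv F" and B = "\<lambda>x. \<i> * deriv F x" and S = "exterior_disc r0" and I = "{r0<..}"
        and z = 0 and \<rho> = \<rho> and k = "int k", OF d cd continuous_on_mult_left[OF cd] open_greaterThan cvx I \<rho>]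
    define D where "D = integral {0..2 * pi} (\<lambda>\<phi>. (of_real (cos \<phi>) * deriv F (0 + circ \<rho> \<phi>)
        + of_real (sin \<phi>) * (\<i> * deriv F (0 + circ \<rho> \<phi>))) * mode (int k) \<phi>)"
    have D1: "(pressure_coeff (int k) t has_vector_derivative D) (at \<rho>)"
      unfolding pc D_def by (rule cF(1))
    have z: "deriv F x + \<i> * (\<i> * deriv F x) = 0" for x by (simp add: mult.assoc[symmetric])
    have D2: "of_real \<rho> * D - of_int (int k) * pressure_coeff (int k) t \<rho> = 0"
    proof -
      have "of_real \<rho> * D - of_int (int k) * pressure_coeff (int k) t \<rho> = integral {0..2 * pi} (\<lambda>\<phi>. circ \<rho> (- \<phi>) *
          (deriv F (0 + circ \<rho> \<phi>) + \<i> * (\<i> * deriv F (0 + circ \<rho> \<phi>))) * mode (int k) \<phi>)"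
        using cF(3) unfolding D_def pc .
      then show ?thesis unfolding z by simp
    qed
    have "0 < \<rho>" using \<rho> r0 by simp
    have Deq: "D = (k / \<rho>) *\<^sub>R pressure_coeff (int k) t \<rho>"
      using D2 \<open>0 < \<rho>\<close> by (simp add: scaleR_conv_of_real field_simps)
    have "((\<lambda>r. inverse (r ^ k)) has_real_derivative - (inverse (\<rho> ^ k) * (k * \<rho> ^ (k - 1)) * inverse (\<rho> ^ k))) (at \<rho> within {r0<..})"
      using \<open>0 < \<rho>\<close> by (auto intro!: derivative_eq_intros)
    moreover have "inverse (\<rho> ^ k) * (k * \<rho> ^ (k - 1)) * inverse (\<rho> ^ k) = k / \<rho> * inverse (\<rho> ^ k)"
      using \<open>0 < \<rho>\<close> by (cases k) (auto simp: field_simps)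
    ultimately have "((\<lambda>r. inverse (r ^ k)) has_real_derivative - (k / \<rho> * inverse (\<rho> ^ k))) (at \<rho> within {r0<..})" by simp
    from has_vector_derivative_scaleR[OF this has_vector_derivative_at_within[OF D1]]
    have "((\<lambda>\<rho>. inverse (\<rho> ^ k) *\<^sub>R pressure_coeff (int k) t \<rho>) has_vector_derivative 0) (at \<rho> within {r0<..})"
      by (simp add: Deq mult.commute)
    moreover have "inverse (\<rho> ^ k) *\<^sub>R pressure_coeff (int k) t \<rho> = pressure_coeff (int k) t \<rho> / of_real \<rho> ^ k" for \<rho>
      by (simp add: scaleR_conv_of_real divide_inverse mult.commute)
    ultimately show ?thesis by simp
  qed
  obtain c where "\<And>\<rho>. \<rho> \<in> {r0<..} \<Longrightarrow> pressure_coeff (int k) t \<rho> / of_real \<rho> ^ k = c"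
    by (rule has_vector_derivative_zero_constant[OF _ der]) auto
  then show ?thesis using r by simp
qed

lemma pressure_coeff_continuous:
  assumes "r0 < r"
  shows "continuous_on {0<..} (\<lambda>t. pressure_coeff k t r)"
proof -
  have "continuous_on ({0<..} \<times> cbox 0 (2 * pi)) (\<lambda>(t, \<phi>). h t (\<Psi> (circ r \<phi>)) * deriv \<Psi> (circ r \<phi>)
      * (circ r \<phi>) * mode k \<phi>)"
    unfolding split_def
    by (intro continuous_intros cont_on_param[OF cont_h] continuous_on_compose2[OF cont_\<Psi>] continuous_on_compose2[OF cont_deriv_\<Psi>])
      (use in_ext[OF assms] \<Psi>_circle_in[OF assms] in auto)
  from integral_continuous_on_param[OF this] show ?thesis
    by (simp add: pressure_coeff_def cbox_interval)
qed

lemma pressure_coeff_time_integral: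
  assumes r: "r0 < r" and s: "0 < s1" "s1 \<le> s2"
  shows "integral {s1..s2} (\<lambda>t. pressure_coeff k t r) = integral {0..2 * pi} (\<lambda>\<phi>. integral {s1..s2} (\<lambda>t. h t (\<Psi> (circ r \<phi>)))
     * (deriv \<Psi> (circ r \<phi>) * (circ r \<phi>) * mode k \<phi>))"
proof -
  have "integral (cbox s1 s2) (\<lambda>t. integral (cbox 0 (2 * pi)) (\<lambda>\<phi>. h t (\<Psi> (circ r \<phi>)) * deriv \<Psi> (circ r \<phi>)
      * (circ r \<phi>) * mode k \<phi>))
    = integral (cbox 0 (2 * pi)) (\<lambda>\<phi>. integral (cbox s1 s2) (\<lambda>t. h t (\<Psi> (circ r \<phi>)) * deriv \<Psi> (circ r \<phi>)
      * (circ r \<phi>) * mode k \<phi>))"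
    by (rule integral_swap_continuous, unfold split_def)
      (intro continuous_intros cont_on_param[OF cont_h] continuous_on_compose2[OF cont_\<Psi>] continuous_on_compose2[OF cont_deriv_\<Psi>],
        use in_ext[OF r] \<Psi>_circle_in[OF r] s in \<open>auto simp: cbox_Pair_eq cbox_interval\<close>)
  then show ?thesis by (simp add: pressure_coeff_def cbox_interval mult.assoc)
qed

text \<open>If the coefficient were nonzero at time \<open>t\<close>, it would be nonzero during a short interval after
  \<open>t\<close>, which contains an interval \<open>{s1..s2}\<close> on which the velocity is bounded near infinity. There
  the time integrals of the coefficient vanish: by \<open>pressure_coeff_power\<close> they may be evaluated on
  a circle of arbitrarily large radius \<open>\<rho>\<close>, where \<open>time_integral_h_decay\<close> makes them \<open>o(\<rho>)\<close>, while
  the factor of proportionality is \<open>(r / \<rho>) ^ k\<close> with \<open>k \<ge> 1\<close>.\<close>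

lemma pressure_coeff_zero:
  assumes "0 < t" "r0 < r" and "k \<ge> 1"
  shows "pressure_coeff (int k) t r = 0"
proof (rule ccontr)
  assume nz: "pressure_coeff (int k) t r \<noteq> 0"
  define c where "c t = pressure_coeff (int k) t r" for t
  have "open ({0<..} :: real set)" by simp
  then have "isCont c t"
    using pressure_coeff_continuous[OF assms(2), of "int k"] assms(1) by (simp add: continuous_on_eq_continuous_at c_def[abs_def])
  then have "\<forall>\<^sub>F s in at t. c s \<noteq> 0"
    using nz[folded c_def] by (intro tendsto_imp_eventually_ne) (auto simp: isCont_def)
  then obtain d where d: "d > 0" "\<And>s. s \<noteq> t \<Longrightarrow> dist s t < d \<Longrightarrow> c s \<noteq> 0"
    unfolding eventually_at by blast
  have td: "t < t + d / 2" using d(1) by simp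
  obtain s1 s2 m where s: "t \<le> s1" "s1 < s2" "s2 \<le> t + d / 2" and
    m: "\<And>s x. s \<in> {s1..s2} \<Longrightarrow> R0 \<le> norm x \<Longrightarrow> norm (v s x) \<le> m"
    by (rule velocity_bounded_on_subinterval[of R0 t "t + d / 2", OF far assms(1) td]) (assumption, rule that)
  have "c s2 = 0"
  proof (rule continuous_zero_of_integrals[OF s(2)])
    show "continuous_on {s1..s2} c"
      unfolding c_def by (rule continuous_on_subset[OF pressure_coeff_continuous[OF assms(2)]]) (use s assms in auto)
    show "s2 \<in> {s1..s2}" using s by simp
    fix u assume u: "u \<in> {s1..s2}"
    have s1: "0 < s1" "s1 \<le> u" using s assms u by auto
    have lim: "((\<lambda>z. integral {s1..u} (\<lambda>t. h t z)) \<longlongrightarrow> 0) at_infinity"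
      by (rule time_integral_h_decay[OF far s1, where m = m]) (use m u in auto)
    obtain R D where RD: "R > r0" "\<And>z. R \<le> norm z \<Longrightarrow> norm (deriv \<Psi> z) \<le> D"
      using deriv_\<Psi>_bounded_at_infinity by blast
    have "R \<le> norm (of_real R :: complex)" by simp
    then have "D \<ge> 0" using RD(2)[of "of_real R"] norm_ge_zero[of "deriv \<Psi> (of_real R)"] by linarith
    have "norm (integral {s1..u} c) \<le> e" if "e > 0" for e
    proof -
      \<comment> \<open>The constant absorbs the length of the circle, the bound for the derivative of \<open>\<Psi>\<close> and the factor \<open>r ^ k\<close>.\<close>
      define e' where "e' = e / (2 * pi * (D + 1) * r ^ k)"
      have "e' > 0" using \<open>e > 0\<close> \<open>D \<ge> 0\<close> assms(2) r0 by (auto simp: e'_def)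
      have "((\<lambda>z. integral {s1..u} (\<lambda>t. h t (\<Psi> z))) \<longlongrightarrow> 0) at_infinity"
        by (rule filterlim_compose[OF lim \<Psi>_to_infinity])
      from tendstoD[OF this \<open>e' > 0\<close>] obtain R' where R': "\<And>z. R' \<le> norm z \<Longrightarrow> norm (integral {s1..u} (\<lambda>t. h t (\<Psi> z))) < e'"
        unfolding eventually_at_infinity by (auto simp: dist_norm)
      define \<rho> where "\<rho> = max R' (max R 1)"
      have \<rho>: "R' \<le> \<rho>" "R \<le> \<rho>" "1 \<le> \<rho>" "r0 < \<rho>" using RD(1) by (auto simp: \<rho>_def)
      have n\<rho>: "norm (circ \<rho> \<phi>) = \<rho>" for \<phi> using \<rho> by (simp add: norm_mult)
      have "norm (integral {s1..u} (\<lambda>t. pressure_coeff (int k) t \<rho>)) \<le> (e' * (D * \<rho>)) * (2 * pi - 0)"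
        unfolding pressure_coeff_time_integral[OF \<rho>(4) s1]
      proof (rule integral_bound)
        have "continuous_on {0..2 * pi} (\<lambda>\<phi>. integral (cbox s1 u) (\<lambda>t. h t (\<Psi> (circ \<rho> \<phi>))))"
          by (intro integral_continuous_on_param)
            (use in_ext[OF \<rho>(4)] \<Psi>_circle_in[OF \<rho>(4)] s1 in \<open>auto simp: split_def cbox_interval intro!: continuous_intros cont_on_param[OF cont_h] continuous_on_compose2[OF cont_\<Psi>]\<close>)
        then show "continuous_on {0..2 * pi} (\<lambda>\<phi>. integral {s1..u} (\<lambda>t. h t (\<Psi> (circ \<rho> \<phi>)))
            * (deriv \<Psi> (circ \<rho> \<phi>) * (circ \<rho> \<phi>) * mode (int k) \<phi>))"
          by (intro continuous_intros continuous_on_compose2[OF cont_deriv_\<Psi>]) (use in_ext[OF \<rho>(4)] in \<open>auto simp: cbox_interval\<close>)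
        fix \<phi> :: real
        have "norm (integral {s1..u} (\<lambda>t. h t (\<Psi> (circ \<rho> \<phi>)))) \<le> e'"
          using R'[of "circ \<rho> \<phi>"] n\<rho> \<rho> by (simp add: less_imp_le)
        moreover have "norm (deriv \<Psi> (circ \<rho> \<phi>)) \<le> D" using RD(2)[of "circ \<rho> \<phi>"] n\<rho> \<rho> by simp
        ultimately show "norm (integral {s1..u} (\<lambda>t. h t (\<Psi> (circ \<rho> \<phi>)))
            * (deriv \<Psi> (circ \<rho> \<phi>) * (circ \<rho> \<phi>) * mode (int k) \<phi>)) \<le> e' * (D * \<rho>)"
        proof -
          assume le: "norm (integral {s1..u} (\<lambda>t. h t (\<Psi> (circ \<rho> \<phi>)))) \<le> e'" "norm (deriv \<Psi> (circ \<rho> \<phi>)) \<le> D"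
          have "norm (deriv \<Psi> (circ \<rho> \<phi>) * (circ \<rho> \<phi>) * mode (int k) \<phi>) = norm (deriv \<Psi> (circ \<rho> \<phi>)) * \<rho>"
            using \<rho> by (simp add: norm_mult)
          also have "\<dots> \<le> D * \<rho>" using le(2) \<rho> by (intro mult_right_mono) auto
          finally have le2: "norm (deriv \<Psi> (circ \<rho> \<phi>) * (circ \<rho> \<phi>) * mode (int k) \<phi>) \<le> D * \<rho>" .
          show ?thesis
            by (subst norm_mult, rule mult_mono[OF le(1) le2]) (use \<open>e' > 0\<close> in auto)
        qed
      qed simp
      also have "(e' * (D * \<rho>)) * (2 * pi - 0) \<le> (e' * ((D + 1) * \<rho> ^ k)) * (2 * pi)"
      proof -
        have "\<rho> \<le> \<rho> ^ k" using self_le_power[of \<rho> k] \<rho>(3) \<open>k \<ge> 1\<close> by simp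
        then have "D * \<rho> \<le> (D + 1) * \<rho> ^ k" using \<open>D \<ge> 0\<close> \<rho>(3) by (intro mult_mono) auto
        then have "e' * (D * \<rho>) \<le> e' * ((D + 1) * \<rho> ^ k)" using \<open>e' > 0\<close> by (intro mult_left_mono) auto
        then show ?thesis by (simp add: mult_right_mono)
      qed
      finally have 1: "norm (integral {s1..u} (\<lambda>t. pressure_coeff (int k) t \<rho>)) \<le> (e' * ((D + 1) * \<rho> ^ k)) * (2 * pi)" .
      have "c t = of_real (r ^ k / \<rho> ^ k) * pressure_coeff (int k) t \<rho>" if "t \<in> {s1..u}" for t
      proof -
        have "0 < t" using s1 that by simp
        have "c t = of_real r ^ k * (pressure_coeff (int k) t r / of_real r ^ k)" using r0 assms(2) by (simp add: c_def)
        also have "\<dots> = of_real r ^ k * (pressure_coeff (int k) t \<rho> / of_real \<rho> ^ k)"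
          by (simp only: pressure_coeff_power[OF \<open>0 < t\<close> assms(2) \<rho>(4)])
        finally show ?thesis by simp
      qed
      then have "integral {s1..u} c = integral {s1..u} (\<lambda>t. of_real (r ^ k / \<rho> ^ k) * pressure_coeff (int k) t \<rho>)"
        by (intro integral_cong)
      also have "\<dots> = of_real (r ^ k / \<rho> ^ k) * integral {s1..u} (\<lambda>t. pressure_coeff (int k) t \<rho>)" by simp
      finally have "norm (integral {s1..u} c) = (r ^ k / \<rho> ^ k) * norm (integral {s1..u} (\<lambda>t. pressure_coeff (int k) t \<rho>))"
        using r0 assms(2) \<rho> by (simp add: norm_mult norm_divide norm_power)
      also have "\<dots> \<le> (r ^ k / \<rho> ^ k) * ((e' * ((D + 1) * \<rho> ^ k)) * (2 * pi))"
        using 1 r0 assms(2) \<rho> by (intro mult_left_mono) auto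
      also have "\<dots> = e' * (2 * pi * (D + 1) * r ^ k)" using \<rho> by (simp add: mult_ac)
      also have "\<dots> = e" using r0 assms(2) \<open>D \<ge> 0\<close> unfolding e'_def by simp
      finally show ?thesis .
    qed
    then have "norm (integral {s1..u} c) \<le> 0" by (rule field_le_epsilon) (simp only: add_0)
    then show "integral {s1..u} c = 0" by simp
  qed
  moreover have "c s2 \<noteq> 0" using d s by (intro d(2)) (auto simp: dist_real_def)
  ultimately show False by simp
qed

text \<open>The imaginary part is minus the increment of \<open>p t \<circ> \<Psi>\<close> around the circle.\<close>

lemma pressure_mean_real:
  assumes t: "0 < t" and r: "r0 < r"
  shows "Im (pressure_coeff 0 t r) = 0"
proof -
  let ?z = "\<lambda>\<phi>. circ r \<phi> :: complex"
  have "((\<lambda>\<phi>. - Im (h t (\<Psi> (?z \<phi>)) * deriv \<Psi> (?z \<phi>) * ?z \<phi>)) has_integral p t (\<Psi> (?z (2 * pi))) - p t (\<Psi> (?z 0))) {0..2 * pi}"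
  proof (rule fundamental_theorem_of_calculus)
    fix \<phi> :: real
    have "((\<lambda>\<phi>. \<Psi> (?z \<phi>)) has_vector_derivative of_real r * (\<i> * cis \<phi>) * deriv \<Psi> (?z \<phi>)) (at \<phi> within {0..2 * pi})"
      by (rule has_vector_derivative_at_within[OF circle_map_derivative]) (use r r0 in simp)
    note chain = vector_derivative_diff_chain_within[OF this has_derivative_at_withinI[OF p_deriv[OF t \<Psi>_circle_in[OF r]]]]
    have eq: "h t (\<Psi> (?z \<phi>)) * (of_real r * (\<i> * cis \<phi>) * deriv \<Psi> (?z \<phi>)) = \<i> * (h t (\<Psi> (?z \<phi>)) * deriv \<Psi> (?z \<phi>) * ?z \<phi>)"
      by (simp only: mult_ac)
    show "((\<lambda>\<phi>. p t (\<Psi> (?z \<phi>))) has_vector_derivative - Im (h t (\<Psi> (?z \<phi>)) * deriv \<Psi> (?z \<phi>) * ?z \<phi>)) (at \<phi> within {0..2 * pi})"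
      using chain unfolding eq by (simp add: o_def)
  qed simp
  then have 0: "integral {0..2 * pi} (\<lambda>\<phi>. - Im (h t (\<Psi> (?z \<phi>)) * deriv \<Psi> (?z \<phi>) * ?z \<phi>)) = 0"
    by (simp add: integral_unique)
  have int: "(\<lambda>\<phi>. h t (\<Psi> (?z \<phi>)) * deriv \<Psi> (?z \<phi>) * ?z \<phi>) integrable_on {0..2 * pi}"
    by (intro integrable_continuous_real continuous_intros cont_on_param[OF cont_h] continuous_on_compose2[OF cont_\<Psi>] continuous_on_compose2[OF cont_deriv_\<Psi>])
      (use in_ext[OF r] \<Psi>_circle_in[OF r] t in auto)
  have "integral {0..2 * pi} (\<lambda>\<phi>. Im (h t (\<Psi> (?z \<phi>)) * deriv \<Psi> (?z \<phi>) * ?z \<phi>)) = Im (pressure_coeff 0 t r)"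
    using integral_linear[OF int bounded_linear_Im] by (simp add: pressure_coeff_def o_def)
  moreover have "- integral {0..2 * pi} (\<lambda>\<phi>. Im (h t (\<Psi> (?z \<phi>)) * deriv \<Psi> (?z \<phi>) * ?z \<phi>)) = 0"
    using 0 by (simp only: integral_neg)
  ultimately show ?thesis by simp
qed

section \<open>The Robin condition for the vorticity\<close>

lemma vt_small_near_boundary:
  assumes t: "0 < t" and "e > 0"
  obtains r where "r0 < r" "\<And>z. r0 < norm z \<Longrightarrow> norm z < r \<Longrightarrow> norm (vt t (\<Psi> z)) < e"
proof -
  obtain m where m: "\<And>q. q \<in> J \<Longrightarrow> norm q \<le> m"
    using compact_imp_bounded[OF compact_J] unfolding bounded_iff by blast
  let ?K = "closure \<Omega> \<inter> cball 0 (m + 1)"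
  have "uniformly_continuous_on ?K (vt t)"
    by (intro compact_uniformly_continuous continuous_on_subset[OF cont_vt_closure[OF t]] closed_Int_compact) auto
  then obtain d where d: "d > 0" "\<And>x y. x \<in> ?K \<Longrightarrow> y \<in> ?K \<Longrightarrow> dist y x < d \<Longrightarrow> dist (vt t y) (vt t x) < e"
    using \<open>e > 0\<close> unfolding uniformly_continuous_on_def by metis
  obtain r where r: "r0 < r" "\<And>z. r0 < norm z \<Longrightarrow> norm z < r \<Longrightarrow> \<exists>q\<in>J. dist (\<Psi> z) q < min d 1"
    using \<Psi>_near_J[of "min d 1"] d(1) by auto
  show ?thesis
  proof
    show "r0 < r" by fact
    fix z :: complex assume z: "r0 < norm z" "norm z < r"
    obtain q where q: "q \<in> J" "dist (\<Psi> z) q < min d 1" using r(2)[OF z] by blast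
    have "norm (\<Psi> z) \<le> m + 1"
      using m[OF q(1)] q(2) norm_triangle_sub[of "\<Psi> z" q] by (simp add: dist_norm)
    then have "\<Psi> z \<in> ?K" "q \<in> ?K"
      using \<Psi>_in[OF z(1)] q(1) m[OF q(1)] closure_\<Omega> by auto
    then show "norm (vt t (\<Psi> z)) < e"
      using d(2)[of q "\<Psi> z"] q vt_boundary[OF t q(1)] by (simp add: dist_norm)
  qed
qed

text \<open>The part of \<open>2 z \<partial>z (\<omega> \<circ> \<Psi>)\<close> that comes from the time derivative of the velocity, again up to \<open>2
  \<pi>\<close> and a factor \<open>i\<close>.\<close>

definition flux_coeff :: "int \<Rightarrow> real \<Rightarrow> real \<Rightarrow> complex" where
  "flux_coeff k t r = integral {0..2 * pi} (\<lambda>\<phi>. cnj (vt t (\<Psi> (circ r \<phi>))) * deriv \<Psi> (circ r \<phi>)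
      * (circ r \<phi>) * mode k \<phi>)"

lemma flux_integrand_continuous:
  assumes "0 < t" "r0 < r"
  shows "continuous_on {0..2 * pi} (\<lambda>\<phi>. cnj (vt t (\<Psi> (circ r \<phi>))) * deriv \<Psi> (circ r \<phi>)
      * (circ r \<phi>) * mode k \<phi>)"
  by (intro continuous_intros cont_on_param[OF cont_vt] continuous_on_compose2[OF cont_\<Psi>] continuous_on_compose2[OF cont_deriv_\<Psi>])
    (use in_ext[OF assms(2)] \<Psi>_circle_in[OF assms(2)] assms(1) in auto)

lemma flux_coeff_continuous:
  assumes "0 < t"
  shows "continuous_on {r0<..} (flux_coeff k t)"
proof -
  have "continuous_on ({r0<..} \<times> cbox 0 (2 * pi)) (\<lambda>(r, \<phi>). cnj (vt t (\<Psi> (circ r \<phi>))) * deriv \<Psi> (circ r \<phi>)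
      * (circ r \<phi>) * mode k \<phi>)"
    unfolding split_def
    by (intro continuous_intros cont_on_param[OF cont_vt] continuous_on_compose2[OF cont_\<Psi>] continuous_on_compose2[OF cont_deriv_\<Psi>])
      (use in_ext \<Psi>_circle_in assms in auto)
  from integral_continuous_on_param[OF this] show ?thesis
    by (simp add: flux_coeff_def[abs_def] cbox_interval)
qed

text \<open>The velocity factor tends to \<open>0\<close> uniformly by the no-slip condition, while the integral of the
  modulus of the derivative of \<open>\<Psi>\<close> stays bounded.\<close>

lemma flux_coeff_tendsto:
  assumes t: "0 < t"
  shows "(flux_coeff k t \<longlongrightarrow> 0) (at_right r0)"
proof (rule tendstoI)
  fix e :: real assume "e > 0"
  obtain C where C: "\<And>r. r0 < r \<Longrightarrow> r < r0 + 1 \<Longrightarrow> integral {0..2 * pi} (\<lambda>\<phi>. r * norm (deriv \<Psi> (circ r \<phi>))) \<le> C"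
    using integral_means_bounded[of "r0 + 1"] by auto
  define e' where "e' = e / (\<bar>C\<bar> + 1)"
  have "e' > 0" using \<open>e > 0\<close> by (simp add: e'_def)
  obtain r1 where r1: "r0 < r1" "\<And>z. r0 < norm z \<Longrightarrow> norm z < r1 \<Longrightarrow> norm (vt t (\<Psi> z)) < e'"
    using vt_small_near_boundary[OF t \<open>e' > 0\<close>] by blast
  have "norm (flux_coeff k t r) < e" if r: "r0 < r" "r < min r1 (r0 + 1)" for r
  proof -
    have "0 < r" using r r0 by simp
    have cd: "continuous_on {0..2 * pi} (\<lambda>\<phi>. deriv \<Psi> (circ r \<phi>))"
      by (intro continuous_intros continuous_on_compose2[OF cont_deriv_\<Psi>]) (use in_ext[OF r(1)] in auto)
    have "norm (flux_coeff k t r) \<le> integral {0..2 * pi} (\<lambda>\<phi>. e' * (r * norm (deriv \<Psi> (circ r \<phi>))))"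
      unfolding flux_coeff_def
    proof (rule integral_norm_bound_integral)
      show "(\<lambda>\<phi>. cnj (vt t (\<Psi> (circ r \<phi>))) * deriv \<Psi> (circ r \<phi>)
          * (circ r \<phi>) * mode k \<phi>) integrable_on {0..2 * pi}"
        by (intro integrable_continuous_real flux_integrand_continuous t r)
      show "(\<lambda>\<phi>. e' * (r * norm (deriv \<Psi> (circ r \<phi>)))) integrable_on {0..2 * pi}"
        by (intro integrable_continuous_real continuous_intros cd)
      fix \<phi> :: real
      have "norm (vt t (\<Psi> (circ r \<phi>))) \<le> e'"
        using r1(2)[of "circ r \<phi>"] r \<open>0 < r\<close> by (simp add: norm_mult)
      then show "norm (cnj (vt t (\<Psi> (circ r \<phi>))) * deriv \<Psi> (circ r \<phi>)
          * (circ r \<phi>) * mode k \<phi>) \<le> e' * (r * norm (deriv \<Psi> (circ r \<phi>)))"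
        using \<open>0 < r\<close> mult_right_mono[of "norm (vt t (\<Psi> (circ r \<phi>)))" e' "r * norm (deriv \<Psi> (circ r \<phi>))"]
        by (simp add: norm_mult mult_ac)
    qed
    also have "\<dots> = e' * integral {0..2 * pi} (\<lambda>\<phi>. r * norm (deriv \<Psi> (circ r \<phi>)))" by (rule integral_mult_right)
    also have "\<dots> \<le> e' * C" using C[of r] r \<open>e' > 0\<close> by (intro mult_left_mono) auto
    also have "\<dots> \<le> e' * \<bar>C\<bar>" using \<open>e' > 0\<close> by (intro mult_left_mono) auto
    also have "\<dots> < e' * (\<bar>C\<bar> + 1)" using \<open>e' > 0\<close> by (intro mult_strict_left_mono) auto
    also have "\<dots> = e" by (simp add: e'_def)
    finally show ?thesis .
  qed
  then show "\<forall>\<^sub>F r in at_right r0. dist (flux_coeff k t r) 0 < e"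
    unfolding eventually_at_right_field using r1(1) by (intro exI[of _ "min r1 (r0 + 1)"]) auto
qed

definition vorticity_coeff :: "int \<Rightarrow> real \<Rightarrow> real \<Rightarrow> complex" where
  "vorticity_coeff k t r = integral {0..2 * pi} (\<lambda>\<phi>. of_real (\<omega> t (\<Psi> (circ r \<phi>))) * mode k \<phi>)"

text \<open>The second part of \<open>circle_Fourier\<close> for \<open>\<omega> \<circ> \<Psi>\<close>, with the Stokes equation in the form \<open>\<kappa> = i
  (cnj vt - h)\<close>.\<close>

lemma vorticity_coeff_derivative:
  assumes t: "0 < t" and r: "r0 < r"
  obtains D where "(vorticity_coeff k t has_vector_derivative D) (at r)"
    "of_real r * D + of_int k * vorticity_coeff k t r = \<i> * (flux_coeff k t r - pressure_coeff k t r)"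
    "k = 0 \<Longrightarrow> Im D = 0"
proof -
  define Kp where "Kp z = \<kappa> t (\<Psi> z) * deriv \<Psi> z" for z
  let ?A = "\<lambda>z. of_real (Re (Kp z)) :: complex" and ?B = "\<lambda>z. of_real (- Im (Kp z)) :: complex"
  let ?F = "\<lambda>z. of_real (\<omega> t (\<Psi> z)) :: complex"
  have d: "has_partials ?F (?A z) (?B z) z" if z: "z \<in> exterior_disc r0" for z
  proof -
    have "\<Psi> z \<in> \<Omega>" using \<Psi>_in z by (simp add: exterior_disc_def)
    have "(\<Psi> has_derivative (*) (deriv \<Psi> z)) (at z)"
      using holomorphic_derivI[OF hol_\<Psi> open_ext z] by (simp add: has_field_derivative_def)
    from has_derivative_compose[OF this \<omega>_deriv[OF t \<open>\<Psi> z \<in> \<Omega>\<close>]]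
    have "((\<lambda>z. \<omega> t (\<Psi> z)) has_derivative (\<lambda>e. Re (Kp z * e))) (at z)" by (simp add: Kp_def mult.assoc)
    from bounded_linear.has_derivative[OF bounded_linear_of_real this]
    have "(?F has_derivative (\<lambda>e. of_real (Re (Kp z * e)))) (at z)" .
    moreover have "(\<lambda>e. of_real (Re (Kp z * e)) :: complex) = (\<lambda>e. Re e *\<^sub>R ?A z + Im e *\<^sub>R ?B z)"
      by (rule ext) (simp add: complex_eq_iff algebra_simps)
    ultimately show ?thesis by simp
  qed
  have cK: "continuous_on (exterior_disc r0) Kp"
    unfolding Kp_def
    by (intro continuous_intros cont_deriv_\<Psi> continuous_on_compose2[OF cont_slice[OF cont_\<kappa> t] cont_\<Psi>]) (auto simp: exterior_disc_def \<Psi>_in)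
  have cA: "continuous_on (exterior_disc r0) ?A" "continuous_on (exterior_disc r0) ?B"
    by (intro continuous_intros cK)+
  have I: "0 + circ \<rho> \<phi> \<in> exterior_disc r0" if "\<rho> \<in> {r0<..}" for \<rho> \<phi>
    using in_ext that by simp
  have cvx: "convex {r0<..}" by simp
  have rI: "r \<in> {r0<..}" using r by simp
  note cF = circle_Fourier[where F = ?F and A = ?A and B = ?B and S = "exterior_disc r0" and I = "{r0<..}"
        and z = 0 and \<rho> = r and k = k, OF d cA open_greaterThan cvx I rI]
  define D where "D = integral {0..2 * pi} (\<lambda>\<phi>. (of_real (cos \<phi>) * ?A (0 + circ r \<phi>)
        + of_real (sin \<phi>) * ?B (0 + circ r \<phi>)) * mode k \<phi>)"
  have pc: "vorticity_coeff k t = (\<lambda>\<rho>. integral {0..2 * pi} (\<lambda>\<phi>. ?F (0 + circ \<rho> \<phi>) * mode k \<phi>))"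
    by (rule ext) (simp add: vorticity_coeff_def)
  show ?thesis
  proof
    show "(vorticity_coeff k t has_vector_derivative D) (at r)"
      unfolding pc D_def by (rule cF(1))
    have "of_real r * D + of_int k * vorticity_coeff k t r = integral {0..2 * pi} (\<lambda>\<phi>. circ r \<phi> *
          (?A (0 + circ r \<phi>) - \<i> * ?B (0 + circ r \<phi>)) * mode k \<phi>)"
      using cF(2) unfolding D_def pc .
    also have "\<dots> = integral {0..2 * pi} (\<lambda>\<phi>. \<i> * (cnj (vt t (\<Psi> (circ r \<phi>))) * deriv \<Psi> (circ r \<phi>)
      * (circ r \<phi>) * mode k \<phi> - h t (\<Psi> (circ r \<phi>)) * deriv \<Psi> (circ r \<phi>)
      * (circ r \<phi>) * mode k \<phi>))"
    proof (rule integral_cong)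
      fix \<phi> :: real
      let ?z = "circ r \<phi> :: complex"
      have 1: "?A (0 + ?z) - \<i> * ?B (0 + ?z) = Kp ?z" by (simp add: complex_eq_iff)
      have "h t (\<Psi> ?z) = cnj (vt t (\<Psi> ?z)) + \<i> * \<kappa> t (\<Psi> ?z)" by (rule h_eq[OF t \<Psi>_circle_in[OF r]])
      then have 2: "\<kappa> t (\<Psi> ?z) = \<i> * (cnj (vt t (\<Psi> ?z)) - h t (\<Psi> ?z))" by (simp add: complex_eq_iff)
      show "?z * (?A (0 + ?z) - \<i> * ?B (0 + ?z)) * mode k \<phi>
        = \<i> * (cnj (vt t (\<Psi> ?z)) * deriv \<Psi> ?z * ?z * mode k \<phi> - h t (\<Psi> ?z) * deriv \<Psi> ?z * ?z * mode k \<phi>)"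
        unfolding 1 unfolding Kp_def 2 by (simp only: right_diff_distrib left_diff_distrib mult_ac)
    qed
    also have "\<dots> = \<i> * (flux_coeff k t r - pressure_coeff k t r)"
    proof -
      have "(\<lambda>\<phi>. h t (\<Psi> (circ r \<phi>)) * deriv \<Psi> (circ r \<phi>)
          * (circ r \<phi>) * mode k \<phi>) integrable_on {0..2 * pi}"
        by (intro integrable_continuous_real continuous_intros cont_on_param[OF cont_h] continuous_on_compose2[OF cont_\<Psi>] continuous_on_compose2[OF cont_deriv_\<Psi>])
          (use in_ext[OF r] \<Psi>_circle_in[OF r] t in auto)
      from integral_diff[OF integrable_continuous_real[OF flux_integrand_continuous[OF t r, of k]] this]
      show ?thesis unfolding flux_coeff_def pressure_coeff_def by (simp only: integral_mult_right)
    qed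
    finally show "of_real r * D + of_int k * vorticity_coeff k t r = \<i> * (flux_coeff k t r - pressure_coeff k t r)" .
    assume "k = 0"
    have cAz: "continuous_on {0..2 * pi} (\<lambda>\<phi>. Re (Kp (0 + circ r \<phi>)))" "continuous_on {0..2 * pi} (\<lambda>\<phi>. Im (Kp (0 + circ r \<phi>)))"
      by (intro continuous_intros continuous_on_compose2[OF cK]; use in_ext[OF r] in auto)+
    have int: "(\<lambda>\<phi>. cos \<phi> * Re (Kp (0 + circ r \<phi>)) + sin \<phi> * (- Im (Kp (0 + circ r \<phi>)))) integrable_on {0..2 * pi}"
      by (intro integrable_continuous_real continuous_intros cAz)
    have "D = of_real (integral {0..2 * pi} (\<lambda>\<phi>. cos \<phi> * Re (Kp (0 + circ r \<phi>)) + sin \<phi> * (- Im (Kp (0 + circ r \<phi>)))))"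
      unfolding D_def \<open>k = 0\<close> using integral_linear[OF int bounded_linear_of_real] by (simp add: o_def)
    then show "Im D = 0" by simp
  qed
qed

text \<open>For \<open>k \<ge> 1\<close> the pressure coefficient is zero. For \<open>k = 0\<close> it is real, hence \<open>i\<close> times it is
  imaginary, and it disappears on taking real parts of an identity whose left-hand side is real.\<close>

lemma robin_vorticity_nonneg:
  assumes t: "0 < t"
  shows "robin_condition_at r0 (real k) (vorticity_coeff (int k) t)"
proof -
  define D where "D r = vector_derivative (vorticity_coeff (int k) t) (at r)" for r
  have D: "(vorticity_coeff (int k) t has_vector_derivative D r) (at r)"
    "of_real r * D r + of_int (int k) * vorticity_coeff (int k) t r = \<i> * (flux_coeff (int k) t r - pressure_coeff (int k) t r)"
    "int k = 0 \<Longrightarrow> Im (D r) = 0" if r: "r0 < r" for r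
  proof -
    obtain D' where D': "(vorticity_coeff (int k) t has_vector_derivative D') (at r)"
      "of_real r * D' + of_int (int k) * vorticity_coeff (int k) t r = \<i> * (flux_coeff (int k) t r - pressure_coeff (int k) t r)"
      "int k = 0 \<Longrightarrow> Im D' = 0"
      by (rule vorticity_coeff_derivative[OF t r, of "int k"]) (rule that, assumption, assumption, blast)
    moreover have "D r = D'" unfolding D_def by (rule vector_derivative_at[OF D'(1)])
    ultimately show "(vorticity_coeff (int k) t has_vector_derivative D r) (at r)"
      "of_real r * D r + of_int (int k) * vorticity_coeff (int k) t r = \<i> * (flux_coeff (int k) t r - pressure_coeff (int k) t r)"
      "int k = 0 \<Longrightarrow> Im (D r) = 0" by simp_all
  qed
  show ?thesis
  proof (cases "k = 0")
    case False
    have E: "of_real r * D r + of_nat k * vorticity_coeff (int k) t r = \<i> * flux_coeff (int k) t r" if "r0 < r" for r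
      using D(2)[OF that] pressure_coeff_zero[OF t that, of k] False by simp
    show ?thesis
    proof (rule robin_condition_of_limit[OF r0 D(1) E])
      show "continuous_on {r0<..} (\<lambda>r. \<i> * flux_coeff (int k) t r)"
        by (intro continuous_intros flux_coeff_continuous t)
      show "((\<lambda>r. \<i> * flux_coeff (int k) t r) \<longlongrightarrow> 0) (at_right r0)"
        by (rule tendsto_mult_right_zero[OF flux_coeff_tendsto[OF t]])
    qed
  next
    case True
    have E: "of_real r * D r + of_nat k * vorticity_coeff (int k) t r = of_real (Re (\<i> * flux_coeff (int k) t r))" if "r0 < r" for r
    proof -
      have "of_real r * D r = \<i> * (flux_coeff (int k) t r - pressure_coeff (int k) t r)"
        using D(2)[OF that] True by simp
      moreover have "Im (D r) = 0" using D(3)[OF that] True by simp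
      moreover have "Im (pressure_coeff (int k) t r) = 0" using pressure_mean_real[OF t that] True by simp
      ultimately show ?thesis using True by (simp add: complex_eq_iff)
    qed
    show ?thesis
    proof (rule robin_condition_of_limit[OF r0 D(1) E])
      show "continuous_on {r0<..} (\<lambda>r. of_real (Re (\<i> * flux_coeff (int k) t r)) :: complex)"
        by (intro continuous_intros flux_coeff_continuous t)
      have "((\<lambda>r. \<i> * flux_coeff (int k) t r) \<longlongrightarrow> 0) (at_right r0)"
        by (rule tendsto_mult_right_zero[OF flux_coeff_tendsto[OF t]])
      from tendsto_of_real[OF tendsto_Re[OF this]]
      show "((\<lambda>r. of_real (Re (\<i> * flux_coeff (int k) t r)) :: complex) \<longlongrightarrow> 0) (at_right r0)" by simp
    qed
  qed
qed

lemma robin_vorticity: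
  assumes t: "0 < t"
  shows "robin_condition_at r0 (of_int \<bar>k\<bar>) (vorticity_coeff k t)"
proof (cases "k \<ge> 0")
  case True
  then show ?thesis using robin_vorticity_nonneg[OF t, of "nat k"] by simp
next
  case False
  have "vorticity_coeff k t = (\<lambda>r. cnj (vorticity_coeff (int (nat (- k))) t r))"
  proof
    fix r
    have "int (nat (- k)) = - k" using False by simp
    then show "vorticity_coeff k t r = cnj (vorticity_coeff (int (nat (- k))) t r)"
      by (simp only: vorticity_coeff_def integral_cnj complex_cnj_mult complex_cnj_complex_of_real cis_cnj of_int_minus mult_minus_left minus_minus)
  qed
  then show ?thesis
    using robin_condition_cnj[OF robin_vorticity_nonneg[OF t, of "nat (- k)"]] False by simp
qed

end

section \<open>From classical solutions to Stokes fields\<close>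

lemma pd_eq:
  assumes "(f has_derivative f') (at x)"
  shows "pd e f x = f' e"
proof -
  have "((\<lambda>s. x + s *\<^sub>R e) has_vector_derivative e) (at 0)"
    unfolding has_vector_derivative_def by (auto intro!: derivative_eq_intros)
  moreover have "(f has_derivative f') (at (x + 0 *\<^sub>R e) within range (\<lambda>s. x + s *\<^sub>R e))"
    using assms by (simp add: has_derivative_at_withinI)
  ultimately have "((\<lambda>s. f (x + s *\<^sub>R e)) has_vector_derivative f' e) (at 0)"
    using vector_derivative_diff_chain_within[of "\<lambda>s. x + s *\<^sub>R e" e 0 UNIV f f'] by (simp add: o_def)
  then show ?thesis unfolding pd_def by (rule vector_derivative_at)
qed

lemma pd_has_derivative:
  fixes f :: "complex \<Rightarrow> 'a::real_normed_vector"
  assumes "f differentiable_on S" "open S" "x \<in> S"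
  shows "has_partials f (pd 1 f x) (pd \<i> f x) x"
proof -
  have "f differentiable (at x)" using assms by (simp add: differentiable_on_eq_differentiable_at)
  then obtain f' where f': "(f has_derivative f') (at x)" by (auto simp: differentiable_def)
  interpret linear f' using f' by (rule has_derivative_linear)
  have "f' = (\<lambda>e. Re e *\<^sub>R pd 1 f x + Im e *\<^sub>R pd \<i> f x)"
  proof
    fix e
    have "e = Re e *\<^sub>R 1 + Im e *\<^sub>R \<i>" by (simp add: complex_eq_iff)
    then have "f' e = Re e *\<^sub>R f' 1 + Im e *\<^sub>R f' \<i>" by (metis add scale)
    then show "f' e = Re e *\<^sub>R pd 1 f x + Im e *\<^sub>R pd \<i> f x" by (simp add: pd_eq[OF f'])
  qed
  then show ?thesis using f' by simp
qed

text \<open>Differentiate \<open>f (x + s + i u) - f (x + s)\<close>, written as an integral of \<open>pd \<i> f\<close> over \<open>{0..u}\<close>,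
  in \<open>s\<close> at \<open>0\<close>, and then in \<open>u\<close> at \<open>0\<close>.\<close>

lemma mixed_partials_eq:
  fixes f :: "complex \<Rightarrow> complex"
  assumes S: "open S" "x \<in> S"
    and df: "f differentiable_on S" and d1: "pd 1 f differentiable_on S" and d2: "pd \<i> f differentiable_on S"
    and c: "continuous_on S (pd 1 (pd \<i> f))"
  shows "pd \<i> (pd 1 f) x = pd 1 (pd \<i> f) x"
proof -
  obtain e where e: "e > 0" "ball x (2 * e) \<subseteq> S"
  proof -
    obtain e' where "e' > 0" "ball x e' \<subseteq> S" using S open_contains_ball by blast
    then show ?thesis using that[of "e' / 2"] by simp
  qed
  define X where "X s y = x + of_real s + \<i> * of_real y" for s y :: real
  have X: "X s y \<in> S" if "s \<in> {-e<..<e}" "y \<in> {0..e/2}" for s y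
  proof -
    have "norm (of_real s + \<i> * of_real y :: complex) \<le> \<bar>s\<bar> + \<bar>y\<bar>"
      using norm_triangle_ineq[of "of_real s :: complex" "\<i> * of_real y"] by (simp add: norm_mult)
    also have "\<dots> < 2 * e" using that by auto
    finally have "dist (X s y) x < 2 * e" by (simp add: X_def dist_norm add.assoc)
    then have "X s y \<in> ball x (2 * e)" by (simp add: dist_commute)
    then show ?thesis using e by blast
  qed
  note D = pd_has_derivative[OF df S(1)] pd_has_derivative[OF d1 S(1)] pd_has_derivative[OF d2 S(1)]
  have Xs: "((\<lambda>s. X s y) has_vector_derivative 1) (at s within T)" and Xy: "((\<lambda>y. X s y) has_vector_derivative \<i>) (at y within T)" for s y T
    unfolding X_def has_vector_derivative_def by (auto intro!: derivative_eq_intros simp: scaleR_conv_of_real)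
  have along_s: "((\<lambda>s. G (X s y)) has_vector_derivative pd 1 G (X s y)) (at s within T)"
    if "\<And>x. x \<in> S \<Longrightarrow> has_partials G (pd 1 G x) (pd \<i> G x) x" "X s y \<in> S" for G :: "complex \<Rightarrow> complex" and s y T
    using vector_derivative_diff_chain_within[OF Xs has_derivative_at_withinI[OF that(1)[OF that(2)]]] by (simp add: o_def)
  have along_y: "((\<lambda>y. G (X s y)) has_vector_derivative pd \<i> G (X s y)) (at y within T)"
    if "\<And>x. x \<in> S \<Longrightarrow> has_partials G (pd 1 G x) (pd \<i> G x) x" "X s y \<in> S" for G :: "complex \<Rightarrow> complex" and s y T
    using vector_derivative_diff_chain_within[OF Xy has_derivative_at_withinI[OF that(1)[OF that(2)]]] by (simp add: o_def)
  have cX: "continuous_on (T1 \<times> T2) (\<lambda>q. X (fst q) (snd q))" for T1 T2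
    unfolding X_def by (intro continuous_intros)
  have cX1: "continuous_on T (\<lambda>y. X s y)" for T s unfolding X_def by (intro continuous_intros)
  have c2: "continuous_on S (pd \<i> f)" by (rule differentiable_imp_continuous_on[OF d2])
  have key: "pd 1 f (X 0 u) - pd 1 f (X 0 0) = integral {0..u} (\<lambda>y. pd 1 (pd \<i> f) (X 0 y))" if u: "u \<in> {0..e/2}" for u
  proof -
    have X': "X s y \<in> S" if "s \<in> {-e<..<e}" "y \<in> {0..u}" for s y using X[of s y] that u by auto
    have ftc: "integral (cbox 0 u) (\<lambda>y. pd \<i> f (X s y)) = f (X s u) - f (X s 0)" if "s \<in> {-e<..<e}" for s
    proof -
      have "((\<lambda>y. pd \<i> f (X s y)) has_integral f (X s u) - f (X s 0)) {0..u}"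
        by (rule fundamental_theorem_of_calculus) (use u that in \<open>auto intro!: along_y D(1) X'\<close>)
      then show ?thesis by (simp add: integral_unique cbox_interval)
    qed
    have "((\<lambda>s. integral (cbox 0 u) (\<lambda>y. pd \<i> f (X s y))) has_vector_derivative integral (cbox 0 u) (\<lambda>y. pd 1 (pd \<i> f) (X 0 y))) (at 0 within {-e<..<e})"
    proof (rule leibniz_rule_vector_derivative)
      show "((\<lambda>s. pd \<i> f (X s y)) has_vector_derivative pd 1 (pd \<i> f) (X s y)) (at s within {-e<..<e})"
        if "s \<in> {-e<..<e}" "y \<in> cbox 0 u" for s y
        using that by (intro along_s D(3) X') (auto simp: cbox_interval)
      show "(\<lambda>y. pd \<i> f (X s y)) integrable_on cbox 0 u" if "s \<in> {-e<..<e}" for s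
        by (intro integrable_continuous continuous_on_compose2[OF c2 cX1]) (use X' that in \<open>auto simp: cbox_interval\<close>)
      show "continuous_on ({-e<..<e} \<times> cbox 0 u) (\<lambda>(s, y). pd 1 (pd \<i> f) (X s y))"
        unfolding split_def by (intro continuous_on_compose2[OF c cX]) (use X' in \<open>auto simp: cbox_interval\<close>)
    qed (use e in auto)
    then have "((\<lambda>s. f (X s u) - f (X s 0)) has_vector_derivative integral (cbox 0 u) (\<lambda>y. pd 1 (pd \<i> f) (X 0 y))) (at 0 within {-e<..<e})"
      by (rule has_vector_derivative_transform[rotated 2]) (use e ftc in auto)
    moreover have "((\<lambda>s. f (X s u) - f (X s 0)) has_vector_derivative pd 1 f (X 0 u) - pd 1 f (X 0 0)) (at 0 within {-e<..<e})"
      using u e by (intro has_vector_derivative_diff along_s D(1) X') auto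
    moreover have "at (0::real) within {-e<..<e} = at 0" using e by (intro at_within_open) auto
    ultimately show ?thesis using vector_derivative_unique_at by (metis cbox_interval)
  qed
  have "((\<lambda>u. integral {0..u} (\<lambda>y. pd 1 (pd \<i> f) (X 0 y))) has_vector_derivative pd 1 (pd \<i> f) (X 0 0)) (at 0 within {0..e/2})"
    by (rule integral_has_vector_derivative) (use e X in \<open>auto intro!: continuous_on_compose2[OF c cX1]\<close>)
  then have "((\<lambda>u. pd 1 f (X 0 u) - pd 1 f (X 0 0)) has_vector_derivative pd 1 (pd \<i> f) (X 0 0)) (at 0 within {0..e/2})"
    by (rule has_vector_derivative_transform[rotated 2]) (use e key in auto)
  moreover have "((\<lambda>u. pd 1 f (X 0 u) - pd 1 f (X 0 0)) has_vector_derivative pd \<i> (pd 1 f) (X 0 0) - 0) (at 0 within {0..e/2})"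
    using e by (intro has_vector_derivative_diff along_y D(2) X has_vector_derivative_const) auto
  ultimately have "pd 1 (pd \<i> f) (X 0 0) = pd \<i> (pd 1 f) (X 0 0) - 0"
    by (rule vector_derivative_unique_within[rotated]) (use e in \<open>simp add: trivial_limit_within islimpt_Icc\<close>)
  then show ?thesis by (simp add: X_def)
qed

text \<open>The gradient of the divergence vanishes and mixed second derivatives commute; this turns the
  Laplacian of the velocity into the rotated gradient of the vorticity and the Stokes equation
  into its complex form.\<close>

lemma stokes_solution_field:
  assumes op: "open \<Omega>" and sol: "stokes_solution \<Omega> v0 v_inf v p"
  defines "\<kappa> \<equiv> \<lambda>t x. Complex (Im (pd 1 (pd 1 (v t)) x) - Re (pd 1 (pd \<i> (v t)) x)) (- (Im (pd \<i> (pd 1 (v t)) x) - Re (pd \<i> (pd \<i> (v t)) x)))"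
  shows "stokes_field \<Omega> v (\<lambda>t. pd 1 (v t)) (\<lambda>t. pd \<i> (v t)) (time_deriv v) \<kappa> (\<lambda>t x. cnj (grad (p t) x)) (\<lambda>t. curl (v t)) p v_inf"
proof -
  have reg: "stokes_regular \<Omega> v p" and eqn: "\<And>t x. t > 0 \<Longrightarrow> x \<in> \<Omega> \<Longrightarrow> time_deriv v t x - laplacian (v t) x = grad (p t) x"
    and div0: "\<And>t x. t > 0 \<Longrightarrow> x \<in> \<Omega> \<Longrightarrow> divergence (v t) x = 0"
    and inf: "\<And>t. t > 0 \<Longrightarrow> (v t \<longlongrightarrow> v_inf) at_infinity"
    using sol unfolding stokes_solution_def by blast+
  have sub: "{0<..} \<times> \<Omega> \<subseteq> {0<..} \<times> closure \<Omega>" using closure_subset by blast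
  have cv: "cont_field \<Omega> v" and cvt: "continuous_on ({0<..} \<times> \<Omega>) (\<lambda>(t, x). time_deriv v t x)"
    using reg sub unfolding stokes_regular_def by (auto intro: continuous_on_subset)
  have dt: "(\<lambda>s. v s x) differentiable (at t)" if "t > 0" "x \<in> \<Omega>" for t x
    using reg that closure_subset unfolding stokes_regular_def by blast
  have dv: "v t differentiable_on \<Omega>" and dp: "p t differentiable_on \<Omega>" if "t > 0" for t
    using reg that unfolding stokes_regular_def by blast+
  have dpd: "pd 1 (v t) differentiable_on \<Omega>" "pd \<i> (v t) differentiable_on \<Omega>" if "t > 0" for t
    using reg that unfolding stokes_regular_def by blast+
  have c1: "continuous_on ({0<..} \<times> \<Omega>) (\<lambda>(t, x). pd 1 (v t) x)" "continuous_on ({0<..} \<times> \<Omega>) (\<lambda>(t, x). pd \<i> (v t) x)"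
    using reg unfolding stokes_regular_def by blast+
  have c2: "continuous_on ({0<..} \<times> \<Omega>) (\<lambda>(t, x). pd 1 (pd 1 (v t)) x)" "continuous_on ({0<..} \<times> \<Omega>) (\<lambda>(t, x). pd \<i> (pd 1 (v t)) x)"
      "continuous_on ({0<..} \<times> \<Omega>) (\<lambda>(t, x). pd 1 (pd \<i> (v t)) x)" "continuous_on ({0<..} \<times> \<Omega>) (\<lambda>(t, x). pd \<i> (pd \<i> (v t)) x)"
    using reg unfolding stokes_regular_def by blast+
  have vd: "has_partials (v t) (pd 1 (v t) x) (pd \<i> (v t) x) x" if "t > 0" "x \<in> \<Omega>" for t x
    by (rule pd_has_derivative[OF dv[OF that(1)] op that(2)])
  have Im_d: "((\<lambda>y. Im (F y)) has_derivative (\<lambda>e. Im (Re e *\<^sub>R A + Im e *\<^sub>R B))) (at x)"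
    and Re_d: "((\<lambda>y. Re (F y)) has_derivative (\<lambda>e. Re (Re e *\<^sub>R A + Im e *\<^sub>R B))) (at x)"
    if "has_partials F A B x" for F A B x
    using bounded_linear.has_derivative[OF bounded_linear_Im that] bounded_linear.has_derivative[OF bounded_linear_Re that] by auto
  have div1: "Re (pd 1 (v t) x) + Im (pd \<i> (v t) x) = 0" and cu: "curl (v t) x = Im (pd 1 (v t) x) - Re (pd \<i> (v t) x)"
    if "t > 0" "x \<in> \<Omega>" for t x
    using div0[OF that] pd_eq[OF Re_d[OF vd[OF that]], of 1] pd_eq[OF Im_d[OF vd[OF that]], of \<i>]
      pd_eq[OF Im_d[OF vd[OF that]], of 1] pd_eq[OF Re_d[OF vd[OF that]], of \<i>]
    by (simp_all add: divergence_def curl_def)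
  have curld: "(curl (v t) has_derivative (\<lambda>e. Re (\<kappa> t x * e))) (at x)" if t: "t > 0" and x: "x \<in> \<Omega>" for t x
  proof -
    have "((\<lambda>x. Im (pd 1 (v t) x) - Re (pd \<i> (v t) x)) has_derivative
        (\<lambda>e. Im (Re e *\<^sub>R pd 1 (pd 1 (v t)) x + Im e *\<^sub>R pd \<i> (pd 1 (v t)) x) - Re (Re e *\<^sub>R pd 1 (pd \<i> (v t)) x + Im e *\<^sub>R pd \<i> (pd \<i> (v t)) x))) (at x)"
      by (intro has_derivative_diff Im_d Re_d pd_has_derivative[OF dpd(1)[OF t] op x] pd_has_derivative[OF dpd(2)[OF t] op x])
    then have "(curl (v t) has_derivative
        (\<lambda>e. Im (Re e *\<^sub>R pd 1 (pd 1 (v t)) x + Im e *\<^sub>R pd \<i> (pd 1 (v t)) x) - Re (Re e *\<^sub>R pd 1 (pd \<i> (v t)) x + Im e *\<^sub>R pd \<i> (pd \<i> (v t)) x))) (at x)"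
      by (rule has_derivative_transform_within_open[OF _ op x]) (simp add: cu[OF t])
    moreover have "(\<lambda>e. Im (Re e *\<^sub>R pd 1 (pd 1 (v t)) x + Im e *\<^sub>R pd \<i> (pd 1 (v t)) x) - Re (Re e *\<^sub>R pd 1 (pd \<i> (v t)) x + Im e *\<^sub>R pd \<i> (pd \<i> (v t)) x))
        = (\<lambda>e. Re (\<kappa> t x * e))"
      by (rule ext) (simp add: \<kappa>_def algebra_simps)
    ultimately show ?thesis by simp
  qed
  have heq: "cnj (grad (p t) x) = cnj (time_deriv v t x) + \<i> * \<kappa> t x" if t: "t > 0" and x: "x \<in> \<Omega>" for t x
  proof -
    let ?L = "\<lambda>e. Re (Re e *\<^sub>R pd 1 (pd 1 (v t)) x + Im e *\<^sub>R pd \<i> (pd 1 (v t)) x) + Im (Re e *\<^sub>R pd 1 (pd \<i> (v t)) x + Im e *\<^sub>R pd \<i> (pd \<i> (v t)) x)"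
    have "((\<lambda>x. Re (pd 1 (v t) x) + Im (pd \<i> (v t) x)) has_derivative ?L) (at x)"
      by (intro has_derivative_add Im_d Re_d pd_has_derivative[OF dpd(1)[OF t] op x] pd_has_derivative[OF dpd(2)[OF t] op x])
    moreover have "((\<lambda>x. Re (pd 1 (v t) x) + Im (pd \<i> (v t) x)) has_derivative (\<lambda>_. 0)) (at x)"
      by (rule has_derivative_transform_within_open[OF has_derivative_const[of 0] op x]) (simp add: div1[OF t])
    ultimately have L0: "?L = (\<lambda>_. 0)" by (rule has_derivative_unique)
    have d: "Re (pd 1 (pd 1 (v t)) x) + Im (pd 1 (pd \<i> (v t)) x) = 0" "Re (pd \<i> (pd 1 (v t)) x) + Im (pd \<i> (pd \<i> (v t)) x) = 0"
      using fun_cong[OF L0, of 1] fun_cong[OF L0, of \<i>] by simp_all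
    have "continuous_on \<Omega> (pd 1 (pd \<i> (v t)))"
    proof -
      have "continuous_on \<Omega> (\<lambda>x. case (t, x) of (t, x) \<Rightarrow> pd 1 (pd \<i> (v t)) x)"
        by (rule continuous_on_compose2[OF c2(3)]) (use t in \<open>auto intro!: continuous_intros\<close>)
      then show ?thesis by simp
    qed
    then have mix: "pd \<i> (pd 1 (v t)) x = pd 1 (pd \<i> (v t)) x"
      by (rule mixed_partials_eq[OF op x dv[OF t] dpd[OF t]])
    have "cnj (laplacian (v t) x) = - \<i> * \<kappa> t x"
      using d unfolding laplacian_def \<kappa>_def complex_eq_iff by (simp add: mix)
    then show ?thesis unfolding eqn[OF t x, symmetric] by simp
  qed
  have ck: "continuous_on ({0<..} \<times> \<Omega>) (\<lambda>(t, x). \<kappa> t x)"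
    using c2 unfolding \<kappa>_def split_def by (intro continuous_intros)
  show ?thesis
  proof
    show "open \<Omega>" by fact
    show "(p t has_derivative (\<lambda>e. Re (cnj (grad (p t) x) * e))) (at x)" if "0 < t" "x \<in> \<Omega>" for t x
    proof -
      have "(\<lambda>e. Re (cnj (grad (p t) x) * e)) = (\<lambda>e. Re e *\<^sub>R pd 1 (p t) x + Im e *\<^sub>R pd \<i> (p t) x)"
        by (rule ext) (simp add: grad_def)
      then show ?thesis using pd_has_derivative[OF dp[OF that(1)] op that(2)] by simp
    qed
    show "((\<lambda>s. v s x) has_vector_derivative time_deriv v t x) (at t)" if "0 < t" "x \<in> \<Omega>" for t x
      using dt[OF that] unfolding time_deriv_def by (simp add: vector_derivative_works)
  qed (use vd cv c1 div1 cu curld ck heq cvt inf in auto)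
qed

section \<open>The exterior of a piecewise smooth Jordan domain\<close>

lemma regular_arc_lipschitz:
  assumes "regular_arc_on a b g"
  obtains K where "K \<ge> 0" "\<And>s t. s \<in> {a..b} \<Longrightarrow> t \<in> {a..b} \<Longrightarrow> dist (g s) (g t) \<le> K * dist s t"
proof -
  obtain g' where g': "\<And>s. s \<in> {a..b} \<Longrightarrow> (g has_vector_derivative g' s) (at s within {a..b})" "continuous_on {a..b} g'"
    using assms unfolding regular_arc_on_def by blast
  have "bounded (g' ` {a..b})" by (intro compact_imp_bounded compact_continuous_image g') auto
  then obtain K where K: "K > 0" "\<And>s. s \<in> {a..b} \<Longrightarrow> norm (g' s) \<le> K"
    unfolding bounded_pos by blast
  have "dist (g s) (g t) \<le> K * dist s t" if "s \<in> {a..b}" "t \<in> {a..b}" for s t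
    unfolding dist_norm
  proof (rule differentiable_bound[of "{a..b}" g "\<lambda>s h. h *\<^sub>R g' s"])
    show "(g has_derivative (\<lambda>h. h *\<^sub>R g' s)) (at s within {a..b})" if "s \<in> {a..b}" for s
      using g'(1)[OF that] by (simp add: has_vector_derivative_def)
    show "onorm (\<lambda>h. h *\<^sub>R g' s) \<le> K" if "s \<in> {a..b}" for s
      using K that by (intro onorm_bound) (auto simp: mult.commute[of K] intro!: mult_left_mono)
  qed (use that in auto)
  then show ?thesis using that K(1) by (meson less_imp_le)
qed

lemma piecewise_smooth_lipschitz:
  assumes "piecewise_smooth_path g"
  obtains K where "\<And>s t. s \<in> {0..1} \<Longrightarrow> t \<in> {0..1} \<Longrightarrow> dist (g s) (g t) \<le> K * dist s t"
proof -
  obtain n :: nat and \<tau> where \<tau>: "\<tau> 0 = 0" "\<tau> n = 1" "\<And>i. i < n \<Longrightarrow> \<tau> i < \<tau> (Suc i)" "\<And>i. i < n \<Longrightarrow> regular_arc_on (\<tau> i) (\<tau> (Suc i)) g"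
    using assms unfolding piecewise_smooth_path_def by blast
  have "\<exists>K\<ge>0. \<forall>s\<in>{0..\<tau> m}. \<forall>t\<in>{0..\<tau> m}. dist (g s) (g t) \<le> K * dist s t" if "m \<le> n" for m
    using that
  proof (induction m)
    case 0 then show ?case using \<tau>(1) by auto
  next
    case (Suc m)
    then obtain K1 where K1: "K1 \<ge> 0" "\<And>s t. s \<in> {0..\<tau> m} \<Longrightarrow> t \<in> {0..\<tau> m} \<Longrightarrow> dist (g s) (g t) \<le> K1 * dist s t" by auto
    obtain K2 where K2: "K2 \<ge> 0" "\<And>s t. s \<in> {\<tau> m..\<tau> (Suc m)} \<Longrightarrow> t \<in> {\<tau> m..\<tau> (Suc m)} \<Longrightarrow> dist (g s) (g t) \<le> K2 * dist s t"
      using regular_arc_lipschitz[OF \<tau>(4)[of m]] Suc by auto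
    define K where "K = max K1 K2"
    have Km: "K1 * d \<le> K * d" "K2 * d \<le> K * d" if "d \<ge> 0" for d
      using that by (auto simp: K_def mult_right_mono)
    have *: "dist (g s) (g t) \<le> K * dist s t" if st: "s \<le> t" "s \<in> {0..\<tau> (Suc m)}" "t \<in> {0..\<tau> (Suc m)}" for s t
    proof -
      consider "t \<le> \<tau> m" | "\<tau> m \<le> s" | "s \<le> \<tau> m" "\<tau> m \<le> t" using st by linarith
      then show ?thesis
      proof cases
        case 1 then show ?thesis using K1(2)[of s t] Km(1)[of "dist s t"] st by auto
      next
        case 2 then show ?thesis using K2(2)[of s t] Km(2)[of "dist s t"] st by auto
      next
        case 3
        have "dist (g s) (g t) \<le> dist (g s) (g (\<tau> m)) + dist (g (\<tau> m)) (g t)" by (rule dist_triangle)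
        also have "\<dots> \<le> K * dist s (\<tau> m) + K * dist (\<tau> m) t"
          using K1(2)[of s "\<tau> m"] Km(1)[of "dist s (\<tau> m)"] K2(2)[of "\<tau> m" t] Km(2)[of "dist (\<tau> m) t"] st 3 by auto
        also have "\<dots> = K * dist s t" using 3 by (simp add: dist_real_def distrib_left[symmetric])
        finally show ?thesis .
      qed
    qed
    have "dist (g s) (g t) \<le> K * dist s t" if "s \<in> {0..\<tau> (Suc m)}" "t \<in> {0..\<tau> (Suc m)}" for s t
      using *[of s t] *[of t s] that by (cases "s \<le> t") (auto simp: dist_commute)
    moreover have "K \<ge> 0" using K1(1) by (simp add: K_def)
    ultimately show ?case by blast
  qed
  from this[of n] obtain K where "\<forall>s\<in>{0..1}. \<forall>t\<in>{0..1}. dist (g s) (g t) \<le> K * dist s t" using \<tau>(2) by auto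
  then show ?thesis using that by blast
qed

text \<open>A connected set that meets \<open>B\<close> but not its frontier lies in \<open>B\<close>. This excludes the unbounded
  component of the complement of the curve and gives \<open>B = inside (path_image g)\<close>.\<close>

lemma Jordan_domain_exterior:
  fixes g :: "real \<Rightarrow> complex"
  assumes g: "simple_path g" "pathfinish g = pathstart g"
    and B: "open B" "connected B" "bounded B" "B \<noteq> {}" and fr: "frontier B = path_image g"
  shows "- closure B = outside (path_image g)"
proof -
  let ?J = "path_image g"
  note JC = Jordan_inside_outside[OF g]
  have disj: "B \<inter> ?J = {}" using B(1) fr by (metis frontier_disjoint_eq inf_commute)
  have whole: "C \<subseteq> B" if C: "connected C" "C \<inter> ?J = {}" "C \<inter> B \<noteq> {}" for C
    using connected_Int_frontier[OF C(1), of B] C fr by blast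
  have "outside ?J \<inter> B = {}"
  proof (rule ccontr)
    assume "outside ?J \<inter> B \<noteq> {}"
    then have "outside ?J \<subseteq> B" using JC by (intro whole) (auto simp: outside_no_overlap)
    then show False using JC B(3) bounded_subset by blast
  qed
  then have "B \<subseteq> inside ?J" using disj inside_Un_outside[of ?J] by blast
  moreover have "inside ?J \<subseteq> B"
    using JC B(4) \<open>B \<subseteq> inside ?J\<close> by (intro whole) (auto simp: inside_no_overlap)
  ultimately have "B = inside ?J" by simp
  then have "closure B = inside ?J \<union> ?J" using fr closure_Un_frontier[of B] by simp
  then show ?thesis using inside_Un_outside[of ?J] inside_Int_outside[of ?J] outside_no_overlap[of ?J] by blast
qed

text \<open>The inverse is holomorphic as the inverse of an injective holomorphic map; the series controls
  it at infinity, because its absolute convergence on one circle bounds \<open>\<Psi> z - z\<close> outside that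
  circle.\<close>

lemma riemann_map_exterior_conformal:
  assumes r0: "r0 > 0" and g: "simple_path g" "pathfinish g = pathstart g"
    and \<Omega>: "\<Omega> = outside (path_image g)"
    and rm: "riemann_map_onto_exterior \<Omega> r0 \<Phi>"
    and summ: "\<And>z. z \<in> exterior_disc r0 \<Longrightarrow> summable (\<lambda>n. norm (b (Suc n) / z ^ Suc n))"
    and series: "\<And>z. z \<in> exterior_disc r0 \<Longrightarrow> inv_into \<Omega> \<Phi> z = z + (\<Sum>n. b (Suc n) / z ^ Suc n)"
  shows "exterior_conformal \<Omega> (path_image g) r0 \<Phi> (inv_into \<Omega> \<Phi>)"
proof -
  let ?J = "path_image g" and ?\<Psi> = "inv_into \<Omega> \<Phi>"
  note JC = Jordan_inside_outside[OF g]
  have hol: "\<Phi> holomorphic_on \<Omega>" and bij: "bij_betw \<Phi> \<Omega> (exterior_disc r0)"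
    and bigO: "(\<lambda>z. \<Phi> z - z) \<in> O[at_infinity](\<lambda>z. 1 / z)"
    using rm unfolding riemann_map_onto_exterior_def by auto
  have inj: "inj_on \<Phi> \<Omega>" and img: "\<Phi> ` \<Omega> = exterior_disc r0" using bij by (auto simp: bij_betw_def)
  have op: "open \<Omega>" using JC \<Omega> by blast
  have inv1: "?\<Psi> z \<in> \<Omega>" "\<Phi> (?\<Psi> z) = z" if "r0 < norm z" for z
    using that img by (auto simp: exterior_disc_def inv_into_into f_inv_into_f)
  show ?thesis
  proof
    show "0 < r0" "open \<Omega>" by fact+
    show "compact ?J" using g by (simp add: compact_simple_path_image)
    show "?J \<inter> \<Omega> = {}" unfolding \<Omega> using outside_no_overlap by blast
    show "closure \<Omega> = \<Omega> \<union> ?J" using JC closure_Un_frontier[of \<Omega>] \<Omega> by simp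
    show "continuous_on \<Omega> \<Phi>" by (rule holomorphic_on_imp_continuous_on[OF hol])
    show "?\<Psi> holomorphic_on exterior_disc r0"
    proof -
      obtain G where G: "G holomorphic_on (\<Phi> ` \<Omega>)" "\<And>z. z \<in> \<Omega> \<Longrightarrow> G (\<Phi> z) = z"
        using holomorphic_has_inverse[OF hol op inj] by metis
      have "?\<Psi> z = G z" if "z \<in> exterior_disc r0" for z
        using G(2)[of "?\<Psi> z"] inv1[of z] that by (auto simp: exterior_disc_def)
      then show ?thesis using G(1) holomorphic_cong[of "exterior_disc r0" "exterior_disc r0" ?\<Psi> G] img by auto
    qed
    show "?\<Psi> z \<in> \<Omega>" "\<Phi> (?\<Psi> z) = z" if "r0 < norm z" for z using inv1[OF that] by auto
    show "r0 < norm (\<Phi> x)" if "x \<in> \<Omega>" for x using that img by (auto simp: exterior_disc_def)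
    show "?\<Psi> (\<Phi> x) = x" if "x \<in> \<Omega>" for x using inj that by simp
    show "filterlim \<Phi> at_infinity at_infinity"
    proof -
      have "((\<lambda>z::complex. 1 / z) \<longlongrightarrow> 0) at_infinity"
        using tendsto_inverse_0 by (simp add: divide_inverse)
      moreover obtain C where C: "\<forall>\<^sub>F z in at_infinity. norm (\<Phi> z - z) \<le> C * norm (1 / z)"
        using bigO by (elim landau_o.bigE)
      ultimately have "((\<lambda>z. \<Phi> z - z) \<longlongrightarrow> 0) at_infinity"
        by (intro Lim_null_comparison[OF C] tendsto_mult_right_zero tendsto_norm_zero)
      from tendsto_add_filterlim_at_infinity[OF this filterlim_ident] show ?thesis by simp
    qed
    show "((\<lambda>z. ?\<Psi> z / z) \<longlongrightarrow> 1) at_infinity"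
    proof -
      define \<rho> where "\<rho> = complex_of_real (2 * r0)"
      have \<rho>: "norm \<rho> = 2 * r0" "\<rho> \<in> exterior_disc r0" using r0 by (auto simp: \<rho>_def exterior_disc_def)
      define M where "M = (\<Sum>n. norm (b (Suc n) / \<rho> ^ Suc n))"
      have bd: "norm (?\<Psi> z - z) \<le> M" if z: "2 * r0 \<le> norm z" for z
      proof -
        have zin: "z \<in> exterior_disc r0" using z r0 by (simp add: exterior_disc_def)
        have "norm (?\<Psi> z - z) = norm (\<Sum>n. b (Suc n) / z ^ Suc n)" using series[OF zin] by simp
        also have "\<dots> \<le> (\<Sum>n. norm (b (Suc n) / z ^ Suc n))" by (rule summable_norm[OF summ[OF zin]])
        also have "\<dots> \<le> M"
          unfolding M_def
        proof (rule suminf_le[OF _ summ[OF zin] summ[OF \<rho>(2)]])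
          show "norm (b (Suc n) / z ^ Suc n) \<le> norm (b (Suc n) / \<rho> ^ Suc n)" for n
            unfolding norm_divide norm_power \<rho>(1) using z r0 by (intro divide_left_mono power_mono mult_pos_pos zero_less_power) auto
        qed
        finally show ?thesis .
      qed
      have "((\<lambda>z. ?\<Psi> z / z - 1) \<longlongrightarrow> 0) at_infinity"
      proof (rule Lim_null_comparison)
        show "\<forall>\<^sub>F z in at_infinity. norm (?\<Psi> z / z - 1) \<le> M * norm (inverse z)"
          unfolding eventually_at_infinity
        proof (intro exI allI impI)
          fix z :: complex assume z: "2 * r0 \<le> norm z"
          then have "z \<noteq> 0" using r0 by auto
          then have "?\<Psi> z / z - 1 = (?\<Psi> z - z) * inverse z" by (simp add: field_simps)
          then show "norm (?\<Psi> z / z - 1) \<le> M * norm (inverse z)"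
            using bd[OF z] by (simp only: norm_mult) (intro mult_right_mono, auto)
        qed
        show "((\<lambda>z::complex. M * norm (inverse z)) \<longlongrightarrow> 0) at_infinity"
          by (rule tendsto_mult_right_zero[OF tendsto_norm_zero[OF tendsto_inverse_0]])
      qed
      then show ?thesis by (simp add: LIM_zero_iff)
    qed
  qed
qed

lemma robin_condition_scale:
  assumes "robin_condition_at r0 m f" "\<And>r. r0 < r \<Longrightarrow> f' r = c * f r"
  shows "robin_condition_at r0 m f'"
proof -
  obtain F F' where F: "\<forall>r>r0. F r = f r" "\<forall>r\<ge>r0. (F has_vector_derivative F' r) (at r within {r0..})"
    "continuous_on {r0..} F'" "of_real r0 * F' r0 + of_real m * F r0 = 0"
    using assms(1) unfolding robin_condition_at_def by blast
  have "of_real r0 * (c * F' r0) + of_real m * (c * F r0) = c * (of_real r0 * F' r0 + of_real m * F r0)"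
    by (simp add: algebra_simps)
  then have "of_real r0 * (c * F' r0) + of_real m * (c * F r0) = 0" using F(4) by simp
  then show ?thesis
    unfolding robin_condition_at_def
    using F assms(2) by (intro exI[of _ "\<lambda>r. c * F r"] exI[of _ "\<lambda>r. c * F' r"])
      (auto intro!: has_vector_derivative_mult_right continuous_intros)
qed

section \<open>Vorticity boundary condition\<close>

theorem theorem3p3:
  fixes B \<Omega> :: "complex set" and r0 :: real
    and \<Phi> :: "complex \<Rightarrow> complex" and b :: "nat \<Rightarrow> complex"
    and v_inf :: complex and v0 :: "complex \<Rightarrow> complex"
    and v :: "real \<Rightarrow> complex \<Rightarrow> complex" and p :: "real \<Rightarrow> complex \<Rightarrow> real"
    and w :: "real \<Rightarrow> complex \<Rightarrow> real"
  assumes "r0 > 0"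
    and "piecewise_smooth_domain B"
    and "\<Omega> = - closure B"
    and "riemann_map_onto_exterior \<Omega> r0 \<Phi>"
    and "\<And>z. z \<in> exterior_disc r0 \<Longrightarrow> summable (\<lambda>n. norm (b (Suc n) / z ^ Suc n))"
    and "\<And>z. z \<in> exterior_disc r0 \<Longrightarrow>
           inv_into \<Omega> \<Phi> z = z + (\<Sum>n. b (Suc n) / z ^ Suc n)"
    and "continuous_on (closure \<Omega>) v0"
    and "v0 differentiable_on \<Omega>"
    and "(\<lambda>z. curl v0 (inv_into \<Omega> \<Phi> z)) absolutely_integrable_on exterior_disc r0"
    and "\<And>x. x \<in> frontier \<Omega> \<Longrightarrow> v0 x = 0"
    and "(v0 \<longlongrightarrow> v_inf) at_infinity"
    and "((\<lambda>R. circulation v0 R) \<longlongrightarrow> 0) at_top"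
    and "stokes_solution \<Omega> v0 v_inf v p"
    and "\<And>t z. t > 0 \<Longrightarrow> z \<in> exterior_disc r0 \<Longrightarrow> w t z = curl (v t) (inv_into \<Omega> \<Phi> z)"
  shows "\<forall>t>0. \<forall>k::int.
           robin_condition_at r0 (of_int \<bar>k\<bar>) (\<lambda>r. angular_coeff k (w t) r)"
proof -
  obtain g where B: "B \<noteq> {}" "open B" "connected B" "bounded B" and g: "simple_path g" "pathfinish g = pathstart g"
    and pw: "piecewise_smooth_path g" and fr: "frontier B = path_image g"
    using assms(2) unfolding piecewise_smooth_domain_def by blast
  obtain K where K: "\<And>s t. s \<in> {0..1} \<Longrightarrow> t \<in> {0..1} \<Longrightarrow> dist (g s) (g t) \<le> K * dist s t"
    using piecewise_smooth_lipschitz[OF pw] by blast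
  have \<Omega>: "\<Omega> = outside (path_image g)"
    unfolding assms(3) by (rule Jordan_domain_exterior[OF g B(2,3,4,1) fr])
  let ?\<Psi> = "inv_into \<Omega> \<Phi>" and ?J = "path_image g"
  interpret E: exterior_conformal \<Omega> ?J r0 \<Phi> ?\<Psi>
    by (rule riemann_map_exterior_conformal[OF assms(1) g \<Omega> assms(4,5,6)])
  have fr\<Omega>: "frontier \<Omega> = ?J" using Jordan_inside_outside[OF g] \<Omega> by simp
  obtain R0 where R0: "\<And>x. x \<in> closure B \<Longrightarrow> norm x < R0"
    using B(4) by (metis bounded_closure bounded_pos_less)
  define \<kappa> where "\<kappa> = (\<lambda>t x. Complex (Im (pd 1 (pd 1 (v t)) x) - Re (pd 1 (pd \<i> (v t)) x)) (- (Im (pd \<i> (pd 1 (v t)) x) - Re (pd \<i> (pd \<i> (v t)) x))))"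
  interpret F: stokes_field \<Omega> v "\<lambda>t. pd 1 (v t)" "\<lambda>t. pd \<i> (v t)" "time_deriv v" \<kappa> "\<lambda>t x. cnj (grad (p t) x)" "\<lambda>t. curl (v t)" p v_inf
    unfolding \<kappa>_def by (rule stokes_solution_field[OF E.open_\<Omega> assms(13)])
  interpret S: stokes_exterior \<Omega> ?J r0 \<Phi> ?\<Psi> g K v "\<lambda>t. pd 1 (v t)" "\<lambda>t. pd \<i> (v t)" "time_deriv v" \<kappa>
      "\<lambda>t x. cnj (grad (p t) x)" "\<lambda>t. curl (v t)" p v_inf R0
  proof
    show "\<exists>\<delta>>0. \<forall>x\<in>\<Omega> \<inter> ball q \<delta>. \<forall>y\<in>\<Omega> \<inter> ball q \<delta>.
        \<exists>p. path p \<and> pathstart p = x \<and> pathfinish p = y \<and> path_image p \<subseteq> \<Omega> \<inter> ball q \<epsilon>"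
      if "q \<in> ?J" "\<epsilon> > 0" for q \<epsilon>
      using Jordan_exterior_locally_connected[OF g that] unfolding \<Omega> by metis
    show "?J = g ` {0..1}" by (simp add: path_image_def)
    show "dist (g s) (g t) \<le> K * dist s t" if "s \<in> {0..1}" "t \<in> {0..1}" for s t by (rule K[OF that])
    show "x \<in> \<Omega>" if "R0 \<le> norm x" for x using R0[of x] that assms(3) by auto
    have reg: "stokes_regular \<Omega> v p" and noslip: "\<And>t x. t > 0 \<Longrightarrow> x \<in> frontier \<Omega> \<Longrightarrow> v t x = 0"
      using assms(13) unfolding stokes_solution_def by blast+
    show "continuous_on (closure \<Omega>) (time_deriv v t)" if "0 < t" for t
    proof -
      have "continuous_on ({0<..} \<times> closure \<Omega>) (\<lambda>(t, x). time_deriv v t x)"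
        using reg unfolding stokes_regular_def by blast
      then have "continuous_on (closure \<Omega>) (\<lambda>x. case (t, x) of (t, x) \<Rightarrow> time_deriv v t x)"
        by (rule continuous_on_compose2) (use that in \<open>auto intro!: continuous_intros\<close>)
      then show ?thesis by simp
    qed
    show "time_deriv v t q = 0" if "0 < t" "q \<in> ?J" for t q
    proof -
      have "((\<lambda>s. v s q) has_vector_derivative 0) (at t)"
        by (rule has_vector_derivative_transform_within_open[of "\<lambda>_. 0" _ _ "{0<..}"])
          (use that noslip fr\<Omega> in auto)
      then show ?thesis unfolding time_deriv_def by (rule vector_derivative_at)
    qed
  qed
  show ?thesis
  proof (intro allI impI)
    fix t :: real and k :: int assume t: "t > 0"
    show "robin_condition_at r0 (of_int \<bar>k\<bar>) (\<lambda>r. angular_coeff k (w t) r)"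
    proof (rule robin_condition_scale[OF S.robin_vorticity[OF t, of k]])
      fix r assume "r0 < r"
      then have "w t (circ r \<phi>) = curl (v t) (?\<Psi> (circ r \<phi>))" for \<phi>
        by (intro assms(14) t S.in_ext)
      then show "angular_coeff k (w t) r = of_real (1 / (2 * pi)) * S.vorticity_coeff k t r"
        unfolding angular_coeff_def S.vorticity_coeff_def by simp
    qed
  qed
qed

end
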